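(* Let $f \colon \mathfrak{B}_d \to \mathfrak{B}_d$ be an nc-map with $f(0)=0$. Let $V(1) \subseteq \mathbb{C}^d$ be a linear subspace such that the set of fixed points of $f$ on the first level $\mathfrak{B}_d(1)$ is exactly $V(1) \cap \mathfrak{B}_d(1)$. Then the fixed points of $f$ are precisely all the points of $\mathfrak{B}_d$ that satisfy the linear relations of $V(1)$; that is, for every $n \ge 1$ and every $Z=(Z_1,\dots,Z_d) \in \mathfrak{B}_d(n)$, one has $f(Z)=Z$ if and only if $\sum_{j=1}^d a_j Z_j = 0$ for every $(a_1,\dots,a_d) \in \mathbb{C}^d$ such that $\sum_{j=1}^d a_j v_j = 0$ for all $(v_1,\dots,v_d) \in V(1)$.
   Context: $d$ is a positive integer. $\mathbb{M}_d = \bigsqcup_{n\ge 1} \mathbb{M}_d(n)$ with $\mathbb{M}_d(n) = M_n(\mathbb{C})^{d}$ ($d$-tuples of $n\times n$ complex matrices). The free (nc) ball is $\mathfrak{B}_d = \bigsqcup_{n\ge1} \mathfrak{B}_d(n)$, where $\mathfrak{B}_d(n)$ is the set of $X=(X_1,\dots,X_d)\in \mathbb{M}_d(n)$ with $\sum_{j=1}^d X_jX_j^* < I$; thus $\mathfrak{B}_d(1)$ is the open Euclidean unit ball of $\mathbb{C}^d$. Direct sums $X\oplus Y$ and similarities $S^{-1}XS$ ($S\in \mathrm{GL}_n(\mathbb{C})$) of tuples are taken coordinatewise. For $\Omega\subset\mathbb{M}_d$ closed under direct sums, a function $f\colon\Omega\to\mathbb{M}_1$ is an nc function if $f(\Omega(n))\subset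 \mathbb{M}_1(n)$ for all $n$, $f(X\oplus Y)=f(X)\oplus f(Y)$ for all $X,Y\in\Omega$, and $f(S^{-1}XS)=S^{-1}f(X)S$ whenever $X\in\Omega(n)$, $S\in\mathrm{GL}_n(\mathbb{C})$ and $S^{-1}XS\in\Omega(n)$. An nc-map is a map into some $\mathbb{M}_e$ each of whose coordinates is an nc function. Here $0$ denotes the zero tuple in $\mathbb{C}^d$ (and at every level). *)

theory Defs
  imports "HOL-Analysis.Analysis" "Jordan_Normal_Form.Schur_Decomposition"
begin

text \<open>
  The number \<open>d\<close> of coordinates is the cardinality of the finite index type \<open>'d\<close>, whereas the
  matrix size \<open>n\<close> varies inside a single nc function. Hence tuples of matrices are functions
  from \<open>'d\<close> into the type of matrices of arbitrary dimension.
\<close>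

type_synonym 'd mat_tuple = "'d \<Rightarrow> complex mat"

definition mat_tuples :: "nat \<Rightarrow> 'd mat_tuple set" where
  "mat_tuples n = {X. \<forall>j. X j \<in> carrier_mat n n}"

text \<open>The sum \<open>\<Sum>\<^sub>j A\<^sub>j\<close> of \<open>n \<times> n\<close> matrices; the type of matrices has no zero element, so the
  generic big operator does not apply.\<close>

definition mat_sum :: "nat \<Rightarrow> ('d::finite \<Rightarrow> complex mat) \<Rightarrow> complex mat" where
  "mat_sum n A = mat n n (\<lambda>(i, k). \<Sum>j\<in>UNIV. A j $$ (i, k))"

definition pos_def :: "nat \<Rightarrow> complex mat \<Rightarrow> bool" where
  "pos_def n A \<longleftrightarrow> A \<in> carrier_mat n n \<and> mat_adjoint A = A \<and>
     (\<forall>v\<in>carrier_vec n. v \<noteq> 0\<^sub>v n \<longrightarrow> 0 < (A *\<^sub>v v) \<bullet>c v)"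

definition nc_ball_level :: "nat \<Rightarrow> 'd::finite mat_tuple set" where
  "nc_ball_level n =
     {X \<in> mat_tuples n. pos_def n (1\<^sub>m n - mat_sum n (\<lambda>j. X j * mat_adjoint (X j)))}"

definition nc_ball :: "'d::finite mat_tuple set" where
  "nc_ball = (\<Union>n\<in>{1..}. nc_ball_level n)"

definition mat_dsum :: "complex mat \<Rightarrow> complex mat \<Rightarrow> complex mat" where
  "mat_dsum A B = four_block_mat A (0\<^sub>m (dim_row A) (dim_col B)) (0\<^sub>m (dim_row B) (dim_col A)) B"

definition tuple_dsum :: "'d mat_tuple \<Rightarrow> 'd mat_tuple \<Rightarrow> 'd mat_tuple" where
  "tuple_dsum X Y = (\<lambda>j. mat_dsum (X j) (Y j))"

text \<open>The notion below is meant for domains \<open>\<Omega>\<close> that are closed under direct sums; the lemma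
  \<open>nc_ball_dsum_closed\<close> shows that the ball is one. In the last clause, \<open>T\<close> is the inverse of \<open>S\<close>.\<close>

definition nc_function_on :: "'d mat_tuple set \<Rightarrow> ('d mat_tuple \<Rightarrow> complex mat) \<Rightarrow> bool" where
  "nc_function_on \<Omega> f \<longleftrightarrow>
     (\<forall>n\<ge>1. \<forall>X \<in> \<Omega> \<inter> mat_tuples n. f X \<in> carrier_mat n n) \<and>
     (\<forall>X\<in>\<Omega>. \<forall>Y\<in>\<Omega>. f (tuple_dsum X Y) = mat_dsum (f X) (f Y)) \<and>
     (\<forall>n\<ge>1. \<forall>X \<in> \<Omega> \<inter> mat_tuples n. \<forall>S\<in>carrier_mat n n. \<forall>T\<in>carrier_mat n n.
        inverts_mat S T \<longrightarrow> inverts_mat T S \<longrightarrow> (\<lambda>j. T * X j * S) \<in> \<Omega> \<longrightarrow>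
        f (\<lambda>j. T * X j * S) = T * f X * S)"

definition nc_map_on :: "'d mat_tuple set \<Rightarrow> ('d mat_tuple \<Rightarrow> 'e mat_tuple) \<Rightarrow> bool" where
  "nc_map_on \<Omega> f \<longleftrightarrow> (\<forall>i. nc_function_on \<Omega> (\<lambda>X. f X i))"

text \<open>The identification of \<open>\<complex>\<^sup>d\<close> with the \<open>d\<close>-tuples of \<open>1 \<times> 1\<close> matrices.\<close>

definition scalar_tuple :: "complex ^ 'd \<Rightarrow> 'd mat_tuple" where
  "scalar_tuple v = (\<lambda>j. mat 1 1 (\<lambda>_. vec_nth v j))"

lemma mat_adjoint_dim [simp]: "A \<in> carrier_mat n m \<Longrightarrow> mat_adjoint A \<in> carrier_mat m n"
  for A :: "complex mat"
  by (auto simp: mat_adjoint_def mat_of_rows_def)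

lemma mat_adjoint_index:
  fixes A :: "complex mat"
  assumes "A \<in> carrier_mat n m" "i < m" "k < n"
  shows "mat_adjoint A $$ (i, k) = cnj (A $$ (k, i))"
  using assms by (auto simp: mat_adjoint_def mat_of_rows_def cols_def)

lemma mat_dsum_carrier:
  "A \<in> carrier_mat n n \<Longrightarrow> B \<in> carrier_mat m m \<Longrightarrow> mat_dsum A B \<in> carrier_mat (n + m) (n + m)"
  by (auto simp: mat_dsum_def)

lemma mat_dsum_adjoint:
  assumes "A \<in> carrier_mat n n" "B \<in> carrier_mat m m"
  shows "mat_adjoint (mat_dsum A B) = mat_dsum (mat_adjoint A) (mat_adjoint B)"
proof (rule eq_matI)
  have c: "mat_adjoint A \<in> carrier_mat n n" "mat_adjoint B \<in> carrier_mat m m"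
    using assms by simp_all
  have d: "mat_dsum (mat_adjoint A) (mat_adjoint B) \<in> carrier_mat (n + m) (n + m)"
    using c by (rule mat_dsum_carrier)
  have e: "mat_adjoint (mat_dsum A B) \<in> carrier_mat (n + m) (n + m)"
    using mat_dsum_carrier[OF assms] by simp
  show "dim_row (mat_adjoint (mat_dsum A B)) = dim_row (mat_dsum (mat_adjoint A) (mat_adjoint B))"
    "dim_col (mat_adjoint (mat_dsum A B)) = dim_col (mat_dsum (mat_adjoint A) (mat_adjoint B))"
    using d e by auto
  fix i k
  assume "i < dim_row (mat_dsum (mat_adjoint A) (mat_adjoint B))"
    "k < dim_col (mat_dsum (mat_adjoint A) (mat_adjoint B))"
  then have ik: "i < n + m" "k < n + m" using d by auto
  have "mat_adjoint (mat_dsum A B) $$ (i, k) = cnj (mat_dsum A B $$ (k, i))"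
    using mat_adjoint_index[OF mat_dsum_carrier[OF assms] ik] .
  also have "\<dots> = mat_dsum (mat_adjoint A) (mat_adjoint B) $$ (i, k)"
    using assms c ik
    by (auto simp: mat_dsum_def mat_adjoint_index carrier_matD[OF c(1)] carrier_matD[OF c(2)])
  finally show "mat_adjoint (mat_dsum A B) $$ (i, k) =
    mat_dsum (mat_adjoint A) (mat_adjoint B) $$ (i, k)" .
qed

lemma mat_dsum_mult:
  assumes "A \<in> carrier_mat n n" "B \<in> carrier_mat m m"
    "C \<in> carrier_mat n n" "D \<in> carrier_mat m m"
  shows "mat_dsum A B * mat_dsum C D = mat_dsum (A * C) (B * D)"
  using assms unfolding mat_dsum_def
  by (subst mult_four_block_mat[where ?nr1.0 = n and ?nr2.0 = m and ?n1.0 = n and ?n2.0 = m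
        and ?nc1.0 = n and ?nc2.0 = m]) auto

lemma mat_sum_dsum:
  assumes "\<And>j. A j \<in> carrier_mat n n" "\<And>j. B j \<in> carrier_mat m m"
  shows "mat_sum (n + m) (\<lambda>j. mat_dsum (A j) (B j)) = mat_dsum (mat_sum n A) (mat_sum m B)"
  using assms
  by (intro eq_matI)
    (auto simp: mat_sum_def mat_dsum_def carrier_matD[OF assms(1)] carrier_matD[OF assms(2)])

lemma pos_def_dsum:
  assumes "pos_def n A" "pos_def m B"
  shows "pos_def (n + m) (mat_dsum A B)"
proof -
  have A: "A \<in> carrier_mat n n" "mat_adjoint A = A"
    and B: "B \<in> carrier_mat m m" "mat_adjoint B = B"
    using assms by (auto simp: pos_def_def)
  have nonneg: "0 \<le> (C *\<^sub>v w) \<bullet>c w" if "pos_def k C" "w \<in> carrier_vec k" for k C w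
    using that by (cases "w = 0\<^sub>v k") (auto simp: pos_def_def less_imp_le)
  have "0 < (mat_dsum A B *\<^sub>v v) \<bullet>c v" if v: "v \<in> carrier_vec (n + m)" "v \<noteq> 0\<^sub>v (n + m)" for v
  proof -
    define x y where "x = vec_first v n" and "y = vec_last v m"
    have x: "x \<in> carrier_vec n" and y: "y \<in> carrier_vec m" and vxy: "v = x @\<^sub>v y"
      using v by (auto simp: x_def y_def)
    have "mat_dsum A B *\<^sub>v v = A *\<^sub>v x @\<^sub>v B *\<^sub>v y"
      unfolding mat_dsum_def vxy using A B x y
      by (subst four_block_mat_mult_vec[where ?nr1.0 = n and ?nr2.0 = m and ?nc1.0 = n and ?nc2.0 = m])
        auto
    moreover have "conjugate v = conjugate x @\<^sub>v conjugate y"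
      using vxy x y by (intro eq_vecI) auto
    ultimately have eq: "(mat_dsum A B *\<^sub>v v) \<bullet>c v = (A *\<^sub>v x) \<bullet>c x + (B *\<^sub>v y) \<bullet>c y"
      using A B x y by (simp add: scalar_prod_append[where ?n1.0 = n and ?n2.0 = m])
    have "x \<noteq> 0\<^sub>v n \<or> y \<noteq> 0\<^sub>v m"
      using v(2) vxy by auto
    then show ?thesis
    proof
      assume "x \<noteq> 0\<^sub>v n"
      then have "0 < (A *\<^sub>v x) \<bullet>c x" using assms(1) x by (auto simp: pos_def_def)
      then show ?thesis unfolding eq using nonneg[OF assms(2) y] by (rule add_pos_nonneg)
    next
      assume "y \<noteq> 0\<^sub>v m"
      then have "0 < (B *\<^sub>v y) \<bullet>c y" using assms(2) y by (auto simp: pos_def_def)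
      then show ?thesis unfolding eq using nonneg[OF assms(1) x] by (intro add_nonneg_pos)
    qed
  qed
  then show ?thesis
    using A B by (auto simp: pos_def_def mat_dsum_carrier mat_dsum_adjoint)
qed

lemma nc_ball_level_dsum:
  assumes X: "X \<in> nc_ball_level n" and Y: "Y \<in> nc_ball_level m"
  shows "tuple_dsum X Y \<in> nc_ball_level (n + m)"
proof -
  have Xc: "X j \<in> carrier_mat n n" and Yc: "Y j \<in> carrier_mat m m" for j
    using X Y by (auto simp: nc_ball_level_def mat_tuples_def)
  let ?P = "\<lambda>j. X j * mat_adjoint (X j)" and ?Q = "\<lambda>j. Y j * mat_adjoint (Y j)"
  have PQ: "?P j \<in> carrier_mat n n" "?Q j \<in> carrier_mat m m" for j
    using Xc Yc by (auto intro!: mult_carrier_mat)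
  have "tuple_dsum X Y j * mat_adjoint (tuple_dsum X Y j) = mat_dsum (?P j) (?Q j)" for j
    using Xc[of j] Yc[of j] by (simp add: tuple_dsum_def mat_dsum_adjoint mat_dsum_mult)
  then have "mat_sum (n + m) (\<lambda>j. tuple_dsum X Y j * mat_adjoint (tuple_dsum X Y j)) =
      mat_dsum (mat_sum n ?P) (mat_sum m ?Q)"
    using mat_sum_dsum[of ?P n ?Q m] PQ by simp
  moreover have "1\<^sub>m (n + m) - mat_dsum (mat_sum n ?P) (mat_sum m ?Q) =
      mat_dsum (1\<^sub>m n - mat_sum n ?P) (1\<^sub>m m - mat_sum m ?Q)"
    by (intro eq_matI) (auto simp: mat_dsum_def mat_sum_def)
  ultimately show ?thesis
    using X Y Xc Yc pos_def_dsum
    by (auto simp: nc_ball_level_def mat_tuples_def tuple_dsum_def mat_dsum_carrier)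
qed

lemma nc_ball_dsum_closed:
  assumes "X \<in> nc_ball" "Y \<in> nc_ball"
  shows "tuple_dsum X Y \<in> nc_ball"
proof -
  obtain n m where "n \<ge> 1" "m \<ge> 1" "X \<in> nc_ball_level n" "Y \<in> nc_ball_level m"
    using assms by (auto simp: nc_ball_def)
  then have "n + m \<ge> 1" "tuple_dsum X Y \<in> nc_ball_level (n + m)"
    by (auto intro: nc_ball_level_dsum)
  then show ?thesis by (auto simp: nc_ball_def)
qed

end

theory Submission
  imports Defs "HOL-Complex_Analysis.Great_Picard"
begin

text \<open>
  Write the \<open>n \<times> n\<close> matrix tuple \<open>Z\<close> as an array of vectors: its entry at \<open>(a, b)\<close> is a vector in
  \<open>\<complex>\<^sup>d\<close>. Then \<open>Z\<close> satisfies the linear relations of \<open>V\<close> iff all its entries lie in \<open>V\<close>, and it lies in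
  the ball iff every unit row vector \<open>x\<close> gives \<open>x Z\<close> norm less than one. Noncommutativity enters
  through one rule: \<open>f\<close> commutes with conjugation by block matrices with identity diagonal blocks and
  \<open>\<Phi>\<close> in the upper corner, so it sends the block triangular tuple with diagonal \<open>X, Y\<close> and corner
  \<open>X \<Phi> - \<Phi> Y\<close> to the one with diagonal \<open>f X, f Y\<close> and corner \<open>f X \<Phi> - \<Phi> f Y\<close>. Taking \<open>\<Phi>\<close> with
  \<open>X \<Phi> = \<Phi> Y\<close> shows that \<open>f\<close> respects intertwining (\<open>intertwine\<close>); taking \<open>\<Phi> = c I\<close> exhibits
  \<open>c (f X - f Y)\<close> as a corner of a value of \<open>f\<close>, hence bounded by one, which makes \<open>f\<close> Lipschitz and
  holomorphic along complex lines (\<open>difference_corner\<close>, \<open>entry_holomorphic\<close>). On the nilpotent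
  \<open>2 \<times> 2\<close> tuple with single nonzero entry \<open>\<beta>\<close>, \<open>f\<close> acts as its derivative \<open>L\<close> at the origin.

  Rigidity. If \<open>\<beta>\<close> is a unit vector with \<open>L \<beta> = \<beta>\<close>, then \<open>f\<close> preserves the \<open>\<beta>\<close>-component of every point
  of the ball (\<open>rigid_in_fixed_direction\<close>). The direct sum of \<open>Z\<close> and a multiple \<open>r < 1\<close> of the nilpotent
  tuple of \<open>\<beta>\<close> is similar to a tuple whose last column is \<open>r \<beta>\<close> in one row and orthogonal to \<open>\<beta>\<close>
  elsewhere; it stays in the ball as \<open>r \<rightarrow> 1\<close>, and the last column of its image then has no room for
  a further \<open>\<beta>\<close>-component, which is exactly the change of the \<open>\<beta>\<close>-component of \<open>Z\<close>. This has no
  commutative counterpart: \<open>(x, y) \<mapsto> (x + y\<^sup>2/2, 0)\<close> maps the scalar ball into itself.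

  Tuples over \<open>V\<close> are fixed. Unit vectors of \<open>V\<close> are fixed by \<open>L\<close>, so \<open>f\<close> preserves the
  \<open>V\<close>-component of every point. If all entries of \<open>Z\<close> lie in \<open>V\<close>, one more column over \<open>V\<close> brings a
  given row as close to norm one as desired, and then \<open>f\<close> cannot add anything orthogonal to \<open>V\<close>
  to that row (\<open>identity_on_rigid_directions\<close>). Applied to the line of a vector fixed by \<open>L\<close>, this also
  shows that \<open>L\<close> fixes no vector outside \<open>V\<close>.

  Fixed points lie over \<open>V\<close>. Let \<open>f Z = Z\<close> and split \<open>Z = X + Y\<close> entrywise along \<open>V\<close> and its orthogonal
  complement. The average \<open>g\<close> of \<open>f\<close> and the identity has the same fixed points, and by strict
  convexity of the Euclidean ball its derivative at the origin strictly contracts the complement of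
  \<open>V\<close>. Hence \<open>g\<^sup>k (t Z) - t X\<close> tends to zero as \<open>k \<rightarrow> \<infinity>\<close> for small \<open>t\<close>
  (\<open>iterates_converge_to_V\<close>). These are bounded holomorphic functions of \<open>t\<close> on a disc of radius
  greater than one whose value at \<open>t = 1\<close> is always \<open>Y\<close>; Montel's theorem and the identity theorem
  give \<open>Y = 0\<close>.
\<close>

section \<open>Hermitian geometry of \<open>\<complex>\<^sup>d\<close>\<close>

definition cinner :: "complex ^ 'd \<Rightarrow> complex ^ 'd \<Rightarrow> complex" where
  "cinner v w = (\<Sum>j\<in>UNIV. vec_nth v j * cnj (vec_nth w j))"

lemma cinner_add_left: "cinner (u + v) w = cinner u w + cinner v w"
  by (simp add: cinner_def sum.distrib algebra_simps)

lemma cinner_diff_left: "cinner (u - v) w = cinner u w - cinner v w"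
  by (simp add: cinner_def sum_subtractf algebra_simps)

lemma cinner_diff_right: "cinner u (v - w) = cinner u v - cinner u w"
  by (simp add: cinner_def sum_subtractf algebra_simps)

lemma cinner_scale_left: "cinner (c *s v) w = c * cinner v w"
  by (simp add: cinner_def sum_distrib_left mult_ac)

lemma cinner_scale_right: "cinner v (c *s w) = cnj c * cinner v w"
  by (simp add: cinner_def sum_distrib_left mult_ac)

lemma cinner_sum_left: "cinner (\<Sum>a\<in>A. f a) w = (\<Sum>a\<in>A. cinner (f a) w)"
  by (induction A rule: infinite_finite_induct) (simp_all add: cinner_add_left, simp_all add: cinner_def)

lemma cinner_zero [simp]: "cinner 0 w = 0" "cinner v 0 = 0"
  by (simp_all add: cinner_def)

lemma cinner_commute: "cinner w v = cnj (cinner v w)"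
  by (simp add: cinner_def mult_ac)

lemma norm_vec_squared: "(norm v)\<^sup>2 = (\<Sum>j\<in>UNIV. (cmod (vec_nth v j))\<^sup>2)" for v :: "complex ^ 'd"
  by (simp add: norm_vec_def L2_set_def sum_nonneg)

lemma cinner_self: "cinner v v = of_real ((norm v)\<^sup>2)"
  unfolding norm_vec_squared cinner_def
  by (simp add: complex_norm_square[symmetric] del: of_real_power)

lemma norm_vec_scale: "norm (c *s v) = cmod c * norm v" for v :: "complex ^ 'd"
proof -
  have "(norm (c *s v))\<^sup>2 = (cmod c * norm v)\<^sup>2"
    by (simp add: norm_vec_squared power_mult_distrib norm_mult sum_distrib_left)
  then show ?thesis by (simp add: power2_eq_iff_nonneg)
qed

lemma cmod_cinner_le: "cmod (cinner v w) \<le> norm v * norm w"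
proof -
  have "cmod (cinner v w) \<le> (\<Sum>j\<in>UNIV. \<bar>cmod (vec_nth v j)\<bar> * \<bar>cmod (vec_nth w j)\<bar>)"
    unfolding cinner_def by (rule order_trans[OF norm_sum]) (simp add: norm_mult)
  also have "\<dots> \<le> norm v * norm w"
    unfolding norm_vec_def by (rule L2_set_mult_ineq)
  finally show ?thesis .
qed

lemma norm_diff_scale_squared:
  "(norm (v - c *s w))\<^sup>2 = (norm v)\<^sup>2 - 2 * Re (cnj c * cinner v w) + (cmod c)\<^sup>2 * (norm w)\<^sup>2"
  for v w :: "complex ^ 'd"
proof -
  have "of_real ((norm (v - c *s w))\<^sup>2) = cinner (v - c *s w) (v - c *s w)"
    by (simp only: cinner_self)
  also have "\<dots> = cinner v v - cnj c * cinner v w - cnj (cnj c * cinner v w) + c * cnj c * cinner w w"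
    using cinner_commute[of v w]
    by (simp add: cinner_diff_left cinner_diff_right cinner_scale_left cinner_scale_right algebra_simps)
  also have "\<dots> = of_real ((norm v)\<^sup>2 - 2 * Re (cnj c * cinner v w) + (cmod c)\<^sup>2 * (norm w)\<^sup>2)"
    using complex_add_cnj[of "cnj c * cinner v w"]
    by (simp add: cinner_self complex_norm_square[of c, unfolded of_real_power] algebra_simps)
  finally show ?thesis by (simp only: of_real_eq_iff)
qed

lemma norm_add_squared_orthogonal:
  assumes "cinner v w = 0"
  shows "(norm (v + w))\<^sup>2 = (norm v)\<^sup>2 + (norm w)\<^sup>2"
  using norm_diff_scale_squared[of v "-1" w] assms by (simp add: vector_sneg_minus1[symmetric])

lemma cmod_diff_squared: "(cmod (z - s))\<^sup>2 = (cmod z)\<^sup>2 - 2 * Re (cnj s * z) + (cmod s)\<^sup>2"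
  unfolding cmod_power2 by (simp add: power2_eq_square algebra_simps)

lemma norm_orthogonal_part_le:
  fixes v \<beta> :: "complex ^ 'd"
  assumes "norm \<beta> = 1"
  shows "(norm (v - cinner v \<beta> *s \<beta>))\<^sup>2 \<le> (norm v)\<^sup>2"
proof -
  have "cnj (cinner v \<beta>) * cinner v \<beta> = of_real ((cmod (cinner v \<beta>))\<^sup>2)"
    unfolding complex_norm_square by (rule mult.commute)
  then show ?thesis
    unfolding norm_diff_scale_squared by (simp add: assms del: of_real_power)
qed

lemma unit_multiple:
  fixes v :: "complex ^ 'd"
  assumes "v \<noteq> 0"
  obtains u where "norm u = 1" "v = of_real (norm v) *s u" "u = of_real (1 / norm v) *s v"
proof
  show "norm (of_real (1 / norm v) *s v) = 1"
    unfolding norm_vec_scale norm_of_real using assms by simp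
  show "v = of_real (norm v) *s (of_real (1 / norm v) *s v)"
    using assms by (simp add: of_real_mult[symmetric] del: of_real_mult)
qed simp

lemma norm_vec_le_sum: "norm x \<le> (\<Sum>j\<in>UNIV. cmod (vec_nth x j))" for x :: "complex ^ 'd"
  unfolding norm_vec_def by (rule L2_set_le_sum) simp

lemma average_eq_iff: "(1/2) *s (x + y) = y \<longleftrightarrow> x = y" for x y :: "complex ^ 'd"
proof
  assume "(1/2) *s (x + y) = y"
  then have "2 *s ((1/2) *s (x + y)) = 2 *s y" by simp
  then have "x + y = y + y" using vec.scale_left_distrib[of 1 1 y] by simp
  then show "x = y" by simp
next
  assume "x = y"
  then show "(1/2) *s (x + y) = y" using vec.scale_left_distrib[of "1/2" "1/2" y]
    by (simp only: vec.scale_right_distrib) simp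
qed

lemma norm_sum_scale_squared_le:
  fixes G :: "nat \<Rightarrow> complex ^ 'd"
  shows "(norm (\<Sum>k<n. p k *s G k))\<^sup>2 \<le> (\<Sum>k<n. (cmod (p k))\<^sup>2) * (\<Sum>k<n. (norm (G k))\<^sup>2)"
proof -
  have "norm (\<Sum>k<n. p k *s G k) \<le> (\<Sum>k<n. \<bar>cmod (p k)\<bar> * \<bar>norm (G k)\<bar>)"
    by (rule order_trans[OF norm_sum]) (simp add: norm_vec_scale)
  also have "\<dots> \<le> L2_set (\<lambda>k. cmod (p k)) {..<n} * L2_set (\<lambda>k. norm (G k)) {..<n}"
    by (rule L2_set_mult_ineq)
  finally have "(norm (\<Sum>k<n. p k *s G k))\<^sup>2 \<le>
      (L2_set (\<lambda>k. cmod (p k)) {..<n} * L2_set (\<lambda>k. norm (G k)) {..<n})\<^sup>2"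
    by (intro power_mono) auto
  then show ?thesis by (simp add: power_mult_distrib L2_set_def sum_nonneg)
qed

text \<open>
  The real orthogonal projection already does the job: vectors that are real-orthogonal to \<open>v\<close> and to
  \<open>\<i> v\<close> are complex-orthogonal to \<open>v\<close>.
\<close>

lemma orthogonal_decomposition:
  fixes V :: "(complex ^ 'd) set"
  assumes "vec.subspace V"
  obtains x y where "z = x + y" "x \<in> V" "\<And>v. v \<in> V \<Longrightarrow> cinner y v = 0" 
proof -
  have sc: "c *s v \<in> V" if "v \<in> V" for c v
    using assms that by (rule vec.subspace_scale)
  have scr: "r *\<^sub>R v = of_real r *s v" for r and v :: "complex ^ 'd"
    unfolding Finite_Cartesian_Product.vec_eq_iff vector_scaleR_component vector_smult_component by (simp add: scaleR_conv_of_real)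
  have "Real_Vector_Spaces.subspace V"
    unfolding Real_Vector_Spaces.subspace_def using assms vec.subspace_0 vec.subspace_add by (auto simp: scr sc)
  then have span: "Real_Vector_Spaces.span V = V" by (rule Real_Vector_Spaces.span_eq_iff[THEN iffD2])
  obtain x y where xy: "x \<in> Real_Vector_Spaces.span V" "\<And>w. w \<in> Real_Vector_Spaces.span V \<Longrightarrow> Linear_Algebra.orthogonal y w" "z = x + y"
    using orthogonal_subspace_decomp_exists[of V z] by blast
  have re: "inner y w = Re (cinner y w)" for w
    by (simp add: inner_vec_def cinner_def inner_complex_def)
  have "cinner y v = 0" if "v \<in> V" for v
  proof (rule complex_eqI)
    show "Re (cinner y v) = Re 0"
      using xy(2)[of v] that by (simp add: span Linear_Algebra.orthogonal_def re)
    have "Re (cinner y (\<i> *s v)) = 0"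
      using xy(2)[of "\<i> *s v"] sc[OF that] by (simp add: span Linear_Algebra.orthogonal_def re)
    then show "Im (cinner y v) = Im 0" by (simp add: cinner_scale_right)
  qed
  then show ?thesis using that xy by (simp add: span)
qed

definition orthogonal_complement :: "(complex ^ 'd) set \<Rightarrow> (complex ^ 'd) set" where
  "orthogonal_complement V = {y. \<forall>v\<in>V. cinner y v = 0}"

text \<open>
  The functional that detects \<open>z\<close> outside \<open>V\<close> is the inner product with the component of \<open>z\<close>
  orthogonal to \<open>V\<close>.
\<close>

lemma annihilator_iff:
  fixes V :: "(complex ^ 'd) set"
  assumes "vec.subspace V"
  shows "z \<in> V \<longleftrightarrow>
    (\<forall>a. (\<forall>v\<in>V. (\<Sum>j\<in>UNIV. vec_nth a j * vec_nth v j) = 0) \<longrightarrow> (\<Sum>j\<in>UNIV. vec_nth a j * vec_nth z j) = 0)"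
    (is "_ \<longleftrightarrow> ?R")
proof
  assume R: ?R
  obtain x y where xy: "z = x + y" "x \<in> V" "\<And>v. v \<in> V \<Longrightarrow> cinner y v = 0"
    using orthogonal_decomposition[OF assms, of z] by metis
  define a :: "complex ^ 'd" where "a = (\<chi> j. cnj (vec_nth y j))"
  have a: "(\<Sum>j\<in>UNIV. vec_nth a j * vec_nth v j) = cinner v y" for v
    by (simp add: a_def cinner_def mult.commute)
  have "cinner v y = 0" if "v \<in> V" for v using xy(3)[OF that] cinner_commute[of v y] by simp
  then have "cinner z y = 0" "cinner x y = 0" using R[rule_format, of a] xy(2) by (simp_all add: a)
  then have "y = 0" by (simp add: xy(1) cinner_add_left cinner_self)
  then show "z \<in> V" using xy by simp
qed blast

section \<open>Tuples as kernels and the row ball\<close>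

text \<open>
  Only the entries with both indices below the size \<open>n\<close> matter; the size is passed separately.
\<close>

type_synonym 'd kernel = "nat \<Rightarrow> nat \<Rightarrow> complex ^ 'd"

text \<open>
  For \<open>F\<close> the kernel of a tuple \<open>X\<close>, this is the squared norm of the row \<open>x\<close> times
  \<open>(X\<^sub>1, \<dots>, X\<^sub>d)\<close>, that is, the Hermitian form of \<open>\<Sum>\<^sub>j X\<^sub>j X\<^sub>j\<^sup>*\<close> at the conjugate of \<open>x\<close>.
\<close>

definition row_form :: "nat \<Rightarrow> 'd::finite kernel \<Rightarrow> (nat \<Rightarrow> complex) \<Rightarrow> real" where
  "row_form n F x = (\<Sum>b<n. (norm (\<Sum>a<n. x a *s F a b))\<^sup>2)"

definition coord_form :: "nat \<Rightarrow> (nat \<Rightarrow> complex) \<Rightarrow> real" where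
  "coord_form n x = (\<Sum>a<n. (cmod (x a))\<^sup>2)"

definition in_ball :: "nat \<Rightarrow> 'd::finite kernel \<Rightarrow> bool" where
  "in_ball n F \<longleftrightarrow> (\<forall>x. (\<exists>a<n. x a \<noteq> 0) \<longrightarrow> row_form n F x < coord_form n x)"

lemma coord_form_nonneg: "0 \<le> coord_form n x"
  by (simp add: coord_form_def sum_nonneg)

lemma row_form_nonneg: "0 \<le> row_form n F x"
  by (simp add: row_form_def sum_nonneg)

lemma coord_form_pos: "\<exists>a<n. x a \<noteq> 0 \<Longrightarrow> 0 < coord_form n x"
  unfolding coord_form_def by (auto intro: sum_pos2)

lemma row_form_zero: "(\<And>a. a < n \<Longrightarrow> x a = 0) \<Longrightarrow> row_form n F x = 0"
  by (simp add: row_form_def)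

lemma row_form_cong:
  "(\<And>a b. a < n \<Longrightarrow> b < n \<Longrightarrow> F a b = G a b) \<Longrightarrow> (\<And>a. a < n \<Longrightarrow> x a = y a)
    \<Longrightarrow> row_form n F x = row_form n G y"
  by (simp add: row_form_def)

lemma in_ballD: "in_ball n F \<Longrightarrow> row_form n F x \<le> coord_form n x"
  using coord_form_nonneg[of n x] row_form_zero[of n x F] unfolding in_ball_def by (metis less_imp_le)

lemma row_form_scale: "row_form n F (\<lambda>a. c * x a) = (cmod c)\<^sup>2 * row_form n F x"
proof -
  have "(\<Sum>a<n. (c * x a) *s F a b) = c *s (\<Sum>a<n. x a *s F a b)" for b
    by (simp add: vec.scale_sum_right)
  then show ?thesis
    by (simp add: row_form_def norm_vec_scale power_mult_distrib sum_distrib_left)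
qed

lemma coord_form_scale: "coord_form n (\<lambda>a. c * x a) = (cmod c)\<^sup>2 * coord_form n x"
  by (simp add: coord_form_def norm_mult power_mult_distrib sum_distrib_left)

lemma coord_form_unit: "a0 < n \<Longrightarrow> coord_form n (\<lambda>a. if a = a0 then 1 else 0) = 1"
  by (simp add: coord_form_def if_distrib[of cmod] if_distrib[of "\<lambda>z::real. z\<^sup>2"] cong: if_cong)

lemma row_form_unit:
  "a0 < n \<Longrightarrow> row_form n F (\<lambda>a. if a = a0 then 1 else 0) = (\<Sum>b<n. (norm (F a0 b))\<^sup>2)"
  by (simp add: row_form_def if_distrib[of "\<lambda>c. c *s _"] cong: if_cong)

lemma in_ball_row: "in_ball n F \<Longrightarrow> a0 < n \<Longrightarrow> (\<Sum>b<n. (norm (F a0 b))\<^sup>2) < 1"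
  unfolding in_ball_def
  by (drule spec[of _ "\<lambda>a. if a = a0 then 1 else 0"]) (auto simp: coord_form_unit row_form_unit)

lemma in_ball_entry:
  assumes "in_ball n F" "a < n" "b < n"
  shows "norm (F a b) \<le> 1"
proof -
  have "(norm (F a b))\<^sup>2 \<le> (\<Sum>b<n. (norm (F a b))\<^sup>2)"
    using assms by (intro member_le_sum) auto
  then have "(norm (F a b))\<^sup>2 \<le> 1\<^sup>2" using in_ball_row[OF assms(1,2)] by simp
  then show ?thesis by (rule power2_le_imp_le) simp
qed

text \<open>
  Both forms are continuous and the unit sphere of \<open>\<complex>\<^sup>n\<close> is compact. Since \<open>n\<close> is a variable and not a type, the sphere
  is realised inside the functions on all of \<open>\<nat>\<close> that vanish from \<open>n\<close> on, where Tychonoff's theorem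
  gives compactness.
\<close>

lemma row_form_uniform_gap:
  assumes "in_ball n F"
  obtains s where "0 \<le> s" "s < 1" "\<And>x. row_form n F x \<le> s * coord_form n x"
proof (cases "n = 0")
  case True
  then show ?thesis using that[of 0] by (simp add: row_form_def)
next
  case False
  let ?K = "PiE UNIV (\<lambda>a. if a < n then cball (0::complex) 1 else {0})"
  let ?S = "?K \<inter> {x. coord_form n x = 1}"
  have "compactin (product_topology (\<lambda>i::nat. euclidean :: complex topology) UNIV) ?K"
    unfolding compactin_PiE by auto
  then have K: "compact ?K" by (simp add: euclidean_product_topology)
  have coord: "continuous_on UNIV (coord_form n)"
    unfolding coord_form_def by (intro continuous_intros continuous_on_product_coordinates)
  have "closed {x. coord_form n x = 1}"
    using closed_Collect_eq[OF coord continuous_on_const] .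
  with K have S: "compact ?S" by (rule compact_Int_closed)
  have ne: "(\<lambda>a. if a = 0 then 1 else 0) \<in> ?S"
    using False by (auto simp: coord_form_unit)
  have row: "continuous_on UNIV (row_form n F)"
    unfolding row_form_def vector_scalar_mult_def
    by (intro continuous_intros continuous_on_product_coordinates)
  have "\<exists>x\<in>?S. \<forall>y\<in>?S. row_form n F y \<le> row_form n F x"
    by (rule continuous_attains_sup[OF S _ continuous_on_subset[OF row]]) (use ne in auto)
  then obtain x0 where x0: "x0 \<in> ?S" and mx: "\<And>y. y \<in> ?S \<Longrightarrow> row_form n F y \<le> row_form n F x0"
    by blast
  have "\<exists>a<n. x0 a \<noteq> 0"
    using x0 unfolding coord_form_def by (metis (mono_tags, lifting) IntE lessThan_iff mem_Collect_eq
        norm_zero power_zero_numeral sum.neutral zero_neq_one)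
  then have lt: "row_form n F x0 < 1"
    using assms x0 unfolding in_ball_def by (metis (mono_tags, lifting) IntE mem_Collect_eq)
  have bound: "row_form n F x \<le> row_form n F x0 * coord_form n x" for x
  proof (cases "\<exists>a<n. x a \<noteq> 0")
    case False
    then show ?thesis
      using row_form_zero[of n x F] row_form_nonneg[of n F x0] coord_form_nonneg[of n x]
      by (simp add: mult_nonneg_nonneg)
  next
    case True
    let ?c = "coord_form n x"
    have c: "0 < ?c" using coord_form_pos[OF True] .
    define y where "y = (\<lambda>a. of_real (1 / sqrt ?c) * x a)"
    have cf: "coord_form n y = 1"
      unfolding y_def coord_form_scale using c by (simp add: norm_divide power_divide)
    have rf: "row_form n F y = row_form n F x / ?c"
      unfolding y_def row_form_scale using c by (simp add: norm_divide power_divide)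
    have "cmod (y a) \<le> 1" if "a < n" for a
    proof -
      have "(cmod (y a))\<^sup>2 \<le> coord_form n y"
        unfolding coord_form_def using that by (intro member_le_sum) auto
      then show ?thesis using power2_le_imp_le[of "cmod (y a)" 1] by (simp add: cf)
    qed
    then have "(\<lambda>a. if a < n then y a else 0) \<in> ?S"
      using cf by (auto simp: coord_form_def)
    from mx[OF this] have "row_form n F y \<le> row_form n F x0"
      using row_form_cong[of n F F y "\<lambda>a. if a < n then y a else 0"] by simp
    then show ?thesis using c by (simp add: rf field_simps)
  qed
  show ?thesis by (rule that[OF row_form_nonneg lt bound])
qed

lemma row_form_le_entries:
  assumes "\<And>a b. a < n \<Longrightarrow> b < n \<Longrightarrow> norm (F a b) \<le> M"
  shows "row_form n F x \<le> (n * M)\<^sup>2 * coord_form n x"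
proof -
  have "row_form n F x \<le> (\<Sum>b<n. coord_form n x * (n * M\<^sup>2))"
    unfolding row_form_def
  proof (rule sum_mono)
    fix b assume b: "b \<in> {..<n}"
    have "(norm (\<Sum>a<n. x a *s F a b))\<^sup>2 \<le> coord_form n x * (\<Sum>a<n. (norm (F a b))\<^sup>2)"
      unfolding coord_form_def by (rule norm_sum_scale_squared_le)
    also have "(\<Sum>a<n. (norm (F a b))\<^sup>2) \<le> (\<Sum>a<n. M\<^sup>2)"
      using assms b by (intro sum_mono power_mono) auto
    finally show "(norm (\<Sum>a<n. x a *s F a b))\<^sup>2 \<le> coord_form n x * (n * M\<^sup>2)"
      using coord_form_nonneg[of n x] by (simp add: mult_left_mono)
  qed
  then show ?thesis by (simp add: power2_eq_square mult_ac)
qed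

text \<open>
  A crude sufficient condition (the Hilbert-Schmidt norm is at most \<open>n M\<close>) that is used for tuples
  that may be scaled down freely.
\<close>

lemma in_ball_small_entries:
  assumes "\<And>a b. a < n \<Longrightarrow> b < n \<Longrightarrow> norm (F a b) \<le> M" "n * M < 1"
  shows "in_ball n F"
  unfolding in_ball_def
proof (intro allI impI)
  fix x :: "nat \<Rightarrow> complex" assume x: "\<exists>a<n. x a \<noteq> 0"
  then have "0 \<le> M" using assms(1) by (meson norm_ge_zero order_trans)
  then have "(n * M)\<^sup>2 < 1" using assms(2) by (simp add: power_less_one_iff)
  then have "(n * M)\<^sup>2 * coord_form n x < 1 * coord_form n x"
    using coord_form_pos[OF x] by (intro mult_strict_right_mono)
  then show "row_form n F x < coord_form n x"
    using row_form_le_entries[of n F M x] assms(1) by simp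
qed

lemma in_ball_open:
  assumes "in_ball n F"
  obtains \<epsilon> where "0 < \<epsilon>"
    "\<And>G. (\<And>a b. a < n \<Longrightarrow> b < n \<Longrightarrow> norm (G a b - F a b) \<le> \<epsilon>) \<Longrightarrow> in_ball n G"
proof -
  obtain s where s: "0 \<le> s" "s < 1" "\<And>x. row_form n F x \<le> s * coord_form n x"
    using row_form_uniform_gap[OF assms] by blast
  have sq: "sqrt s < 1" using s by simp
  define \<epsilon> where "\<epsilon> = (1 - sqrt s) / (n + 1)"
  have \<epsilon>: "0 < \<epsilon>" using sq by (simp add: \<epsilon>_def)
  have lt: "sqrt s + n * \<epsilon> < 1"
  proof -
    have "n * \<epsilon> < (n + 1) * \<epsilon>" using \<epsilon> by simp
    also have "\<dots> = 1 - sqrt s" by (simp add: \<epsilon>_def)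
    finally show ?thesis by simp
  qed
  have "in_ball n G" if G: "\<And>a b. a < n \<Longrightarrow> b < n \<Longrightarrow> norm (G a b - F a b) \<le> \<epsilon>" for G
    unfolding in_ball_def
  proof (intro allI impI)
    fix x :: "nat \<Rightarrow> complex" assume x: "\<exists>a<n. x a \<noteq> 0"
    let ?c = "coord_form n x"
    let ?R = "\<lambda>F. L2_set (\<lambda>b. norm (\<Sum>a<n. x a *s F a b)) {..<n}"
    have R: "?R H = sqrt (row_form n H x)" for H
      by (simp add: L2_set_def row_form_def)
    have "?R G \<le> L2_set (\<lambda>b. norm (\<Sum>a<n. x a *s F a b)
        + norm (\<Sum>a<n. x a *s (G a b - F a b))) {..<n}"
    proof (rule L2_set_mono)
      fix b
      have "(\<Sum>a<n. x a *s G a b) = (\<Sum>a<n. x a *s F a b) + (\<Sum>a<n. x a *s (G a b - F a b))"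
        by (simp add: vec.scale_right_diff_distrib sum_subtractf)
      then show "norm (\<Sum>a<n. x a *s G a b) \<le> norm (\<Sum>a<n. x a *s F a b)
        + norm (\<Sum>a<n. x a *s (G a b - F a b))" by (simp only: norm_triangle_ineq)
    qed auto
    also have "\<dots> \<le> ?R F + ?R (\<lambda>a b. G a b - F a b)"
      by (rule L2_set_triangle_ineq)
    also have "\<dots> \<le> sqrt s * sqrt ?c + n * \<epsilon> * sqrt ?c"
    proof (rule add_mono)
      show "?R F \<le> sqrt s * sqrt ?c"
        unfolding R real_sqrt_mult[symmetric] using s(3) by simp
      have "sqrt (row_form n (\<lambda>a b. G a b - F a b) x) \<le> sqrt ((n * \<epsilon>)\<^sup>2 * ?c)"
        using row_form_le_entries[of n "\<lambda>a b. G a b - F a b" \<epsilon> x] G by simp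
      then show "?R (\<lambda>a b. G a b - F a b) \<le> n * \<epsilon> * sqrt ?c"
        unfolding R using \<epsilon> by (simp add: real_sqrt_mult)
    qed
    also have "\<dots> = (sqrt s + n * \<epsilon>) * sqrt ?c" by (simp add: algebra_simps)
    also have "\<dots> < 1 * sqrt ?c"
      using lt coord_form_pos[OF x] by (intro mult_strict_right_mono) auto
    finally show "row_form n G x < ?c" by (simp add: R)
  qed
  with \<epsilon> show ?thesis by (rule that)
qed

lemma in_ball_scale:
  assumes "in_ball n F" "cmod c \<le> 1"
  shows "in_ball n (\<lambda>a b. c *s F a b)"
  unfolding in_ball_def
proof (intro allI impI)
  fix x :: "nat \<Rightarrow> complex" assume x: "\<exists>a<n. x a \<noteq> 0"
  have "(\<Sum>a<n. x a *s (c *s F a b)) = c *s (\<Sum>a<n. x a *s F a b)" for b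
    unfolding vec.scale_sum_right vec.scale_scale by (simp only: mult.commute)
  then have "row_form n (\<lambda>a b. c *s F a b) x = (cmod c)\<^sup>2 * row_form n F x"
    by (simp add: row_form_def norm_vec_scale power_mult_distrib sum_distrib_left)
  also have "\<dots> \<le> 1 * row_form n F x"
    using assms(2) row_form_nonneg by (intro mult_right_mono) (auto simp: power_le_one)
  also have "\<dots> < coord_form n x" using assms(1) x by (simp add: in_ball_def)
  finally show "row_form n (\<lambda>a b. c *s F a b) x < coord_form n x" .
qed

lemma in_ball_average:
  assumes "in_ball n F" "in_ball n G"
  shows "in_ball n (\<lambda>a b. (1/2) *s (F a b + G a b))"
  unfolding in_ball_def
proof (intro allI impI)
  fix x :: "nat \<Rightarrow> complex" assume x: "\<exists>a<n. x a \<noteq> 0"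
  have *: "(norm ((1/2) *s (u + v)))\<^sup>2 \<le> ((norm u)\<^sup>2 + (norm v)\<^sup>2) / 2" for u v :: "complex ^ 'd"
  proof -
    have "norm ((1/2) *s (u + v)) \<le> (norm u + norm v) / 2"
      using norm_triangle_ineq[of u v] by (simp only: norm_vec_scale) simp
    then have "(norm ((1/2) *s (u + v)))\<^sup>2 \<le> ((norm u + norm v) / 2)\<^sup>2"
      by (intro power_mono) auto
    also have "\<dots> \<le> ((norm u)\<^sup>2 + (norm v)\<^sup>2) / 2"
      using sum_squares_bound[of "norm u" "norm v"] by (simp add: power2_eq_square field_simps)
    finally show ?thesis .
  qed
  let ?S = "\<lambda>F b. \<Sum>a<n. x a *s F a b"
  have eq: "?S (\<lambda>a b. (1/2) *s (F a b + G a b)) b = (1/2) *s (?S F b + ?S G b)" for b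
    unfolding vec.scale_right_distrib vec.scale_sum_right vec.scale_scale sum.distrib
    by (simp only: mult.commute)
  have "row_form n (\<lambda>a b. (1/2) *s (F a b + G a b)) x
      \<le> (\<Sum>b<n. ((norm (?S F b))\<^sup>2 + (norm (?S G b))\<^sup>2) / 2)"
    unfolding row_form_def eq by (intro sum_mono *)
  also have "\<dots> = (row_form n F x + row_form n G x) / 2"
    by (simp add: row_form_def sum.distrib sum_divide_distrib[symmetric])
  also have "\<dots> < coord_form n x"
    using assms[unfolded in_ball_def, rule_format, OF x] by simp
  finally show "row_form n (\<lambda>a b. (1/2) *s (F a b + G a b)) x < coord_form n x" .
qed

lemma in_ball_one: "in_ball 1 F \<longleftrightarrow> norm (F 0 0) < 1"
proof -
  have "in_ball 1 F" if "norm (F 0 0) < 1"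
    using that by (intro in_ball_small_entries[of 1 F "norm (F 0 0)"]) auto
  moreover have "norm (F 0 0) < 1" if "in_ball 1 F"
    using in_ball_row[OF that, of 0] by (simp add: power_less_one_iff abs_square_less_1)
  ultimately show ?thesis by blast
qed

lemma sum_lessThan_add: "(\<Sum>a<n + m. f a) = (\<Sum>a<n. f a) + (\<Sum>a<m. f (n + a))"
  for f :: "nat \<Rightarrow> 'a::comm_monoid_add"
  by (induction m) (simp_all add: add.assoc)

lemma sum_lessThan_two: "(\<Sum>j<2. f j) = f 0 + f (Suc 0)"
  for f :: "nat \<Rightarrow> 'a::comm_monoid_add"
  by (simp add: numeral_2_eq_2)

lemma in_ball_upper_left:
  assumes "in_ball (n + m) T"
  shows "in_ball n T"
  unfolding in_ball_def
proof (intro allI impI)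
  fix x :: "nat \<Rightarrow> complex" assume x: "\<exists>a<n. x a \<noteq> 0"
  define y where "y = (\<lambda>a. if a < n then x a else 0)"
  have "row_form n T x \<le> row_form (n + m) T y"
    by (simp add: row_form_def sum_lessThan_add y_def sum_nonneg)
  also have "\<dots> < coord_form (n + m) y"
  proof -
    obtain a where "a < n" "x a \<noteq> 0" using x by blast
    then have "\<exists>a<n + m. y a \<noteq> 0" by (intro exI[of _ a]) (simp add: y_def)
    then show ?thesis using assms by (simp add: in_ball_def)
  qed
  also have "\<dots> = coord_form n x"
    by (simp add: coord_form_def sum_lessThan_add y_def)
  finally show "row_form n T x < coord_form n x" .
qed

lemma in_ball_lower_right:
  assumes "in_ball (n + m) T"
  shows "in_ball m (\<lambda>a b. T (n + a) (n + b))"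
  unfolding in_ball_def
proof (intro allI impI)
  fix x :: "nat \<Rightarrow> complex" assume x: "\<exists>a<m. x a \<noteq> 0"
  define y where "y = (\<lambda>a. if n \<le> a then x (a - n) else 0)"
  have "row_form m (\<lambda>a b. T (n + a) (n + b)) x \<le> row_form (n + m) T y"
    by (simp add: row_form_def sum_lessThan_add y_def sum_nonneg)
  also have "\<dots> < coord_form (n + m) y"
  proof -
    obtain a where "a < m" "x a \<noteq> 0" using x by blast
    then have "\<exists>a<n + m. y a \<noteq> 0" by (intro exI[of _ "n + a"]) (simp add: y_def)
    then show ?thesis using assms by (simp add: in_ball_def)
  qed
  also have "\<dots> = coord_form m x"
    by (simp add: coord_form_def sum_lessThan_add y_def)
  finally show "row_form m (\<lambda>a b. T (n + a) (n + b)) x < coord_form m x" .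
qed

definition block_kernel :: "nat \<Rightarrow> 'd::finite kernel \<Rightarrow> 'd kernel \<Rightarrow> 'd kernel \<Rightarrow> 'd kernel" where
  "block_kernel n F C G = (\<lambda>a b.
     if a < n then (if b < n then F a b else C a (b - n))
     else if b < n then 0 else G (a - n) (b - n))"

lemma block_kernel_simps [simp]:
  "a < n \<Longrightarrow> b < n \<Longrightarrow> block_kernel n F C G a b = F a b"
  "a < n \<Longrightarrow> block_kernel n F C G a (n + b) = C a b"
  "b < n \<Longrightarrow> block_kernel n F C G (n + a) b = 0"
  "block_kernel n F C G (n + a) (n + b) = G a b"
  by (simp_all add: block_kernel_def)

lemma block_kernel_boundary [simp]:
  "a < n \<Longrightarrow> block_kernel n F C G a n = C a 0"
  "b < n \<Longrightarrow> block_kernel n F C G n b = 0"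
  "block_kernel n F C G n n = G 0 0"
  by (simp_all add: block_kernel_def)

lemma in_ball_direct_sum:
  assumes "in_ball n F" "in_ball m G"
  shows "in_ball (n + m) (block_kernel n F (\<lambda>_ _. 0) G)"
  unfolding in_ball_def
proof (intro allI impI)
  fix x :: "nat \<Rightarrow> complex" assume x: "\<exists>a<n + m. x a \<noteq> 0"
  let ?y = "\<lambda>a. x (n + a)"
  have row: "row_form (n + m) (block_kernel n F (\<lambda>_ _. 0) G) x = row_form n F x + row_form m G ?y"
    by (simp add: row_form_def sum_lessThan_add)
  have coord: "coord_form (n + m) x = coord_form n x + coord_form m ?y"
    by (simp add: coord_form_def sum_lessThan_add)
  have "(\<exists>a<n. x a \<noteq> 0) \<or> (\<exists>a<m. ?y a \<noteq> 0)"
  proof -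
    obtain a where a: "a < n + m" "x a \<noteq> 0" using x by blast
    show ?thesis
    proof (cases "a < n")
      case True then show ?thesis using a by blast
    next
      case False
      then have "a - n < m" "?y (a - n) \<noteq> 0" using a by auto
      then show ?thesis by blast
    qed
  qed
  then show "row_form (n + m) (block_kernel n F (\<lambda>_ _. 0) G) x < coord_form (n + m) x"
    unfolding row coord
    using assms[unfolded in_ball_def] in_ballD[OF assms(1), of x] in_ballD[OF assms(2), of ?y]
    by (meson add_less_le_mono add_le_less_mono)
qed

section \<open>Noncommutative self-maps of the ball in kernel form\<close>

text \<open>
  Block triangular tuples that are conjugate to the direct sum of their diagonal blocks by the matrix
  with identity diagonal blocks and upper corner \<open>\<phi>\<close>: the corner is \<open>X \<phi> - \<phi> Y\<close>, where \<open>X\<close> and \<open>Y\<close> are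
  the diagonal blocks.
\<close>

definition block_similar ::
  "nat \<Rightarrow> nat \<Rightarrow> (nat \<Rightarrow> nat \<Rightarrow> complex) \<Rightarrow> 'd::finite kernel \<Rightarrow> bool" where
  "block_similar n m \<phi> T \<longleftrightarrow>
     (\<forall>a<m. \<forall>b<n. T (n + a) b = 0) \<and>
     (\<forall>a<n. \<forall>b<m. T a (n + b) =
        (\<Sum>k<n. \<phi> k b *s T a k) - (\<Sum>k<m. \<phi> a k *s T (n + k) (n + b)))"

text \<open>
  The kernel form of an nc self-map of the ball that fixes the origin. Direct sums and similarities occur only in the combination of \<open>block_similar\<close>; in this form the
  axioms visibly pass to compositions and to averages with the identity, because the same \<open>\<phi>\<close> serves
  for the argument and for the value.
\<close>

locale nc_self_map =
  fixes e :: "nat \<Rightarrow> 'd::finite kernel \<Rightarrow> 'd kernel"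
  assumes ball: "\<And>n F. 1 \<le> n \<Longrightarrow> in_ball n F \<Longrightarrow> in_ball n (e n F)"
    and zero: "e 1 (\<lambda>_ _. 0) 0 0 = 0"
    and cong: "\<And>n F G a b. (\<And>a b. a < n \<Longrightarrow> b < n \<Longrightarrow> F a b = G a b) \<Longrightarrow> a < n \<Longrightarrow> b < n
      \<Longrightarrow> e n F a b = e n G a b"
    and similar: "\<And>n m T \<phi>. 1 \<le> n \<Longrightarrow> 1 \<le> m \<Longrightarrow> in_ball (n + m) T \<Longrightarrow> block_similar n m \<phi> T
      \<Longrightarrow> block_similar n m \<phi> (e (n + m) T)"
    and similar_upper: "\<And>n m T \<phi> a b. 1 \<le> n \<Longrightarrow> 1 \<le> m \<Longrightarrow> in_ball (n + m) T
      \<Longrightarrow> block_similar n m \<phi> T \<Longrightarrow> a < n \<Longrightarrow> b < n \<Longrightarrow> e (n + m) T a b = e n T a b"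
    and similar_lower: "\<And>n m T \<phi> a b. 1 \<le> n \<Longrightarrow> 1 \<le> m \<Longrightarrow> in_ball (n + m) T
      \<Longrightarrow> block_similar n m \<phi> T \<Longrightarrow> a < m \<Longrightarrow> b < m
      \<Longrightarrow> e (n + m) T (n + a) (n + b) = e m (\<lambda>a b. T (n + a) (n + b)) a b"

section \<open>From matrix tuples to kernels\<close>

definition tuple_of :: "nat \<Rightarrow> 'd::finite kernel \<Rightarrow> 'd mat_tuple" where
  "tuple_of n F = (\<lambda>j. mat n n (\<lambda>(a, b). vec_nth (F a b) j))"

definition kernel_map :: "('d::finite mat_tuple \<Rightarrow> 'd mat_tuple) \<Rightarrow> nat \<Rightarrow> 'd kernel \<Rightarrow> 'd kernel" where
  "kernel_map f n F = (\<lambda>a b. \<chi> j. f (tuple_of n F) j $$ (a, b))"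

lemma tuple_of_mat_tuples: "tuple_of n F \<in> mat_tuples n"
  by (simp add: tuple_of_def mat_tuples_def)

lemma tuple_of_carrier [simp]: "tuple_of n F j \<in> carrier_mat n n"
  by (simp add: tuple_of_def)

lemma tuple_of_dim [simp]: "dim_row (tuple_of n F j) = n" "dim_col (tuple_of n F j) = n"
  by (simp_all add: tuple_of_def)

lemma tuple_of_index [simp]:
  "a < n \<Longrightarrow> b < n \<Longrightarrow> tuple_of n F j $$ (a, b) = vec_nth (F a b) j"
  by (simp add: tuple_of_def)

lemma tuple_of_cong:
  "(\<And>a b. a < n \<Longrightarrow> b < n \<Longrightarrow> F a b = G a b) \<Longrightarrow> tuple_of n F = tuple_of n G"
  by (intro ext eq_matI) simp_all

lemma tuple_of_eq_iff:
  "tuple_of n F = tuple_of n G \<longleftrightarrow> (\<forall>a<n. \<forall>b<n. F a b = G a b)"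
proof
  assume eq: "tuple_of n F = tuple_of n G"
  show "\<forall>a<n. \<forall>b<n. F a b = G a b"
  proof (intro allI impI)
    fix a b assume "a < n" "b < n"
    then have "vec_nth (F a b) j = vec_nth (G a b) j" for j
      using tuple_of_index[of a n b F j] tuple_of_index[of a n b G j] eq by simp
    then show "F a b = G a b" by (simp add: Finite_Cartesian_Product.vec_eq_iff)
  qed
next
  assume "\<forall>a<n. \<forall>b<n. F a b = G a b"
  then show "tuple_of n F = tuple_of n G" by (intro tuple_of_cong) simp
qed

lemma tuple_of_entries:
  assumes "X \<in> mat_tuples n"
  shows "tuple_of n (\<lambda>a b. \<chi> j. X j $$ (a, b)) = X"
proof (rule ext)
  fix j
  have "X j \<in> carrier_mat n n" using assms by (simp add: mat_tuples_def)
  then show "tuple_of n (\<lambda>a b. \<chi> j. X j $$ (a, b)) j = X j"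
    by (intro eq_matI) simp_all
qed

lemma norm_vec_sum_scale_squared:
  "(norm (\<Sum>a<n. x a *s v a))\<^sup>2 = (\<Sum>j\<in>UNIV. (cmod (\<Sum>a<n. x a * vec_nth (v a) j))\<^sup>2)"
  for v :: "nat \<Rightarrow> complex ^ 'd"
  by (simp add: norm_vec_squared)

lemma row_gram_carrier: "1\<^sub>m n - mat_sum n A \<in> carrier_mat n n"
  by (intro minus_carrier_mat) (simp add: mat_sum_def)

lemma row_gram_index:
  assumes "i < n" "k < n"
  shows "(1\<^sub>m n - mat_sum n (\<lambda>j. tuple_of n F j * mat_adjoint (tuple_of n F j))) $$ (i, k)
    = (if i = k then 1 else 0)
      - (\<Sum>j\<in>UNIV. \<Sum>b<n. vec_nth (F i b) j * cnj (vec_nth (F k b) j))"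
proof -
  have "(tuple_of n F j * mat_adjoint (tuple_of n F j)) $$ (i, k)
      = (\<Sum>b<n. vec_nth (F i b) j * cnj (vec_nth (F k b) j))" for j
  proof -
    have adj: "mat_adjoint (tuple_of n F j) \<in> carrier_mat n n" by (rule mat_adjoint_dim) simp
    have "(tuple_of n F j * mat_adjoint (tuple_of n F j)) $$ (i, k)
        = row (tuple_of n F j) i \<bullet> col (mat_adjoint (tuple_of n F j)) k"
      using assms carrier_matD[OF adj] by (intro index_mult_mat) simp_all
    also have "\<dots> = (\<Sum>b<n. vec_index (row (tuple_of n F j) i) b * vec_index (col (mat_adjoint (tuple_of n F j)) k) b)"
      using carrier_matD[OF adj] by (simp add: scalar_prod_def atLeast0LessThan)
    also have "\<dots> = (\<Sum>b<n. vec_nth (F i b) j * cnj (vec_nth (F k b) j))"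
      using assms carrier_matD[OF adj]
      by (intro sum.cong refl) (simp add: mat_adjoint_index[OF tuple_of_carrier])
    finally show ?thesis .
  qed
  then show ?thesis using assms by (simp add: mat_sum_def)
qed

text \<open>
  Expanding the square of the norm in \<open>row_form\<close> gives the double sum over the entries of
  \<open>\<Sum>\<^sub>j X\<^sub>j X\<^sub>j\<^sup>*\<close>; the proof only reorders the four summations.
\<close>

lemma row_gram_quadratic_form:
  fixes F :: "'d::finite kernel"
  assumes v: "v \<in> carrier_vec n"
  defines "A \<equiv> 1\<^sub>m n - mat_sum n (\<lambda>j. tuple_of n F j * mat_adjoint (tuple_of n F j))"
  defines "x \<equiv> \<lambda>a. cnj (vec_index v a)"
  shows "(A *\<^sub>v v) \<bullet>c v = of_real (coord_form n x - row_form n F x)"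
proof -
  have Ac: "A \<in> carrier_mat n n" unfolding A_def by (rule row_gram_carrier)
  have "(A *\<^sub>v v) \<bullet>c v = (\<Sum>i<n. \<Sum>k<n. A $$ (i, k) * cnj (x k) * x i)"
  proof -
    have "(A *\<^sub>v v) \<bullet>c v = (\<Sum>i<n. vec_index (A *\<^sub>v v) i * vec_index (conjugate v) i)"
      using v by (simp add: scalar_prod_def atLeast0LessThan)
    also have "\<dots> = (\<Sum>i<n. (\<Sum>k<n. A $$ (i, k) * vec_index v k) * x i)"
      using v carrier_matD[OF Ac]
      by (intro sum.cong refl) (simp add: scalar_prod_def atLeast0LessThan x_def)
    finally show ?thesis by (simp add: sum_distrib_right x_def)
  qed
  also have "\<dots> = (\<Sum>i<n. \<Sum>k<n. (if i = k then cnj (x k) * x i else 0))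
      - (\<Sum>i<n. \<Sum>k<n. \<Sum>j\<in>UNIV. \<Sum>b<n. (x i * vec_nth (F i b) j) * cnj (x k * vec_nth (F k b) j))"
    unfolding sum_subtractf[symmetric]
    by (intro sum.cong refl)
      (auto simp: A_def row_gram_index algebra_simps sum_distrib_left sum_distrib_right)
  also have "(\<Sum>i<n. \<Sum>k<n. (if i = k then cnj (x k) * x i else 0)) = of_real (coord_form n x)"
    by (simp add: coord_form_def complex_norm_square mult.commute del: of_real_power)
  also have "(\<Sum>i<n. \<Sum>k<n. \<Sum>j\<in>UNIV. \<Sum>b<n. (x i * vec_nth (F i b) j) * cnj (x k * vec_nth (F k b) j))
      = (\<Sum>i<n. \<Sum>j\<in>UNIV. \<Sum>k<n. \<Sum>b<n. (x i * vec_nth (F i b) j) * cnj (x k * vec_nth (F k b) j))"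
    by (rule sum.cong[OF refl], rule sum.swap)
  also have "\<dots> = (\<Sum>i<n. \<Sum>j\<in>UNIV. \<Sum>b<n. \<Sum>k<n. (x i * vec_nth (F i b) j) * cnj (x k * vec_nth (F k b) j))"
    by (rule sum.cong[OF refl], rule sum.cong[OF refl], rule sum.swap)
  also have "\<dots> = (\<Sum>j\<in>UNIV. \<Sum>i<n. \<Sum>b<n. \<Sum>k<n. (x i * vec_nth (F i b) j) * cnj (x k * vec_nth (F k b) j))"
    by (rule sum.swap)
  also have "\<dots> = (\<Sum>j\<in>UNIV. \<Sum>b<n. \<Sum>i<n. \<Sum>k<n. (x i * vec_nth (F i b) j) * cnj (x k * vec_nth (F k b) j))"
    by (rule sum.cong[OF refl], rule sum.swap)
  also have "\<dots> = (\<Sum>b<n. \<Sum>j\<in>UNIV. \<Sum>i<n. \<Sum>k<n. (x i * vec_nth (F i b) j) * cnj (x k * vec_nth (F k b) j))"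
    by (rule sum.swap)
  also have "\<dots> = of_real (row_form n F x)"
    unfolding row_form_def norm_vec_sum_scale_squared of_real_sum complex_norm_square cnj_sum sum_product
    by (rule refl)
  finally show ?thesis by simp
qed

lemma tuple_of_in_ball: "tuple_of n F \<in> nc_ball_level n \<longleftrightarrow> in_ball n F"
proof -
  let ?A = "1\<^sub>m n - mat_sum n (\<lambda>j. tuple_of n F j * mat_adjoint (tuple_of n F j))"
  have Ac: "?A \<in> carrier_mat n n" by (rule row_gram_carrier)
  have sa: "mat_adjoint ?A = ?A"
  proof (rule eq_matI)
    fix i k assume "i < dim_row ?A" "k < dim_col ?A"
    then have ik: "i < n" "k < n" using Ac by auto
    show "mat_adjoint ?A $$ (i, k) = ?A $$ (i, k)"
      unfolding mat_adjoint_index[OF Ac ik] row_gram_index[OF ik] row_gram_index[OF ik(2,1)]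
      by (simp add: mult.commute)
  qed (simp_all only: carrier_matD[OF mat_adjoint_dim[OF Ac]] carrier_matD[OF Ac])
  have "pos_def n ?A \<longleftrightarrow> in_ball n F"
  proof
    assume p: "pos_def n ?A"
    show "in_ball n F"
      unfolding in_ball_def
    proof (intro allI impI)
      fix x :: "nat \<Rightarrow> complex" assume x: "\<exists>a<n. x a \<noteq> 0"
      let ?v = "Matrix.vec n (\<lambda>a. cnj (x a))"
      have "?v \<noteq> 0\<^sub>v n" using x by (auto simp: Matrix.vec_eq_iff)
      then have "0 < (?A *\<^sub>v ?v) \<bullet>c ?v" using p by (simp add: pos_def_def)
      moreover have "coord_form n (\<lambda>a. cnj (vec_index ?v a)) = coord_form n x"
        "row_form n F (\<lambda>a. cnj (vec_index ?v a)) = row_form n F x"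
        by (simp_all add: coord_form_def row_form_def)
      ultimately show "row_form n F x < coord_form n x"
        by (simp add: row_gram_quadratic_form less_complex_def)
    qed
  next
    assume b: "in_ball n F"
    have "0 < (?A *\<^sub>v v) \<bullet>c v" if v: "v \<in> carrier_vec n" "v \<noteq> 0\<^sub>v n" for v
    proof -
      have "\<exists>a<n. cnj (vec_index v a) \<noteq> 0" using v by (auto simp: Matrix.vec_eq_iff)
      then have "row_form n F (\<lambda>a. cnj (vec_index v a)) < coord_form n (\<lambda>a. cnj (vec_index v a))"
        by (rule b[unfolded in_ball_def, rule_format])
      then show ?thesis by (simp add: row_gram_quadratic_form v(1) less_complex_def)
    qed
    then show "pos_def n ?A" using Ac sa by (simp add: pos_def_def)
  qed
  then show ?thesis by (simp add: nc_ball_level_def tuple_of_mat_tuples)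
qed

lemma unitriangular_conjugation:
  fixes A B \<Phi> :: "complex mat"
  assumes A: "A \<in> carrier_mat n n" and B: "B \<in> carrier_mat m m" and P: "\<Phi> \<in> carrier_mat n m"
  shows "four_block_mat (1\<^sub>m n) (- \<Phi>) (0\<^sub>m m n) (1\<^sub>m m) * mat_dsum A B
      * four_block_mat (1\<^sub>m n) \<Phi> (0\<^sub>m m n) (1\<^sub>m m)
    = four_block_mat A (A * \<Phi> - \<Phi> * B) (0\<^sub>m m n) B"
proof -
  have nP: "- \<Phi> \<in> carrier_mat n m" "- \<Phi> * B \<in> carrier_mat n m" "A * \<Phi> \<in> carrier_mat n m"
    "\<Phi> * B \<in> carrier_mat n m"
    using A B P by auto
  have "four_block_mat (1\<^sub>m n) (- \<Phi>) (0\<^sub>m m n) (1\<^sub>m m) * mat_dsum A B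
      = four_block_mat A (- \<Phi> * B) (0\<^sub>m m n) B"
    unfolding mat_dsum_def using A B P nP
    by (subst mult_four_block_mat[where ?nr1.0 = n and ?nr2.0 = m and ?n1.0 = n and ?n2.0 = m
        and ?nc1.0 = n and ?nc2.0 = m]) auto
  moreover have "four_block_mat A (- \<Phi> * B) (0\<^sub>m m n) B * four_block_mat (1\<^sub>m n) \<Phi> (0\<^sub>m m n) (1\<^sub>m m)
      = four_block_mat A (A * \<Phi> - \<Phi> * B) (0\<^sub>m m n) B"
    using A B P nP
    by (subst mult_four_block_mat[where ?nr1.0 = n and ?nr2.0 = m and ?n1.0 = n and ?n2.0 = m
        and ?nc1.0 = n and ?nc2.0 = m]) (auto simp: minus_add_uminus_mat[of _ n m])
  ultimately show ?thesis by simp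
qed

lemma unitriangular_inverts:
  fixes \<Phi> :: "complex mat"
  assumes P: "\<Phi> \<in> carrier_mat n m"
  shows "inverts_mat (four_block_mat (1\<^sub>m n) \<Phi> (0\<^sub>m m n) (1\<^sub>m m))
    (four_block_mat (1\<^sub>m n) (- \<Phi>) (0\<^sub>m m n) (1\<^sub>m m))"
proof -
  have z: "- 0\<^sub>m m m + 1\<^sub>m m = (1\<^sub>m m :: complex mat)"
    by (intro eq_matI) auto
  have "four_block_mat (1\<^sub>m n) \<Phi> (0\<^sub>m m n) (1\<^sub>m m) * four_block_mat (1\<^sub>m n) (- \<Phi>) (0\<^sub>m m n) (1\<^sub>m m)
    = 1\<^sub>m (n + m)"
    using P
    by (subst mult_four_block_mat[where ?nr1.0 = n and ?nr2.0 = m and ?n1.0 = n and ?n2.0 = m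
        and ?nc1.0 = n and ?nc2.0 = m]) (auto simp: z)
  then show ?thesis by (simp add: inverts_mat_def)
qed

lemma nc_function_onD:
  assumes "nc_function_on \<Omega> f"
  shows nc_function_on_carrier:
      "\<And>n X. 1 \<le> n \<Longrightarrow> X \<in> \<Omega> \<Longrightarrow> X \<in> mat_tuples n \<Longrightarrow> f X \<in> carrier_mat n n"
    and nc_function_on_dsum:
      "\<And>X Y. X \<in> \<Omega> \<Longrightarrow> Y \<in> \<Omega> \<Longrightarrow> f (tuple_dsum X Y) = mat_dsum (f X) (f Y)"
    and nc_function_on_similar:
      "\<And>n X S T. 1 \<le> n \<Longrightarrow> X \<in> \<Omega> \<Longrightarrow> X \<in> mat_tuples n \<Longrightarrow> S \<in> carrier_mat n n \<Longrightarrow>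
        T \<in> carrier_mat n n \<Longrightarrow> inverts_mat S T \<Longrightarrow> inverts_mat T S \<Longrightarrow>
        (\<lambda>j. T * X j * S) \<in> \<Omega> \<Longrightarrow> f (\<lambda>j. T * X j * S) = T * f X * S"
  using assms unfolding nc_function_on_def by blast+

lemma nc_ball_levelD: "X \<in> nc_ball_level n \<Longrightarrow> X \<in> mat_tuples n"
  by (simp add: nc_ball_level_def)

lemma nc_ball_level_in_ball: "1 \<le> n \<Longrightarrow> X \<in> nc_ball_level n \<Longrightarrow> X \<in> nc_ball"
  by (auto simp: nc_ball_def)

lemma nc_ball_level_unique:
  fixes X :: "'d::finite mat_tuple"
  assumes "X \<in> nc_ball" "X \<in> mat_tuples n"
  shows "X \<in> nc_ball_level n"
proof -
  obtain m where m: "X \<in> nc_ball_level m" using assms(1) by (auto simp: nc_ball_def)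
  then have "X undefined \<in> carrier_mat m m" "X undefined \<in> carrier_mat n n"
    using assms(2) by (auto simp: nc_ball_level_def mat_tuples_def)
  then show ?thesis using m by auto
qed

text \<open>
  A tuple satisfying \<open>block_similar\<close> is a direct sum conjugated by a unitriangular matrix, so the two
  nc axioms, applied one after the other, give the value of \<open>f\<close> there.
\<close>

lemma kernel_map_nc_self_map:
  fixes f :: "'d::finite mat_tuple \<Rightarrow> 'd mat_tuple"
  assumes nc: "nc_map_on nc_ball f" and self: "f ` nc_ball \<subseteq> nc_ball"
    and zero: "f (\<lambda>_. 0\<^sub>m 1 1) = (\<lambda>_. 0\<^sub>m 1 1)"
  shows "nc_self_map (kernel_map f)"
    and kernel_map_tuple_of:
      "\<And>n F. 1 \<le> n \<Longrightarrow> in_ball n F \<Longrightarrow> tuple_of n (kernel_map f n F) = f (tuple_of n F)"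
proof -
  have fnc: "nc_function_on nc_ball (\<lambda>X. f X i)" for i
    using nc by (simp add: nc_map_on_def)
  have mem: "tuple_of n F \<in> nc_ball" if "1 \<le> n" "in_ball n F" for n and F :: "'d kernel"
    using that nc_ball_level_in_ball tuple_of_in_ball by blast
  have val: "f (tuple_of n F) \<in> mat_tuples n" if "1 \<le> n" "in_ball n F" for n and F :: "'d kernel"
    unfolding mat_tuples_def
    using nc_function_on_carrier[OF fnc that(1) mem[OF that] tuple_of_mat_tuples] by simp
  have rep: "tuple_of n (kernel_map f n F) = f (tuple_of n F)" if "1 \<le> n" "in_ball n F"
    for n and F :: "'d kernel"
    unfolding kernel_map_def by (rule tuple_of_entries[OF val[OF that]])
  then show "\<And>n F. 1 \<le> n \<Longrightarrow> in_ball n F \<Longrightarrow> tuple_of n (kernel_map f n F) = f (tuple_of n F)" .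
  have sim: "f (tuple_of (n + m) T) i = four_block_mat (f (tuple_of n T) i)
      (f (tuple_of n T) i * mat n m (\<lambda>(a, b). \<phi> a b)
        - mat n m (\<lambda>(a, b). \<phi> a b) * f (tuple_of m (\<lambda>a b. T (n + a) (n + b))) i)
      (0\<^sub>m m n) (f (tuple_of m (\<lambda>a b. T (n + a) (n + b))) i)"
    if nm: "1 \<le> n" "1 \<le> m" and T: "in_ball (n + m) T" and s: "block_similar n m \<phi> T"
    for n m \<phi> i and T :: "'d kernel"
  proof -
    let ?X = "tuple_of n T" and ?Y = "tuple_of m (\<lambda>a b. T (n + a) (n + b))"
    let ?P = "mat n m (\<lambda>(a, b). \<phi> a b)"
    let ?S = "four_block_mat (1\<^sub>m n) ?P (0\<^sub>m m n) (1\<^sub>m m)"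
    let ?R = "four_block_mat (1\<^sub>m n) (- ?P) (0\<^sub>m m n) (1\<^sub>m m)"
    have X: "?X \<in> nc_ball" using mem[OF nm(1) in_ball_upper_left[OF T]] .
    have Y: "?Y \<in> nc_ball" using mem[OF nm(2) in_ball_lower_right[OF T]] .
    have P: "?P \<in> carrier_mat n m" by simp
    have XY: "tuple_dsum ?X ?Y \<in> nc_ball" by (rule nc_ball_dsum_closed[OF X Y])
    have XYt: "tuple_dsum ?X ?Y \<in> mat_tuples (n + m)"
      by (simp add: tuple_dsum_def mat_tuples_def mat_dsum_carrier)
    have T_eq: "(\<lambda>j. ?R * tuple_dsum ?X ?Y j * ?S) = tuple_of (n + m) T"
    proof (rule ext)
      fix j
      have "?R * tuple_dsum ?X ?Y j * ?S
          = four_block_mat (?X j) (?X j * ?P - ?P * ?Y j) (0\<^sub>m m n) (?Y j)"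
        unfolding tuple_dsum_def by (rule unitriangular_conjugation) simp_all
      also have "\<dots> = tuple_of (n + m) T j"
      proof (rule eq_matI)
        fix a b assume "a < dim_row (tuple_of (n + m) T j)" "b < dim_col (tuple_of (n + m) T j)"
        then have ab: "a < n + m" "b < n + m" by simp_all
        have corner: "(?X j * ?P - ?P * ?Y j) $$ (a, b - n) = vec_nth (T a b) j"
          if "a < n" "\<not> b < n"
        proof -
          have b: "b = n + (b - n)" "b - n < m" using that ab by simp_all
          have "T a (n + (b - n))
              = (\<Sum>k<n. \<phi> k (b - n) *s T a k) - (\<Sum>k<m. \<phi> a k *s T (n + k) (n + (b - n)))"
            using s that(1) b(2) unfolding block_similar_def by blast
          then have "vec_nth (T a b) j
              = (\<Sum>k<n. \<phi> k (b - n) * vec_nth (T a k) j) - (\<Sum>k<m. \<phi> a k * vec_nth (T (n + k) b) j)"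
            unfolding b(1)[symmetric] by simp
          moreover have "(?X j * ?P) $$ (a, b - n) = (\<Sum>k<n. \<phi> k (b - n) * vec_nth (T a k) j)"
            using that b(2) by (simp add: scalar_prod_def atLeast0LessThan mult.commute)
          moreover have "(?P * ?Y j) $$ (a, b - n) = (\<Sum>k<m. \<phi> a k * vec_nth (T (n + k) b) j)"
            using that b by (simp add: scalar_prod_def atLeast0LessThan)
          ultimately show ?thesis using that b(2) by simp
        qed
        show "four_block_mat (?X j) (?X j * ?P - ?P * ?Y j) (0\<^sub>m m n) (?Y j) $$ (a, b)
            = tuple_of (n + m) T j $$ (a, b)"
          using ab corner s unfolding block_similar_def
          by (auto simp: not_less dest: le_Suc_ex)
      qed simp_all
      finally show "?R * tuple_dsum ?X ?Y j * ?S = tuple_of (n + m) T j" .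
    qed
    have "f (\<lambda>j. ?R * tuple_dsum ?X ?Y j * ?S) i = ?R * f (tuple_dsum ?X ?Y) i * ?S"
    proof (rule nc_function_on_similar[OF fnc _ XY XYt])
      show "inverts_mat ?S ?R" by (rule unitriangular_inverts[OF P])
      show "inverts_mat ?R ?S" using unitriangular_inverts[of "- ?P" n m] P by simp
      show "(\<lambda>j. ?R * tuple_dsum ?X ?Y j * ?S) \<in> nc_ball"
        unfolding T_eq using nm T by (intro mem) auto
    qed (use nm in simp_all)
    also have "f (tuple_dsum ?X ?Y) i = mat_dsum (f ?X i) (f ?Y i)"
      by (rule nc_function_on_dsum[OF fnc X Y])
    also have "?R * \<dots> * ?S = four_block_mat (f ?X i) (f ?X i * ?P - ?P * f ?Y i) (0\<^sub>m m n) (f ?Y i)"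
      using nc_function_on_carrier[OF fnc nm(1) X tuple_of_mat_tuples]
        nc_function_on_carrier[OF fnc nm(2) Y tuple_of_mat_tuples]
      by (rule unitriangular_conjugation) simp
    finally show ?thesis unfolding T_eq .
  qed
  have dims: "f (tuple_of n F) i \<in> carrier_mat n n" if "1 \<le> n" "in_ball n F"
    for n i and F :: "'d kernel"
    using val[OF that] by (simp add: mat_tuples_def)
  show "nc_self_map (kernel_map f)"
  proof
    fix n and F :: "'d kernel" assume n: "1 \<le> n" "in_ball n F"
    have "f (tuple_of n F) \<in> nc_ball" using self mem[OF n] by blast
    then have "tuple_of n (kernel_map f n F) \<in> nc_ball_level n"
      unfolding rep[OF n] using val[OF n] by (rule nc_ball_level_unique)
    then show "in_ball n (kernel_map f n F)" by (simp only: tuple_of_in_ball)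
  next
    have "tuple_of 1 (\<lambda>_ _. 0 :: complex ^ 'd) = (\<lambda>_. 0\<^sub>m 1 1)"
      by (intro ext eq_matI) simp_all
    then have "f (tuple_of 1 (\<lambda>_ _. 0)) = (\<lambda>_. 0\<^sub>m 1 1)" by (simp only: zero)
    then show "kernel_map f 1 (\<lambda>_ _. 0) 0 0 = 0"
      by (simp add: kernel_map_def Finite_Cartesian_Product.vec_eq_iff)
  next
    fix n a b and F G :: "'d kernel"
    assume "\<And>a b. a < n \<Longrightarrow> b < n \<Longrightarrow> F a b = G a b"
    then show "kernel_map f n F a b = kernel_map f n G a b"
      unfolding kernel_map_def using tuple_of_cong[of n F G] by simp
  next
    fix n m \<phi> and T :: "'d kernel"
    assume h: "1 \<le> n" "1 \<le> m" "in_ball (n + m) T" "block_similar n m \<phi> T"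
    let ?X = "tuple_of n T" and ?Y = "tuple_of m (\<lambda>a b. T (n + a) (n + b))"
    have Xd: "f ?X i \<in> carrier_mat n n" for i using dims[OF h(1) in_ball_upper_left[OF h(3)]] .
    have Yd: "f ?Y i \<in> carrier_mat m m" for i using dims[OF h(2) in_ball_lower_right[OF h(3)]] .
    have up: "kernel_map f (n + m) T a b = kernel_map f n T a b" if "a < n" "b < n" for a b
      unfolding kernel_map_def sim[OF h] using that carrier_matD[OF Xd] carrier_matD[OF Yd] by simp
    then show "\<And>a b. a < n \<Longrightarrow> b < n \<Longrightarrow> kernel_map f (n + m) T a b = kernel_map f n T a b" .
    have lo: "kernel_map f (n + m) T (n + a) (n + b) = kernel_map f m (\<lambda>a b. T (n + a) (n + b)) a b"
      if "a < m" "b < m" for a b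
      unfolding kernel_map_def sim[OF h] using that carrier_matD[OF Xd] carrier_matD[OF Yd] by simp
    then show "\<And>a b. a < m \<Longrightarrow> b < m \<Longrightarrow>
      kernel_map f (n + m) T (n + a) (n + b) = kernel_map f m (\<lambda>a b. T (n + a) (n + b)) a b" .
    have ze: "kernel_map f (n + m) T (n + a) b = 0" if "a < m" "b < n" for a b
      unfolding kernel_map_def sim[OF h] using that carrier_matD[OF Xd] carrier_matD[OF Yd]
      by (simp add: Finite_Cartesian_Product.vec_eq_iff)
    have co: "kernel_map f (n + m) T a (n + b) = (\<Sum>k<n. \<phi> k b *s kernel_map f n T a k)
        - (\<Sum>k<m. \<phi> a k *s kernel_map f m (\<lambda>a b. T (n + a) (n + b)) k b)"
      if "a < n" "b < m" for a b
      unfolding kernel_map_def sim[OF h] using that carrier_matD[OF Xd] carrier_matD[OF Yd]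
      by (simp add: Finite_Cartesian_Product.vec_eq_iff scalar_prod_def atLeast0LessThan mult.commute)
    show "block_similar n m \<phi> (kernel_map f (n + m) T)"
      unfolding block_similar_def using ze co up lo by simp
  qed
qed

section \<open>Intertwining and difference quotients\<close>

lemma block_similarD:
  assumes "block_similar n m \<phi> T"
  shows "\<And>a b. a < m \<Longrightarrow> b < n \<Longrightarrow> T (n + a) b = 0"
    and "\<And>a b. a < n \<Longrightarrow> b < m \<Longrightarrow> T a (n + b) =
        (\<Sum>k<n. \<phi> k b *s T a k) - (\<Sum>k<m. \<phi> a k *s T (n + k) (n + b))"
  using assms unfolding block_similar_def by blast+

lemma nc_self_map_compose:
  fixes e e' :: "nat \<Rightarrow> 'd::finite kernel \<Rightarrow> 'd kernel"
  assumes "nc_self_map e" "nc_self_map e'"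
  shows "nc_self_map (\<lambda>n F. e n (e' n F))"
proof -
  interpret e: nc_self_map e by fact
  interpret e': nc_self_map e' by fact
  show ?thesis
  proof
    show "e 1 (e' 1 (\<lambda>_ _. 0)) 0 0 = 0"
      using e.cong[of 1 "e' 1 (\<lambda>_ _. 0)" "\<lambda>_ _. 0" 0 0] e.zero e'.zero by simp
  next
    fix n m \<phi> a b and T :: "'d kernel"
    assume h: "1 \<le> n" "1 \<le> m" "in_ball (n + m) T" "block_similar n m \<phi> T"
    have nm: "1 \<le> n + m" using h(1) by simp
    note b' = e'.ball[OF nm h(3)] and s' = e'.similar[OF h]
    show "block_similar n m \<phi> (e (n + m) (e' (n + m) T))"
      by (rule e.similar[OF h(1,2) b' s'])
    show "e (n + m) (e' (n + m) T) a b = e n (e' n T) a b" if "a < n" "b < n"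
      unfolding e.similar_upper[OF h(1,2) b' s' that]
      by (rule e.cong[OF e'.similar_upper[OF h] that])
    show "e (n + m) (e' (n + m) T) (n + a) (n + b) = e m (e' m (\<lambda>a b. T (n + a) (n + b))) a b"
      if "a < m" "b < m"
      unfolding e.similar_lower[OF h(1,2) b' s' that]
      by (rule e.cong[OF e'.similar_lower[OF h] that])
  next
    fix n a b and F G :: "'d kernel"
    assume "\<And>a b. a < n \<Longrightarrow> b < n \<Longrightarrow> F a b = G a b" "a < n" "b < n"
    then show "e n (e' n F) a b = e n (e' n G) a b"
      by (intro e.cong e'.cong) auto
  qed (simp add: e.ball e'.ball)
qed

lemma nc_self_map_id: "nc_self_map (\<lambda>n F. F)"
  by unfold_locales auto

lemma nc_self_map_funpow:
  assumes "nc_self_map e"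
  shows "nc_self_map (\<lambda>n. e n ^^ k)"
proof (induction k)
  case 0
  then show ?case by (simp add: nc_self_map_id id_def)
next
  case (Suc k)
  then show ?case using nc_self_map_compose[OF assms Suc] by (simp add: o_def)
qed

lemma nc_self_map_average:
  fixes e :: "nat \<Rightarrow> 'd::finite kernel \<Rightarrow> 'd kernel"
  assumes "nc_self_map e"
  shows "nc_self_map (\<lambda>n F a b. (1/2) *s (e n F a b + F a b))"
proof -
  interpret e: nc_self_map e by fact
  show ?thesis
  proof
    show "(1/2) *s (e 1 (\<lambda>_ _. 0) 0 0 + 0) = 0" by (simp add: e.zero[simplified])
  next
    fix n m \<phi> a b and T :: "'d kernel"
    assume h: "1 \<le> n" "1 \<le> m" "in_ball (n + m) T" "block_similar n m \<phi> T"
    show "(1/2) *s (e (n + m) T a b + T a b) = (1/2) *s (e n T a b + T a b)" if "a < n" "b < n"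
      by (simp only: e.similar_upper[OF h that])
    show "(1/2) *s (e (n + m) T (n + a) (n + b) + T (n + a) (n + b))
        = (1/2) *s (e m (\<lambda>a b. T (n + a) (n + b)) a b + T (n + a) (n + b))" if "a < m" "b < m"
      by (simp only: e.similar_lower[OF h that])
    note s = block_similarD[OF h(4)] and s' = block_similarD[OF e.similar[OF h]]
    have "(1/2) *s (e (n + m) T a (n + b) + T a (n + b)) =
        (\<Sum>k<n. \<phi> k b *s ((1/2) *s (e (n + m) T a k + T a k)))
      - (\<Sum>k<m. \<phi> a k *s ((1/2) *s (e (n + m) T (n + k) (n + b) + T (n + k) (n + b))))"
      if "a < n" "b < m" for a b
      unfolding s(2)[OF that] s'(2)[OF that] Finite_Cartesian_Product.vec_eq_iff
      by (simp add: sum.distrib sum_distrib_left algebra_simps sum_divide_distrib add_divide_distrib)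
    then show "block_similar n m \<phi> (\<lambda>a b. (1/2) *s (e (n + m) T a b + T a b))"
      unfolding block_similar_def by (simp add: s(1) s'(1))
  next
    fix n a b and F G :: "'d kernel"
    assume FG: "\<And>a b. a < n \<Longrightarrow> b < n \<Longrightarrow> F a b = G a b" and ab: "a < n" "b < n"
    show "(1/2) *s (e n F a b + F a b) = (1/2) *s (e n G a b + G a b)"
      by (simp only: e.cong[OF FG ab] FG[OF ab])
  next
    fix n and F :: "'d kernel" assume "1 \<le> n" "in_ball n F"
    then show "in_ball n (\<lambda>a b. (1/2) *s (e n F a b + F a b))"
      by (intro in_ball_average e.ball)
  qed
qed

context nc_self_map
begin

text \<open>
  The direct sum of \<open>F\<close> and \<open>G\<close> is block similar to itself both through \<open>\<phi>\<close>, because the corner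
  \<open>F \<phi> - \<phi> G\<close> vanishes, and through zero. The corner of its image is therefore \<open>e F \<phi> - \<phi> e G\<close> and
  zero at the same time.
\<close>

lemma intertwine:
  assumes nm: "1 \<le> n" "1 \<le> m" and F: "in_ball n F" and G: "in_ball m G"
    and eq: "\<And>a b. a < n \<Longrightarrow> b < m \<Longrightarrow> (\<Sum>k<n. \<phi> k b *s F a k) = (\<Sum>k<m. \<phi> a k *s G k b)"
    and ab: "a < n" "b < m"
  shows "(\<Sum>k<n. \<phi> k b *s e n F a k) = (\<Sum>k<m. \<phi> a k *s e m G k b)"
proof -
  define T where "T = block_kernel n F (\<lambda>_ _. 0) G"
  have T: "in_ball (n + m) T" unfolding T_def by (rule in_ball_direct_sum[OF F G])
  have s: "block_similar n m \<phi> T"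
    unfolding block_similar_def T_def by (simp add: eq)
  have s0: "block_similar n m (\<lambda>_ _. 0) T"
    unfolding block_similar_def T_def by simp
  have up: "e (n + m) T a k = e n F a k" if "k < n" for k
    unfolding similar_upper[OF nm T s ab(1) that]
    by (rule cong[OF _ ab(1) that]) (simp add: T_def)
  have lo: "e (n + m) T (n + k) (n + b) = e m G k b" if "k < m" for k
    unfolding similar_lower[OF nm T s that ab(2)]
    by (rule cong[OF _ that ab(2)]) (simp add: T_def)
  have "e (n + m) T a (n + b) = 0"
    using block_similarD(2)[OF similar[OF nm T s0] ab] by simp
  with block_similarD(2)[OF similar[OF nm T s] ab] show ?thesis
    by (simp add: up lo)
qed

text \<open>
  The first \<open>n\<close> coordinates span an invariant subspace of \<open>T\<close>, and their inclusion intertwines \<open>T\<close> with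
  its upper left block, whatever the upper right corner is.
\<close>

lemma upper_left:
  assumes nm: "1 \<le> n" "1 \<le> m" and T: "in_ball (n + m) T"
    and z: "\<And>a b. a < m \<Longrightarrow> b < n \<Longrightarrow> T (n + a) b = 0"
    and b: "b < n"
  shows "a < n \<Longrightarrow> e (n + m) T a b = e n T a b"
    and "a < m \<Longrightarrow> e (n + m) T (n + a) b = 0"
proof -
  let ?\<phi> = "\<lambda>k b::nat. if k = b then 1 else (0 :: complex)"
  have *: "e (n + m) T a b = (\<Sum>k<n. ?\<phi> a k *s e n T k b)" if a: "a < n + m" for a
  proof -
    have "(\<Sum>k<n + m. ?\<phi> k b *s e (n + m) T a k) = (\<Sum>k<n. ?\<phi> a k *s e n T k b)"
    proof (rule intertwine[OF _ nm(1) T in_ball_upper_left[OF T] _ a b])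
      fix a b assume ab: "a < n + m" "b < n"
      have "(\<Sum>k<n + m. ?\<phi> k b *s T a k) = T a b"
        using ab by (simp add: if_distrib[of "\<lambda>c. c *s _"] cong: if_cong)
      also have "\<dots> = (\<Sum>k<n. ?\<phi> a k *s T k b)"
      proof (cases "a < n")
        case True
        then show ?thesis by (simp add: if_distrib[of "\<lambda>c. c *s _"] cong: if_cong)
      next
        case False
        then obtain c where "a = n + c" "c < m" using ab by (metis le_Suc_ex nat_add_left_cancel_less not_less)
        then show ?thesis using z[of c b] ab by (simp add: if_distrib[of "\<lambda>c. c *s _"] cong: if_cong)
      qed
      finally show "(\<Sum>k<n + m. ?\<phi> k b *s T a k) = (\<Sum>k<n. ?\<phi> a k *s T k b)" .
    qed (use nm in simp)
    moreover have "(\<Sum>k<n + m. ?\<phi> k b *s e (n + m) T a k) = e (n + m) T a b"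
      using b by (simp add: if_distrib[of "\<lambda>c. c *s _"] cong: if_cong)
    ultimately show ?thesis by simp
  qed
  show "a < n \<Longrightarrow> e (n + m) T a b = e n T a b"
    using *[of a] by (simp add: if_distrib[of "\<lambda>c. c *s _"] cong: if_cong)
  show "a < m \<Longrightarrow> e (n + m) T (n + a) b = 0"
    using *[of "n + a"] by (simp add: if_distrib[of "\<lambda>c. c *s _"] cong: if_cong)
qed

text \<open>
  Block similarity through \<open>\<phi> = c I\<close>. The corner is a rescaled difference of values, but being an entry
  of a point of the ball it is bounded by one; every quantitative estimate on \<open>e\<close> comes from this.
\<close>

lemma difference_corner:
  assumes n: "1 \<le> n" and T: "in_ball (n + n) (block_kernel n F (\<lambda>a b. c *s (F a b - G a b)) G)"
    and ab: "a < n" "b < n"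
  shows "e (n + n) (block_kernel n F (\<lambda>a b. c *s (F a b - G a b)) G) a (n + b)
    = c *s (e n F a b - e n G a b)"
proof -
  let ?T = "block_kernel n F (\<lambda>a b. c *s (F a b - G a b)) G"
  let ?\<phi> = "\<lambda>k b::nat. if k = b then c else 0"
  have s: "block_similar n n ?\<phi> ?T"
    unfolding block_similar_def
    by (simp add: if_distrib[of "\<lambda>c. c *s _"] vec.scale_right_diff_distrib cong: if_cong)
  have up: "e (n + n) ?T a b = e n F a b"
    unfolding similar_upper[OF n n T s ab] by (rule cong[OF _ ab]) simp
  have lo: "e (n + n) ?T (n + a) (n + b) = e n G a b"
    unfolding similar_lower[OF n n T s ab] by (rule cong[OF _ ab]) simp
  have "e (n + n) ?T a (n + b) = c *s e (n + n) ?T a b - c *s e (n + n) ?T (n + a) (n + b)"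
    unfolding block_similarD(2)[OF similar[OF n n T s] ab]
    using ab by (simp add: if_distrib[of "\<lambda>c. c *s _"] cong: if_cong)
  then show ?thesis unfolding up lo by (simp only: vec.scale_right_diff_distrib)
qed

lemma difference_bound:
  assumes n: "1 \<le> n" and T: "in_ball (n + n) (block_kernel n F (\<lambda>a b. c *s (F a b - G a b)) G)"
    and ab: "a < n" "b < n"
  shows "cmod c * norm (e n F a b - e n G a b) \<le> 1"
proof -
  let ?T = "block_kernel n F (\<lambda>a b. c *s (F a b - G a b)) G"
  have "norm (e (n + n) ?T a (n + b)) \<le> 1"
    using n T ab by (intro in_ball_entry[OF ball]) auto
  then show ?thesis unfolding difference_corner[OF assms] norm_vec_scale .
qed

lemma zero_level:
  assumes n: "1 \<le> n" and F: "\<And>a b. a < n \<Longrightarrow> b < n \<Longrightarrow> F a b = 0" and ab: "a < n" "b < n"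
  shows "e n F a b = 0"
proof -
  let ?\<phi> = "\<lambda>k i::nat. if k = b then 1 else (0 :: complex)"
  have "(\<Sum>k<n. ?\<phi> k 0 *s e n F a k) = (\<Sum>k<1. ?\<phi> a k *s e 1 (\<lambda>_ _. 0) k 0)"
  proof (rule intertwine[OF n _ _ _ _ ab(1)])
    show "in_ball n F" using F by (intro in_ball_small_entries[of n F 0]) simp_all
    show "in_ball 1 (\<lambda>_ _. 0 :: complex ^ 'd)" by (simp add: in_ball_one[simplified])
  qed (use F in simp_all)
  then show ?thesis using ab by (simp add: zero[simplified] if_distrib[of "\<lambda>c. c *s _"] cong: if_cong)
qed

end

section \<open>The derivative at the origin\<close>

definition nilpotent_kernel :: "complex ^ 'd \<Rightarrow> 'd::finite kernel" where
  "nilpotent_kernel \<beta> = (\<lambda>a b. if a = 0 \<and> b = 1 then \<beta> else 0)"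

lemma in_ball_nilpotent:
  assumes "norm \<beta> < 1"
  shows "in_ball 2 (nilpotent_kernel \<beta>)"
  unfolding in_ball_def
proof (intro allI impI)
  fix x :: "nat \<Rightarrow> complex" assume x: "\<exists>a<2. x a \<noteq> 0"
  have "row_form 2 (nilpotent_kernel \<beta>) x = (cmod (x 0))\<^sup>2 * (norm \<beta>)\<^sup>2"
    by (simp add: row_form_def nilpotent_kernel_def numeral_2_eq_2 norm_vec_scale power_mult_distrib)
  moreover have "coord_form 2 x = (cmod (x 0))\<^sup>2 + (cmod (x 1))\<^sup>2"
    by (simp add: coord_form_def numeral_2_eq_2)
  moreover have "(cmod (x 0))\<^sup>2 * (norm \<beta>)\<^sup>2 < (cmod (x 0))\<^sup>2 + (cmod (x 1))\<^sup>2"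
  proof (cases "x 0 = 0")
    case True
    then have "x 1 \<noteq> 0" using x by (metis One_nat_def less_2_cases)
    then show ?thesis using True by simp
  next
    case False
    have "(norm \<beta>)\<^sup>2 < 1" using assms by (simp add: power_less_one_iff)
    then have "(cmod (x 0))\<^sup>2 * (norm \<beta>)\<^sup>2 < (cmod (x 0))\<^sup>2 * 1"
      using False by (intro mult_strict_left_mono) auto
    then show ?thesis by (smt (verit) zero_le_power2)
  qed
  ultimately show "row_form 2 (nilpotent_kernel \<beta>) x < coord_form 2 x" by simp
qed

context nc_self_map
begin

text \<open>
  On a power series \<open>\<Sum>\<^sub>w c\<^sub>w Z\<^sup>w\<close> the nilpotent tuple kills all words of length at least two, so this is the
  derivative at the origin, for \<open>norm \<beta> < 1\<close>.
\<close>

definition linear_part :: "complex ^ 'd \<Rightarrow> complex ^ 'd" where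
  "linear_part \<beta> = e 2 (nilpotent_kernel \<beta>) 0 1"

text \<open>
  The first basis vector spans a subspace, and the second coordinate a quotient, on which the tuple
  acts as zero; \<open>e\<close> respects both, so the value has the same shape.
\<close>

lemma nilpotent_value:
  assumes \<beta>: "norm \<beta> < 1" and ab: "a < 2" "b < 2"
  shows "e 2 (nilpotent_kernel \<beta>) a b = nilpotent_kernel (linear_part \<beta>) a b"
proof -
  let ?N = "nilpotent_kernel \<beta>"
  note N = in_ball_nilpotent[OF \<beta>]
  have z1: "in_ball 1 (\<lambda>_ _. 0 :: complex ^ 'd)" by (simp add: in_ball_one[simplified])
  let ?u = "\<lambda>k i::nat. if k = 0 then 1 else (0 :: complex)"
  have "(\<Sum>k<2. ?u k 0 *s e 2 ?N a k) = (\<Sum>k<1. ?u a k *s e 1 (\<lambda>_ _. 0) k 0)" if "a < 2" for a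
    by (rule intertwine[OF _ _ N z1 _ that]) (simp_all add: nilpotent_kernel_def numeral_2_eq_2)
  then have col: "e 2 ?N a 0 = 0" if "a < 2" for a
    using that by (simp add: numeral_2_eq_2 zero[simplified])
  let ?v = "\<lambda>i k::nat. if k = 1 then 1 else (0 :: complex)"
  have "(\<Sum>k<1. ?v k b *s e 1 (\<lambda>_ _. 0) 0 k) = (\<Sum>k<2. ?v 0 k *s e 2 ?N k b)" if "b < 2" for b
    by (rule intertwine[OF _ _ z1 N _ _ that]) (simp_all add: nilpotent_kernel_def numeral_2_eq_2)
  then have row: "e 2 ?N 1 b = 0" if "b < 2" for b
    using that by (simp add: numeral_2_eq_2 zero[simplified])
  have "a = 0 \<or> a = 1" "b = 0 \<or> b = 1" using ab by auto
  then show ?thesis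
    using col[of a] row[of b] ab by (auto simp: nilpotent_kernel_def linear_part_def)
qed

lemma linear_part_norm_less:
  assumes "norm \<beta> < 1"
  shows "norm (linear_part \<beta>) < 1"
proof -
  have "in_ball 2 (e 2 (nilpotent_kernel \<beta>))" by (rule ball[OF _ in_ball_nilpotent[OF assms]]) simp
  then have "(\<Sum>b<2. (norm (e 2 (nilpotent_kernel \<beta>) 0 b))\<^sup>2) < 1" by (rule in_ball_row) simp
  then have "(norm (linear_part \<beta>))\<^sup>2 < 1"
    using nilpotent_value[OF assms] by (simp add: numeral_2_eq_2 nilpotent_kernel_def)
  then show ?thesis by (simp add: power_less_one_iff abs_square_less_1)
qed

lemma linear_part_scale:
  assumes "norm \<beta> < 1" "norm (c *s \<beta>) < 1"
  shows "linear_part (c *s \<beta>) = c *s linear_part \<beta>"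
proof -
  let ?\<phi> = "\<lambda>k b::nat. if k = b then (if k = 0 then 1 else c) else 0"
  have "(\<Sum>k<2. ?\<phi> k 1 *s e 2 (nilpotent_kernel \<beta>) 0 k)
      = (\<Sum>k<2. ?\<phi> 0 k *s e 2 (nilpotent_kernel (c *s \<beta>)) k 1)"
    by (rule intertwine[OF _ _ in_ball_nilpotent[OF assms(1)] in_ball_nilpotent[OF assms(2)]])
      (auto simp: nilpotent_kernel_def numeral_2_eq_2)
  then show ?thesis by (simp add: numeral_2_eq_2 linear_part_def)
qed

lemma linear_part_norm_le:
  assumes "norm \<beta> < 1"
  shows "norm (linear_part \<beta>) \<le> norm \<beta>"
proof (rule dense_ge_bounded[OF assms])
  fix r assume r: "norm \<beta> < r" "r < 1"
  then have r0: "0 < r" using norm_ge_zero[of \<beta>] by linarith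
  let ?\<gamma> = "of_real (1/r) *s \<beta>"
  have \<gamma>: "norm ?\<gamma> < 1" using r r0 by (simp add: norm_vec_scale norm_divide)
  have eq: "of_real r *s ?\<gamma> = \<beta>" using r0 by (simp add: of_real_mult[symmetric] del: of_real_mult)
  have "linear_part \<beta> = of_real r *s linear_part ?\<gamma>"
    using linear_part_scale[OF \<gamma>, of "of_real r"] assms unfolding eq by simp
  then have "norm (linear_part \<beta>) = r * norm (linear_part ?\<gamma>)"
    using r0 by (simp add: norm_vec_scale)
  also have "\<dots> \<le> r * 1" using linear_part_norm_less[OF \<gamma>] r0 by (intro mult_left_mono) auto
  finally show "norm (linear_part \<beta>) \<le> r" by simp
qed

text \<open>
  An amplification of \<open>linear_part\<close>: on block nilpotent tuples \<open>e\<close> acts as the derivative at the origin in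
  each entry separately. First the row \<open>a\<close> of the corner is cut out by an intertwiner from the left, then
  its column \<open>b\<close> by one from the right.
\<close>

lemma corner_linear_part:
  assumes n: "1 \<le> n" and small: "\<And>a b. a < n \<Longrightarrow> b < n \<Longrightarrow> norm (C a b) \<le> M" "(n + n) * M < 1"
    and ab: "a < n" "b < n"
  shows "e (n + n) (block_kernel n (\<lambda>_ _. 0) C (\<lambda>_ _. 0)) a (n + b) = linear_part (C a b)"
proof -
  define T where "T = block_kernel n (\<lambda>_ _. 0) C (\<lambda>_ _. 0)"
  define R where "R = block_kernel 1 (\<lambda>_ _. 0) (\<lambda>_ k. C a k) (\<lambda>_ _. 0)"
  have Ts: "T i k = 0" "T i (n + j) = C i j" "T (n + i) k = 0" "T (n + i) (n + j) = 0"
    if "i < n" "k < n" for i j k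
    using that by (simp_all add: T_def)
  have M: "0 \<le> M" using small(1)[OF ab] norm_ge_zero order_trans by blast
  have split: "k < n \<or> (\<exists>j<n. k = n + j)" if "k < n + n" for k
    using that by (metis add_less_cancel_left le_Suc_ex not_less)
  have split1: "k = 0 \<or> (\<exists>j<n. k = Suc j)" if "k < Suc n" for k
    using that by (cases k) auto
  have "norm (T i k) \<le> M" if "i < n + n" "k < n + n" for i k
    using split[OF that(1)] split[OF that(2)] small(1) M by (auto simp: Ts)
  then have T_ball: "in_ball (n + n) T" using small(2) by (rule in_ball_small_entries)
  have "real (1 + n) * M \<le> (n + n) * M" using n M by (intro mult_right_mono) auto
  then have lt: "real (1 + n) * M < 1" using small(2) by simp
  have Rs: "R 0 0 = 0" "R 0 (Suc j) = C a j" "R (Suc i) k = 0" for i j k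
    by (simp_all add: R_def block_kernel_def)
  have "norm (R i k) \<le> M" if "i < 1 + n" "k < 1 + n" for i k
    using split1[of i] split1[of k] that small(1)[OF ab(1)] M by (auto simp: Rs)
  then have R_ball: "in_ball (1 + n) R" using lt by (rule in_ball_small_entries)
  have "norm (C a b) \<le> M" using small(1)[OF ab] .
  also have "M < 1"
  proof -
    have "1 * M \<le> real (1 + n) * M" using M by (intro mult_right_mono) auto
    then show ?thesis using lt by simp
  qed
  finally have C: "norm (C a b) < 1" .
  let ?\<psi> = "\<lambda>i k. if i = 0 then (if k = a then 1 else 0) else if k = n + (i - 1) then 1 else (0 :: complex)"
  have sum\<psi>: "(\<Sum>k<n + n. ?\<psi> 0 k *s H k) = H a"
      "j < n \<Longrightarrow> (\<Sum>k<n + n. ?\<psi> (Suc j) k *s H k) = H (n + j)"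
    for j and H :: "nat \<Rightarrow> complex ^ 'd"
    using ab by (simp_all add: if_distrib[of "\<lambda>c. c *s _"] cong: if_cong)
  have \<psi>sum: "(\<Sum>k<Suc n. ?\<psi> k (n + j) *s H k) = H (Suc j)" if "j < n" for j and H :: "nat \<Rightarrow> complex ^ 'd"
  proof -
    have "(\<Sum>k<Suc n. ?\<psi> k (n + j) *s H k) = (\<Sum>k<n. (if k = j then 1 else 0) *s H (Suc k))"
      using ab by (subst sum.lessThan_Suc_shift) (auto intro!: sum.cong)
    then show ?thesis using that by (simp add: if_distrib[of "\<lambda>c. c *s _"] cong: if_cong)
  qed
  have \<psi>sum0: "(\<Sum>k<Suc n. ?\<psi> k j *s H k) = (if j = a then H 0 else 0)" if "j < n"
    for j and H :: "nat \<Rightarrow> complex ^ 'd"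
    using that by (subst sum.lessThan_Suc_shift) auto
  have "(\<Sum>k<1 + n. ?\<psi> k (n + b) *s e (1 + n) R 0 k) = (\<Sum>k<n + n. ?\<psi> 0 k *s e (n + n) T k (n + b))"
  proof (rule intertwine[OF _ _ R_ball T_ball])
    fix i k assume ik: "i < 1 + n" "k < n + n"
    show "(\<Sum>j<1 + n. ?\<psi> j k *s R i j) = (\<Sum>j<n + n. ?\<psi> i j *s T j k)"
    proof -
      have L: "(\<Sum>j<1 + n. ?\<psi> j k *s R i j)
          = (if k < n then (if k = a then R i 0 else 0) else R i (Suc (k - n)))"
      proof (cases "k < n")
        case True
        then show ?thesis using \<psi>sum0[OF True, of "R i"] by (simp only: plus_1_eq_Suc if_True)
      next
        case False
        then have "k = n + (k - n)" "k - n < n" using ik by auto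
        then show ?thesis using \<psi>sum[of "k - n" "R i"] False by (simp only: plus_1_eq_Suc if_False)
      qed
      consider "i = 0" | j where "i = Suc j" "j < n" using split1[of i] ik by auto
      then show ?thesis
      proof cases
        case 1
        have "(\<Sum>j<n + n. ?\<psi> i j *s T j k) = T a k" unfolding 1 by (rule sum\<psi>(1))
        then show ?thesis unfolding L
          using split[OF ik(2)] ab by (auto simp: 1 Rs Ts)
      next
        case 2
        have "(\<Sum>j<n + n. ?\<psi> i j *s T j k) = T (n + j) k" unfolding 2(1) by (rule sum\<psi>(2)[OF 2(2)])
        then show ?thesis unfolding L
          using split[OF ik(2)] 2 by (auto simp: Rs Ts)
      qed
    qed
  qed (use n ab in auto)
  then have 1: "e (1 + n) R 0 (Suc b) = e (n + n) T a (n + b)"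
    by (simp only: sum\<psi>(1) plus_1_eq_Suc \<psi>sum[OF ab(2)])
  let ?\<phi> = "\<lambda>i k::nat. if k = 0 then (if i = 0 then 1 else 0) else if i = Suc b then 1 else (0 :: complex)"
  let ?N = "nilpotent_kernel (C a b)"
  have \<phi>sum: "(\<Sum>j<Suc n. ?\<phi> j 0 *s H j) = H 0" "(\<Sum>j<Suc n. ?\<phi> j (Suc 0) *s H j) = H (Suc b)"
    for H :: "nat \<Rightarrow> complex ^ 'd"
    using ab by (simp_all add: if_distrib[of "\<lambda>c. c *s _"] cong: if_cong)
  have "(\<Sum>k<1 + n. ?\<phi> k 1 *s e (1 + n) R 0 k) = (\<Sum>k<2. ?\<phi> 0 k *s e 2 ?N k 1)"
  proof (rule intertwine[OF _ _ R_ball in_ball_nilpotent[OF C]])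
    fix i k :: nat assume ik: "i < 1 + n" "k < 2"
    then consider "k = 0" | "k = Suc 0" by linarith
    then show "(\<Sum>j<1 + n. ?\<phi> j k *s R i j) = (\<Sum>j<2. ?\<phi> i j *s ?N j k)"
    proof cases
      case 1
      have "(\<Sum>j<1 + n. ?\<phi> j k *s R i j) = R i 0"
        unfolding 1 plus_1_eq_Suc by (rule \<phi>sum(1))
      then have L: "(\<Sum>j<1 + n. ?\<phi> j k *s R i j) = R i 0" .
      show ?thesis unfolding L using split1[of i] ik(1) 1
        by (auto simp: Rs numeral_2_eq_2 nilpotent_kernel_def)
    next
      case 2
      have L: "(\<Sum>j<1 + n. ?\<phi> j k *s R i j) = R i (Suc b)"
        unfolding 2 plus_1_eq_Suc by (rule \<phi>sum(2))
      show ?thesis unfolding L using split1[of i] ik(1) 2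
        by (auto simp: Rs numeral_2_eq_2 nilpotent_kernel_def)
    qed
  qed auto
  then have 2: "e (1 + n) R 0 (Suc b) = linear_part (C a b)"
  proof -
    assume "(\<Sum>k<1 + n. ?\<phi> k 1 *s e (1 + n) R 0 k) = (\<Sum>k<2. ?\<phi> 0 k *s e 2 ?N k 1)"
    also have "\<dots> = linear_part (C a b)" by (simp add: linear_part_def numeral_2_eq_2)
    finally show ?thesis unfolding plus_1_eq_Suc unfolding One_nat_def unfolding \<phi>sum(2) .
  qed
  show ?thesis using 1 2 unfolding T_def by simp
qed

end

section \<open>Rigidity in fixed directions\<close>

text \<open>
  With \<open>N\<close> the nilpotent tuple of \<open>r \<beta>\<close>, the sum \<open>F \<oplus> N\<close> is conjugated so that its last column is
  \<open>\<eta> F q - r p \<beta>\<close> above \<open>r \<beta>\<close> above zero, where \<open>q\<close> is the basis vector number \<open>b0\<close> and \<open>p\<close> is chosen to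
  make the upper part orthogonal to \<open>\<beta>\<close>. Orthogonality keeps the tuple in the ball for all \<open>r < 1\<close>. The
  image has last column \<open>\<eta> e F q - r p \<beta>\<close> above \<open>r \<beta>\<close>, with \<open>\<beta>\<close>-component \<open>\<epsilon>\<close> above \<open>r\<close>; its norm is at
  most one, so \<open>\<bar>\<epsilon>\<bar>\<^sup>2 \<le> 1 - r\<^sup>2\<close>. Since \<open>\<epsilon>\<close> does not depend on \<open>r\<close>, it vanishes.
\<close>

lemma (in nc_self_map) rigid_in_fixed_direction:
  assumes \<beta>: "norm \<beta> = 1"
    and fixed: "\<And>r. 0 < r \<Longrightarrow> r < 1 \<Longrightarrow> linear_part (of_real r *s \<beta>) = of_real r *s \<beta>"
    and n: "1 \<le> n" and F: "in_ball n F" and a0: "a0 < n" and b0: "b0 < n"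
  shows "cinner (e n F a0 b0) \<beta> = cinner (F a0 b0) \<beta>"
proof -
  obtain s where s: "0 \<le> s" "s < 1" "\<And>x. row_form n F x \<le> s * coord_form n x"
    using row_form_uniform_gap[OF F] by blast
  define K where "K = 4 * real n + 1"
  have K: "0 < K" by (simp add: K_def)
  \<comment> \<open>The gap \<open>s\<close> pays for the two columns added to \<open>F\<close>, whose squared size is at most \<open>K \<eta>\<^sup>2\<close>
    times the row form of \<open>F\<close>.\<close>
  define \<eta> where "\<eta> = sqrt ((1 - s) / (2 * K))"
  have \<eta>2: "\<eta>\<^sup>2 = (1 - s) / (2 * K)" and \<eta>: "0 < \<eta>" using s K by (simp_all add: \<eta>_def)
  have gap: "(1 + K * \<eta>\<^sup>2) * s < 1"
  proof -
    have "(1 + K * \<eta>\<^sup>2) * s = s + (1 - s) / 2 * s" unfolding \<eta>2 using K by (simp add: field_simps)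
    also have "\<dots> \<le> s + (1 - s) / 2 * 1" using s by (intro add_left_mono mult_left_mono) auto
    also have "\<dots> < 1" using s(2) by (simp add: field_simps)
    finally show ?thesis .
  qed
  define \<epsilon> where "\<epsilon> a = of_real \<eta> * (cinner (e n F a b0) \<beta> - cinner (F a b0) \<beta>)" for a
  define \<delta> where "\<delta> = (\<Sum>a<n. (cmod (\<epsilon> a))\<^sup>2)"
  have \<delta>_le: "\<delta> \<le> 1 - r\<^sup>2" if r: "1/2 \<le> r" "r < 1" for r
  proof -
    have r0: "0 < r" using r by simp
    \<comment> \<open>The factor \<open>1/r\<close> makes the upper part of the last column independent of \<open>r\<close>.\<close>
    define p where "p a = of_real (\<eta> / r) * cinner (F a b0) \<beta>" for a
    have rp: "of_real r * p a = of_real \<eta> * cinner (F a b0) \<beta>" for a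
      using r0 by (simp add: p_def)
    define C where "C = (\<lambda>a (j::nat). if j = 0 then (\<Sum>k<n. p k *s F a k)
      else of_real \<eta> *s F a b0 - (of_real r * p a) *s \<beta>)"
    define N where "N = nilpotent_kernel (of_real r *s \<beta>)"
    define T where "T = block_kernel n F C N"
    define \<phi> where "\<phi> = (\<lambda>a j::nat. if j = 0 then p a else if a = b0 then of_real \<eta> else 0)"
    have N_entries: "N 0 0 = 0" "N (Suc 0) 0 = 0" "N (Suc 0) (Suc 0) = 0"
      "N 0 (Suc 0) = of_real r *s \<beta>"
      by (simp_all add: N_def nilpotent_kernel_def)
    have sim: "block_similar n 2 \<phi> T"
    proof -
      have "C a j = (\<Sum>k<n. \<phi> k j *s F a k) - (\<Sum>k<2. \<phi> a k *s N k j)" if "j < 2" for a j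
      proof -
        have "j = 0 \<or> j = Suc 0" using that by auto
        then show ?thesis
          using b0 by (auto simp: C_def \<phi>_def N_entries numeral_2_eq_2 mult.commute
              if_distrib[of "\<lambda>c. c *s _"] cong: if_cong)
      qed
      then show ?thesis by (simp add: block_similar_def T_def)
    qed
    have p_le: "(\<Sum>k<n. (cmod (p k))\<^sup>2) \<le> 4 * n * \<eta>\<^sup>2"
    proof -
      have "(cmod (p k))\<^sup>2 \<le> 4 * \<eta>\<^sup>2" if "k < n" for k
      proof -
        have "cmod (p k) \<le> (\<eta> / r) * (norm (F k b0) * norm \<beta>)"
          unfolding p_def norm_mult norm_of_real using \<eta> r0 by (intro mult_mono cmod_cinner_le) auto
        also have "\<dots> \<le> (\<eta> / r) * 1"
          using in_ball_entry[OF F that b0] \<beta> \<eta> r0 by (intro mult_left_mono) auto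
        also have "\<dots> \<le> 2 * \<eta>" using r \<eta> by (simp add: field_simps)
        finally have "(cmod (p k))\<^sup>2 \<le> (2 * \<eta>)\<^sup>2" by (intro power_mono) auto
        then show ?thesis by (simp add: power_mult_distrib)
      qed
      then have "(\<Sum>k<n. (cmod (p k))\<^sup>2) \<le> (\<Sum>k<n. 4 * \<eta>\<^sup>2)" by (intro sum_mono) auto
      then show ?thesis by simp
    qed
    have T_ball: "in_ball (n + 2) T"
      unfolding in_ball_def
    proof (intro allI impI)
      fix x :: "nat \<Rightarrow> complex" assume x: "\<exists>a<n + 2. x a \<noteq> 0"
      define G where "G b = (\<Sum>a<n. x a *s F a b)" for b
      let ?Q = "row_form n F x"
      have Q: "?Q = (\<Sum>b<n. (norm (G b))\<^sup>2)" by (simp add: row_form_def G_def)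
      have c0: "(\<Sum>a<n. x a *s C a 0) = (\<Sum>k<n. p k *s G k)"
      proof -
        have "(\<Sum>a<n. x a *s C a 0) = (\<Sum>a<n. \<Sum>k<n. (x a * p k) *s F a k)"
          by (simp add: C_def vec.scale_sum_right)
        also have "\<dots> = (\<Sum>k<n. \<Sum>a<n. (p k * x a) *s F a k)"
          by (subst sum.swap) (simp only: mult.commute)
        finally show ?thesis by (simp add: G_def vec.scale_sum_right)
      qed
      have c1: "(\<Sum>a<n. x a *s C a (Suc 0)) = of_real \<eta> *s (G b0 - cinner (G b0) \<beta> *s \<beta>)"
        unfolding C_def rp G_def cinner_sum_left cinner_scale_left Finite_Cartesian_Product.vec_eq_iff
        by (simp add: sum_subtractf algebra_simps sum_distrib_left sum_distrib_right)
      have perp: "cinner (of_real \<eta> *s (G b0 - cinner (G b0) \<beta> *s \<beta>)) ((x n * of_real r) *s \<beta>) = 0"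
        by (simp add: cinner_scale_left cinner_scale_right cinner_diff_left cinner_self \<beta>)
      have "row_form (n + 2) T x = ?Q + (norm (\<Sum>k<n. p k *s G k))\<^sup>2
          + (norm (of_real \<eta> *s (G b0 - cinner (G b0) \<beta> *s \<beta>) + (x n * of_real r) *s \<beta>))\<^sup>2"
      proof -
        have "row_form (n + 2) T x = (\<Sum>b<n. (norm (G b))\<^sup>2) + (\<Sum>j<2. (norm ((\<Sum>a<n. x a *s C a j)
            + (\<Sum>a<2. x (n + a) *s N a j)))\<^sup>2)"
          unfolding row_form_def sum_lessThan_add by (simp add: T_def G_def)
        then show ?thesis
          unfolding sum_lessThan_two using Q c0 c1 by (simp add: N_entries)
      qed
      also have "\<dots> = ?Q + (norm (\<Sum>k<n. p k *s G k))\<^sup>2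
          + \<eta>\<^sup>2 * (norm (G b0 - cinner (G b0) \<beta> *s \<beta>))\<^sup>2 + r\<^sup>2 * (cmod (x n))\<^sup>2"
        unfolding norm_add_squared_orthogonal[OF perp] norm_vec_scale norm_mult using \<beta>
        by (simp add: power_mult_distrib)
      also have "\<dots> \<le> ?Q + 4 * n * \<eta>\<^sup>2 * ?Q + \<eta>\<^sup>2 * ?Q + r\<^sup>2 * (cmod (x n))\<^sup>2"
      proof (intro add_mono order_refl mult_left_mono)
        have "(norm (\<Sum>k<n. p k *s G k))\<^sup>2 \<le> (\<Sum>k<n. (cmod (p k))\<^sup>2) * ?Q"
          unfolding Q by (rule norm_sum_scale_squared_le)
        also have "\<dots> \<le> 4 * n * \<eta>\<^sup>2 * ?Q" using p_le row_form_nonneg by (intro mult_right_mono) auto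
        finally show "(norm (\<Sum>k<n. p k *s G k))\<^sup>2 \<le> 4 * n * \<eta>\<^sup>2 * ?Q" .
        have "(norm (G b0 - cinner (G b0) \<beta> *s \<beta>))\<^sup>2 \<le> (norm (G b0))\<^sup>2"
          by (rule norm_orthogonal_part_le[OF \<beta>])
        also have "\<dots> \<le> ?Q" unfolding Q using b0 by (intro member_le_sum) auto
        finally show "(norm (G b0 - cinner (G b0) \<beta> *s \<beta>))\<^sup>2 \<le> ?Q" .
      qed simp
      also have "\<dots> = (1 + K * \<eta>\<^sup>2) * ?Q + r\<^sup>2 * (cmod (x n))\<^sup>2"
        by (simp add: K_def algebra_simps)
      also have "\<dots> \<le> ((1 + K * \<eta>\<^sup>2) * s) * coord_form n x + r\<^sup>2 * (cmod (x n))\<^sup>2"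
        using mult_left_mono[OF s(3)[of x], of "1 + K * \<eta>\<^sup>2"] K by (simp add: mult.assoc)
      also have "\<dots> < coord_form n x + (cmod (x n))\<^sup>2 + (cmod (x (Suc n)))\<^sup>2"
      proof -
        have r2: "r\<^sup>2 < 1" using r by (simp add: power_less_one_iff)
        have 1: "((1 + K * \<eta>\<^sup>2) * s) * coord_form n x \<le> coord_form n x"
          using mult_right_mono[OF less_imp_le[OF gap] coord_form_nonneg[of n x]] by simp
        have 2: "r\<^sup>2 * (cmod (x n))\<^sup>2 \<le> (cmod (x n))\<^sup>2"
          using mult_right_mono[OF less_imp_le[OF r2], of "(cmod (x n))\<^sup>2"] by simp
        consider "\<exists>a<n. x a \<noteq> 0" | "x n \<noteq> 0" | "x (Suc n) \<noteq> 0"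
          using x by (metis One_nat_def add_2_eq_Suc' less_Suc_eq)
        then show ?thesis
        proof cases
          case 1
          have "((1 + K * \<eta>\<^sup>2) * s) * coord_form n x < 1 * coord_form n x"
            by (rule mult_strict_right_mono[OF gap coord_form_pos[OF 1]])
          then show ?thesis using 2 zero_le_power2[of "cmod (x (Suc n))"] by linarith
        next
          case 2
          then have "r\<^sup>2 * (cmod (x n))\<^sup>2 < 1 * (cmod (x n))\<^sup>2"
            by (intro mult_strict_right_mono[OF r2]) simp
          then show ?thesis using 1 zero_le_power2[of "cmod (x (Suc n))"] by linarith
        next
          case 3
          then have "0 < (cmod (x (Suc n)))\<^sup>2" by simp
          then show ?thesis using 1 2 by linarith
        qed
      qed
      also have "\<dots> = coord_form (n + 2) x"
        by (simp add: coord_form_def)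
      finally show "row_form (n + 2) T x < coord_form (n + 2) x" .
    qed
    have nm: "1 \<le> n" "(1::nat) \<le> 2" "1 \<le> n + 2" using n by simp_all
    have r\<beta>: "norm (of_real r *s \<beta>) < 1" using r \<beta> by (simp add: norm_vec_scale)
    have up: "e (n + 2) T a b = e n F a b" if "a < n" "b < n" for a b
      unfolding similar_upper[OF nm(1,2) T_ball sim that]
      by (rule cong[OF _ that]) (simp add: T_def)
    have lo: "e (n + 2) T (n + a) (n + b) = N a b" if "a < 2" "b < 2" for a b
    proof -
      have "e (n + 2) T (n + a) (n + b) = e 2 N a b"
        unfolding similar_lower[OF nm(1,2) T_ball sim that]
        by (rule cong[OF _ that]) (simp add: T_def)
      also have "\<dots> = N a b"
        unfolding N_def nilpotent_value[OF r\<beta> that] using r r0 by (simp add: fixed)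
      finally show ?thesis .
    qed
    have corner: "e (n + 2) T a (n + 1) = of_real \<eta> *s e n F a b0 - (of_real r * p a) *s \<beta>" if "a < n" for a
    proof -
      have "e (n + 2) T a (n + 1) = (\<Sum>k<n. \<phi> k 1 *s e n F a k) - (\<Sum>k<2. \<phi> a k *s N k 1)"
        using block_similarD(2)[OF similar[OF nm(1,2) T_ball sim] that, of 1] up[OF that] lo[of _ 1]
        by simp
      then show ?thesis
        using b0 by (simp add: \<phi>_def N_entries numeral_2_eq_2 mult.commute
            if_distrib[of "\<lambda>c. c *s _"] cong: if_cong)
    qed
    \<comment> \<open>The row vector that detects the \<open>\<beta>\<close>-components \<open>\<epsilon>\<close> and \<open>r\<close> of the last column.\<close>
    define x where "x a = (if a < n then cnj (\<epsilon> a) else if a = n then of_real r else 0)" for a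
    define H where "H = (\<Sum>a<n + 2. x a *s e (n + 2) T a (n + 1))"
    have H: "cinner H \<beta> = of_real (\<delta> + r\<^sup>2)"
    proof -
      have "H = (\<Sum>a<n. cnj (\<epsilon> a) *s (of_real \<eta> *s e n F a b0 - (of_real r * p a) *s \<beta>)) + (of_real r * of_real r) *s \<beta>"
        unfolding H_def sum_lessThan_add using lo[of 0 1] lo[of 1 1]
        by (simp add: sum_lessThan_two x_def N_entries corner[simplified])
      then have "cinner H \<beta> = (\<Sum>a<n. cnj (\<epsilon> a) * \<epsilon> a) + of_real r * of_real r"
        by (simp add: cinner_add_left cinner_sum_left cinner_scale_left cinner_diff_left cinner_self \<beta>
            rp \<epsilon>_def algebra_simps)
      also have "(\<Sum>a<n. cnj (\<epsilon> a) * \<epsilon> a) = of_real \<delta>"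
        by (simp add: \<delta>_def complex_norm_square mult.commute del: of_real_power)
      finally show ?thesis by (simp add: power2_eq_square)
    qed
    have cx: "coord_form (n + 2) x = \<delta> + r\<^sup>2"
      using r0 by (simp add: coord_form_def x_def \<delta>_def)
    have \<delta>0: "0 \<le> \<delta>" by (simp add: \<delta>_def sum_nonneg)
    have "(\<delta> + r\<^sup>2)\<^sup>2 \<le> (norm H)\<^sup>2"
    proof (intro power_mono)
      show "\<delta> + r\<^sup>2 \<le> norm H" using cmod_cinner_le[of H \<beta>] \<beta> \<delta>0 unfolding H norm_of_real by simp
    qed (use \<delta>0 in simp)
    also have "\<dots> \<le> row_form (n + 2) (e (n + 2) T) x"
      unfolding row_form_def H_def by (rule member_le_sum) auto
    also have "\<dots> \<le> \<delta> + r\<^sup>2" using in_ballD[OF ball[OF nm(3) T_ball], of x] cx by simp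
    finally have "(\<delta> + r\<^sup>2) * (\<delta> + r\<^sup>2) \<le> 1 * (\<delta> + r\<^sup>2)" by (simp add: power2_eq_square)
    moreover have "0 < \<delta> + r\<^sup>2" using \<delta>0 r0 by (simp add: add_nonneg_pos)
    ultimately have "\<delta> + r\<^sup>2 \<le> 1" by (rule mult_right_le_imp_le)
    then show ?thesis by simp
  qed
  have "\<delta> \<le> 0"
  proof (rule ccontr)
    assume "\<not> \<delta> \<le> 0"
    then have pos: "0 < \<delta>" by simp
    have "\<delta> \<le> 3/4" using \<delta>_le[of "1/2"] by (simp add: power2_eq_square)
    then have "(1/2)\<^sup>2 \<le> 1 - \<delta>/2" by (simp add: power2_eq_square)
    then have "1/2 \<le> sqrt (1 - \<delta>/2)" by (rule real_le_rsqrt)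
    moreover have "sqrt (1 - \<delta>/2) < 1" using pos by simp
    ultimately have "\<delta> \<le> 1 - (sqrt (1 - \<delta>/2))\<^sup>2" by (rule \<delta>_le)
    then show False using pos \<open>\<delta> \<le> 3/4\<close> by simp
  qed
  moreover have "(cmod (\<epsilon> a0))\<^sup>2 \<le> \<delta>"
    unfolding \<delta>_def using a0 by (intro member_le_sum) auto
  ultimately have "(cmod (\<epsilon> a0))\<^sup>2 \<le> 0" by linarith
  then show ?thesis using \<eta> by (simp add: \<epsilon>_def)
qed

context nc_self_map
begin

text \<open>
  Differentiation at the origin along the line of fixed points \<open>t v\<close>. The triangular tuple \<open>P\<close> with
  diagonal \<open>t v, 0\<close> and corner \<open>v/8\<close> is conjugate to its diagonal and hence fixed; as \<open>t \<rightarrow> 0\<close> it tends to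
  the nilpotent tuple of \<open>v/8\<close>, and \<open>difference_bound\<close> controls the limit.
\<close>

lemma linear_part_of_fixed_line:
  assumes v: "norm v = 1"
    and fixed: "\<And>t. 0 < t \<Longrightarrow> t < 1 \<Longrightarrow> e 1 (\<lambda>_ _. of_real t *s v) 0 0 = of_real t *s v"
    and r: "0 < r" "r < 1"
  shows "linear_part (of_real r *s v) = of_real r *s v"
proof -
  define w where "w = of_real (1/8) *s v"
  have w: "norm w = 1/8" by (simp add: w_def norm_vec_scale v norm_divide)
  have two: "a = 0 \<or> a = Suc 0" if "a < 2" for a :: nat using that by auto
  have bound: "norm (w - linear_part w) \<le> 8 * t" if t: "0 < t" "t \<le> 1/8" for t :: real
  proof -
    define P where "P = block_kernel 1 (\<lambda>_ _. of_real t *s v) (\<lambda>_ _. w) (\<lambda>_ _. 0)"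
    have P: "P 0 0 = of_real t *s v" "P 0 (Suc 0) = w" "P (Suc 0) 0 = 0" "P (Suc 0) (Suc 0) = 0"
      by (simp_all add: P_def block_kernel_def)
    have tv: "norm (of_real t *s v) \<le> 1/8" using t by (simp add: norm_vec_scale v)
    have P_le: "norm (P a b) \<le> 1/8" if "a < 2" "b < 2" for a b
      using two[OF that(1)] two[OF that(2)] tv by (auto simp: P w)
    have P_ball: "in_ball (1 + 1) P"
      using P_le by (intro in_ball_small_entries[of "1 + 1" P "1/8"]) auto
    let ?c = "of_real (1 / (8 * t)) :: complex"
    have cw: "?c *s (of_real t *s v) = w" using t by (simp add: w_def)
    have sim: "block_similar 1 1 (\<lambda>_ _. ?c) P"
      unfolding block_similar_def using cw by (simp add: P)
    have "e (1 + 1) P 0 0 = e 1 P 0 0"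
      by (rule similar_upper[OF _ _ P_ball sim]) simp_all
    also have "\<dots> = e 1 (\<lambda>_ _. of_real t *s v) 0 0"
      by (rule cong) (simp_all add: P)
    finally have e00: "e (1 + 1) P 0 0 = of_real t *s v" using fixed[of t] t by simp
    have "e (1 + 1) P (1 + 0) (1 + 0) = e 1 (\<lambda>a b. P (1 + a) (1 + b)) 0 0"
      by (rule similar_lower[OF _ _ P_ball sim]) simp_all
    also have "\<dots> = e 1 (\<lambda>_ _. 0) 0 0"
      by (rule cong) (simp_all add: P)
    finally have e11: "e (1 + 1) P (1 + 0) (1 + 0) = 0" using zero by simp
    have "e (1 + 1) P 0 (1 + 0) = (\<Sum>k<1. ?c *s e (1 + 1) P 0 k) - (\<Sum>k<1. ?c *s e (1 + 1) P (1 + k) (1 + 0))"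
      by (rule block_similarD(2)[OF similar[OF _ _ P_ball sim]]) simp_all
    also have "\<dots> = w" using e00 e11 cw by simp
    finally have e01: "e 2 P 0 1 = w" by (simp add: numeral_2_eq_2)
    let ?N = "nilpotent_kernel w"
    have d: "norm (?c *s (P a b - ?N a b)) \<le> 1/8" if "a < 2" "b < 2" for a b
      using two[OF that(1)] two[OF that(2)] cw w
      by (auto simp: P nilpotent_kernel_def)
    have N_le: "norm (?N a b) \<le> 1/8" for a b by (simp add: nilpotent_kernel_def w)
    have "in_ball (2 + 2) (block_kernel 2 P (\<lambda>a b. ?c *s (P a b - ?N a b)) ?N)"
    proof (rule in_ball_small_entries[where M = "1/8"])
      fix a b :: nat assume "a < 2 + 2" "b < 2 + 2"
      then have "a < 2 \<or> a - 2 < 2" "b < 2 \<or> b - 2 < 2" by auto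
      then show "norm (block_kernel 2 P (\<lambda>a b. ?c *s (P a b - ?N a b)) ?N a b) \<le> 1/8"
        unfolding block_kernel_def using P_le d N_le by auto
    qed simp
    from difference_bound[OF _ this, of 0 1]
    have "cmod ?c * norm (w - linear_part w) \<le> 1"
      by (simp add: e01[simplified] linear_part_def)
    then show ?thesis using t by (simp add: norm_divide field_simps)
  qed
  have "norm (w - linear_part w) \<le> 0"
  proof (rule field_le_epsilon)
    fix \<epsilon> :: real assume \<epsilon>: "0 < \<epsilon>"
    have "norm (w - linear_part w) \<le> 8 * min (1/8) (\<epsilon>/8)" using \<epsilon> by (intro bound) auto
    then show "norm (w - linear_part w) \<le> 0 + \<epsilon>" by simp
  qed
  then have lw: "linear_part w = w" by simp
  have rw: "of_real (8 * r) *s w = of_real r *s v" by (simp add: w_def)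
  have "norm (of_real r *s v) < 1" using r v by (simp add: norm_vec_scale)
  then have "linear_part (of_real (8 * r) *s w) = of_real (8 * r) *s linear_part w"
    using w rw by (intro linear_part_scale) simp_all
  then show ?thesis by (simp only: rw lw)
qed

text \<open>
  It suffices to treat one row \<open>a0\<close>. With \<open>\<alpha>\<close> the defect of that row from norm one, a column with
  entries in the line of \<open>u\<close> is appended that raises the squared norm of the row to \<open>1 - (1 - \<rho>) \<alpha>\<close>. The
  value of \<open>e\<close> there differs from the argument by something orthogonal to the row, so by Pythagoras
  the difference in row \<open>a0\<close> has squared norm at most \<open>(1 - \<rho>) \<alpha>\<close>, and \<open>\<rho> \<rightarrow> 1\<close> finishes the proof.
\<close>

lemma identity_on_rigid_directions:
  assumes scale: "\<And>c v. v \<in> U \<Longrightarrow> c *s v \<in> U" and u: "u \<in> U" "norm u = 1"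
    and rigid: "\<And>v n F a b. v \<in> U \<Longrightarrow> 1 \<le> n \<Longrightarrow> in_ball n F \<Longrightarrow> a < n \<Longrightarrow> b < n
      \<Longrightarrow> cinner (e n F a b) v = cinner (F a b) v"
    and n: "1 \<le> n" and F: "in_ball n F" and FU: "\<And>a b. a < n \<Longrightarrow> b < n \<Longrightarrow> F a b \<in> U"
    and a0: "a0 < n" and b0: "b0 < n"
  shows "e n F a0 b0 = F a0 b0"
proof -
  define \<alpha> where "\<alpha> = 1 - (\<Sum>b<n. (norm (F a0 b))\<^sup>2)"
  have \<alpha>: "0 < \<alpha>" using in_ball_row[OF F a0] by (simp add: \<alpha>_def)
  \<comment> \<open>Column \<open>a0\<close> of the positive definite matrix \<open>I - \<Sum>\<^sub>j X\<^sub>j X\<^sub>j\<^sup>*\<close>. The matrix \<open>w w\<^sup>* / \<alpha>\<close> is dominated by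
    that matrix by the Cauchy-Schwarz inequality for its form, with equality in the direction \<open>a0\<close>.\<close>
  define w where "w a = (if a = a0 then 1 else 0) - (\<Sum>b<n. cinner (F a b) (F a0 b))" for a
  have w0: "w a0 = of_real \<alpha>" by (simp add: w_def \<alpha>_def cinner_self)
  have schwarz: "(cmod (\<Sum>a<n. y a * w a))\<^sup>2 / \<alpha> \<le> coord_form n y - row_form n F y" for y
  proof -
    define A where "A = (\<Sum>a<n. y a * w a)"
    define Y where "Y b = (\<Sum>a<n. y a *s F a b)" for b
    define s where "s = A / of_real \<alpha>"
    have A: "A = y a0 - (\<Sum>b<n. cinner (Y b) (F a0 b))"
    proof -
      have "A = (\<Sum>a<n. y a * (if a = a0 then 1 else 0)) - (\<Sum>a<n. \<Sum>b<n. y a * cinner (F a b) (F a0 b))"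
        unfolding A_def w_def right_diff_distrib sum_subtractf sum_distrib_left by (rule refl)
      also have "(\<Sum>a<n. \<Sum>b<n. y a * cinner (F a b) (F a0 b)) = (\<Sum>b<n. \<Sum>a<n. y a * cinner (F a b) (F a0 b))"
        by (rule sum.swap)
      finally show ?thesis
        using a0 by (simp add: Y_def cinner_sum_left cinner_scale_left if_distrib cong: if_cong)
    qed
    define y' where "y' a = y a - s * (if a = a0 then 1 else 0)" for a
    have coord: "coord_form n y' = coord_form n y - 2 * Re (cnj s * y a0) + (cmod s)\<^sup>2"
    proof -
      have "(cmod (y' a))\<^sup>2 = (cmod (y a))\<^sup>2 + (if a = a0 then (cmod s)\<^sup>2 - 2 * Re (cnj s * y a0) else 0)" for a
        using cmod_diff_squared[of "y a" s] by (cases "a = a0") (simp_all add: y'_def)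
      then have "coord_form n y' = coord_form n y
          + (\<Sum>a<n. if a = a0 then (cmod s)\<^sup>2 - 2 * Re (cnj s * y a0) else 0)"
        unfolding coord_form_def by (simp only: sum.distrib)
      then show ?thesis using a0 by simp
    qed
    have "(\<Sum>a<n. y' a *s F a b) = Y b - s *s F a0 b" for b
    proof -
      have "(\<Sum>a<n. y' a *s F a b) = Y b - (\<Sum>a<n. (if a = a0 then s *s F a0 b else 0))"
        unfolding Y_def sum_subtractf[symmetric] y'_def
        by (intro sum.cong refl) (auto simp: vec.scale_left_diff_distrib)
      then show ?thesis using a0 by simp
    qed
    then have "row_form n F y' = (\<Sum>b<n. (norm (Y b))\<^sup>2 - 2 * Re (cnj s * cinner (Y b) (F a0 b))
        + (cmod s)\<^sup>2 * (norm (F a0 b))\<^sup>2)"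
      unfolding row_form_def by (simp only: norm_diff_scale_squared)
    also have "\<dots> = row_form n F y - 2 * Re (cnj s * (\<Sum>b<n. cinner (Y b) (F a0 b)))
        + (cmod s)\<^sup>2 * (\<Sum>b<n. (norm (F a0 b))\<^sup>2)"
      by (simp add: row_form_def Y_def[symmetric] sum.distrib sum_subtractf sum_distrib_left Re_sum
          del: Re_complex_of_real complex_Re_numeral times_complex.sel)
    finally have row: "row_form n F y' = row_form n F y - 2 * Re (cnj s * (\<Sum>b<n. cinner (Y b) (F a0 b)))
        + (cmod s)\<^sup>2 * (1 - \<alpha>)" by (simp add: \<alpha>_def)
    have "cnj s * A = of_real ((cmod A)\<^sup>2 / \<alpha>)"
      unfolding s_def of_real_divide complex_norm_square by (simp add: mult.commute)
    then have ReA: "Re (cnj s * A) = (cmod A)\<^sup>2 / \<alpha>" by (simp only: Re_complex_of_real)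
    have s2: "(cmod s)\<^sup>2 = (cmod A)\<^sup>2 / \<alpha>\<^sup>2"
      by (simp add: s_def norm_divide power_divide)
    have "Re (cnj s * A) = Re (cnj s * y a0) - Re (cnj s * (\<Sum>b<n. cinner (Y b) (F a0 b)))"
      unfolding A right_diff_distrib by simp
    then have "0 \<le> coord_form n y - row_form n F y - 2 * Re (cnj s * A) + (cmod s)\<^sup>2 * \<alpha>"
      using in_ballD[OF F, of y'] unfolding coord row by (simp add: algebra_simps)
    also have "\<dots> = coord_form n y - row_form n F y - (cmod A)\<^sup>2 / \<alpha>"
      unfolding ReA s2 using \<alpha> by (simp add: power2_eq_square)
    finally show ?thesis by (simp add: A_def)
  qed
  have bound: "(norm (e n F a0 b0 - F a0 b0))\<^sup>2 \<le> (1 - \<rho>) * \<alpha>" if \<rho>: "0 < \<rho>" "\<rho> < 1" for \<rho>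
  proof -
    define \<kappa> where "\<kappa> = sqrt (\<rho> / \<alpha>)"
    have \<kappa>2: "\<kappa>\<^sup>2 = \<rho> / \<alpha>" using \<rho> \<alpha> by (simp add: \<kappa>_def)
    define T where "T = block_kernel n F (\<lambda>a j. (of_real \<kappa> * w a) *s u) (\<lambda>_ _. 0)"
    have T_ball: "in_ball (n + 1) T"
      unfolding in_ball_def
    proof (intro allI impI)
      fix x :: "nat \<Rightarrow> complex" assume x: "\<exists>a<n + 1. x a \<noteq> 0"
      let ?A = "\<Sum>a<n. x a * w a"
      have "(\<Sum>a<n. x a *s ((of_real \<kappa> * w a) *s u)) = (of_real \<kappa> * ?A) *s u"
        by (simp add: vec.scale_sum_left sum_distrib_left mult_ac)
      then have "row_form (n + 1) T x = row_form n F x + (norm ((of_real \<kappa> * ?A) *s u))\<^sup>2"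
        unfolding row_form_def sum_lessThan_add by (simp add: T_def)
      also have "\<dots> = row_form n F x + \<rho> * ((cmod ?A)\<^sup>2 / \<alpha>)"
        using u by (simp add: norm_vec_scale norm_mult power_mult_distrib \<kappa>2)
      also have "\<dots> \<le> row_form n F x + \<rho> * (coord_form n x - row_form n F x)"
        using schwarz[of x] \<rho> by (intro add_left_mono mult_left_mono) auto
      also have "\<dots> < coord_form n x + (cmod (x n))\<^sup>2"
      proof (cases "\<exists>a<n. x a \<noteq> 0")
        case True
        then have "0 < coord_form n x - row_form n F x" using F by (simp add: in_ball_def)
        then have "\<rho> * (coord_form n x - row_form n F x) < 1 * (coord_form n x - row_form n F x)"
          using \<rho> by (intro mult_strict_right_mono) auto
        from add_strict_left_mono[OF this, of "row_form n F x"]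
        have "row_form n F x + \<rho> * (coord_form n x - row_form n F x) < coord_form n x"
          unfolding mult_1 by simp
        then show ?thesis by (rule less_le_trans) simp
      next
        case False
        then have "x n \<noteq> 0" using x by (metis less_Suc_eq Suc_eq_plus1)
        moreover have "row_form n F x = 0" "coord_form n x = 0"
          using False row_form_zero[of n x F] by (auto simp: coord_form_def)
        ultimately show ?thesis by simp
      qed
      also have "\<dots> = coord_form (n + 1) x" by (simp add: coord_form_def)
      finally show "row_form (n + 1) T x < coord_form (n + 1) x" .
    qed
    have n1: "1 \<le> n + 1" "a0 < n + 1" using a0 by simp_all
    have TU: "T a0 b \<in> U" if "b < n + 1" for b
    proof (cases "b < n")
      case True
      then show ?thesis using a0 FU by (simp add: T_def)
    next
      case False
      then have "b = n + 0" using that by simp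
      then show ?thesis using a0 scale[OF u(1)] unfolding T_def by (simp only: block_kernel_simps)
    qed
    define h where "h b = e (n + 1) T a0 b - T a0 b" for b
    have split: "(norm (e (n + 1) T a0 b))\<^sup>2 = (norm (T a0 b))\<^sup>2 + (norm (h b))\<^sup>2" if "b < n + 1" for b
    proof -
      have "cinner (h b) (T a0 b) = 0"
        unfolding h_def cinner_diff_left using rigid[OF TU[OF that] n1(1) T_ball n1(2) that] by simp
      from norm_add_squared_orthogonal[OF this] show ?thesis by (simp add: h_def)
    qed
    have "(\<Sum>b<n + 1. (norm (T a0 b))\<^sup>2) + (\<Sum>b<n + 1. (norm (h b))\<^sup>2)
        = (\<Sum>b<n + 1. (norm (e (n + 1) T a0 b))\<^sup>2)"
      unfolding sum.distrib[symmetric]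
      by (rule sum.cong[OF refl], rule split[symmetric]) simp
    also have "\<dots> \<le> 1" using in_ball_row[OF ball[OF n1(1) T_ball] n1(2)] by simp
    finally have total: "(\<Sum>b<n + 1. (norm (T a0 b))\<^sup>2) + (\<Sum>b<n + 1. (norm (h b))\<^sup>2) \<le> 1" .
    have T_row: "(\<Sum>b<n + 1. (norm (T a0 b))\<^sup>2) = 1 - \<alpha> + \<rho> * \<alpha>"
    proof -
      have "(\<Sum>b<n + 1. (norm (T a0 b))\<^sup>2) = (\<Sum>b<n. (norm (F a0 b))\<^sup>2) + (norm ((of_real \<kappa> * w a0) *s u))\<^sup>2"
        unfolding sum_lessThan_add using a0 by (simp add: T_def)
      also have "(norm ((of_real \<kappa> * w a0) *s u))\<^sup>2 = \<rho> * \<alpha>"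
        unfolding w0 using u \<alpha>
        by (simp add: norm_vec_scale norm_mult power_mult_distrib \<kappa>2) (simp add: power2_eq_square)
      finally show ?thesis by (simp add: \<alpha>_def)
    qed
    have "(norm (h b0))\<^sup>2 \<le> (\<Sum>b<n + 1. (norm (h b))\<^sup>2)"
      using b0 by (intro member_le_sum) auto
    then have hb: "(norm (h b0))\<^sup>2 \<le> (1 - \<rho>) * \<alpha>" using total T_row by (simp add: algebra_simps)
    have "e (n + 1) T a0 b0 = e n T a0 b0"
      by (rule upper_left(1)[OF n _ T_ball _ b0 a0]) (simp_all add: T_def)
    also have "\<dots> = e n F a0 b0" by (rule cong[OF _ a0 b0]) (simp add: T_def)
    finally have "h b0 = e n F a0 b0 - F a0 b0" using a0 b0 by (simp add: h_def T_def)
    then show ?thesis using hb by simp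
  qed
  define X where "X = (norm (e n F a0 b0 - F a0 b0))\<^sup>2"
  have "X \<le> 0"
  proof (rule field_le_epsilon)
    fix \<epsilon> :: real assume \<epsilon>: "0 < \<epsilon>"
    define \<theta> where "\<theta> = min (1/2) (\<epsilon> / \<alpha>)"
    have "X \<le> (1 - (1 - \<theta>)) * \<alpha>"
      unfolding X_def using \<epsilon> \<alpha> by (intro bound) (auto simp: \<theta>_def)
    also have "\<dots> \<le> (\<epsilon> / \<alpha>) * \<alpha>" using \<alpha> by (intro mult_right_mono) (auto simp: \<theta>_def)
    finally show "X \<le> 0 + \<epsilon>" using \<alpha> by simp
  qed
  then show ?thesis by (simp add: X_def)
qed

end

section \<open>Lipschitz continuity and holomorphy along lines\<close>

context nc_self_map
begin

text \<open>
  The bound one on \<open>c (e G - e F)\<close> from \<open>difference_bound\<close>, with \<open>c\<close> as large as the openness of the ball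
  around \<open>F \<oplus> F\<close> permits.
\<close>

lemma lipschitz_near:
  assumes n: "1 \<le> n" and F: "in_ball n F"
  obtains \<delta> where "0 < \<delta>"
    "\<And>G M a b. (\<And>a b. a < n \<Longrightarrow> b < n \<Longrightarrow> norm (G a b - F a b) \<le> M) \<Longrightarrow> M \<le> \<delta> \<Longrightarrow> a < n \<Longrightarrow> b < n
      \<Longrightarrow> norm (e n G a b - e n F a b) \<le> M / \<delta>"
proof -
  obtain \<delta> where \<delta>: "0 < \<delta>"
    "\<And>T. (\<And>a b. a < n + n \<Longrightarrow> b < n + n \<Longrightarrow> norm (T a b - block_kernel n F (\<lambda>_ _. 0) F a b) \<le> \<delta>)
      \<Longrightarrow> in_ball (n + n) T"
    using in_ball_open[OF in_ball_direct_sum[OF F F]] by blast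
  have "norm (e n G a b - e n F a b) \<le> M / \<delta>"
    if G: "\<And>a b. a < n \<Longrightarrow> b < n \<Longrightarrow> norm (G a b - F a b) \<le> M" and M: "M \<le> \<delta>" and ab: "a < n" "b < n"
    for G M a b
  proof (cases "M = 0")
    case True
    have "e n G a b = e n F a b" using G by (intro cong[OF _ ab]) (simp add: True)
    then show ?thesis by (simp add: True)
  next
    case False
    then have M0: "0 < M" using G[OF ab] norm_ge_zero[of "G a b - F a b"] by linarith
    let ?c = "of_real (\<delta> / M) :: complex"
    have c: "cmod ?c = \<delta> / M" unfolding norm_of_real using \<delta>(1) M0 by simp
    have corner_le: "norm (?c *s (G a b - F a b)) \<le> \<delta>" if "a < n" "b < n" for a b
    proof -
      have "\<delta> / M * norm (G a b - F a b) \<le> \<delta> / M * M"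
        using G[OF that] \<delta>(1) M0 by (intro mult_left_mono) auto
      then show ?thesis using M0 unfolding norm_vec_scale c by simp
    qed
    have "in_ball (n + n) (block_kernel n G (\<lambda>a b. ?c *s (G a b - F a b)) F)"
    proof (rule \<delta>(2))
      fix a b assume "a < n + n" "b < n + n"
      moreover have "norm (G a b - F a b) \<le> \<delta>" if "a < n" "b < n" for a b using G[OF that] M by linarith
      ultimately show "norm (block_kernel n G (\<lambda>a b. ?c *s (G a b - F a b)) F a b
          - block_kernel n F (\<lambda>_ _. 0) F a b) \<le> \<delta>"
        using \<delta>(1) corner_le[of a "b - n"] by (auto simp: block_kernel_def)
    qed
    from difference_bound[OF n this ab] have "\<delta> / M * norm (e n G a b - e n F a b) \<le> 1"
      unfolding c .
    then show ?thesis using \<delta>(1) M0 by (simp add: field_simps)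
  qed
  with \<delta>(1) show ?thesis by (rule that)
qed

text \<open>
  For \<open>h \<noteq> 0\<close> the difference quotient in direction \<open>H\<close> is, up to the factor \<open>c\<close>, the corner of the value of
  \<open>e\<close> at the triangular tuple \<open>E h\<close> with diagonal \<open>F + h H, F\<close> and corner \<open>c H\<close>. The tuple \<open>E h\<close> makes
  sense for \<open>h = 0\<close> too, so continuity of \<open>e\<close> at \<open>E 0\<close>, one size up, gives the derivative at size \<open>n\<close>.
\<close>

lemma entry_field_differentiable:
  assumes n: "1 \<le> n" and F: "in_ball n (\<lambda>a b. B a b + t0 *s H a b)" and ab: "a < n" "b < n"
  shows "(\<lambda>t. vec_nth (e n (\<lambda>a b. B a b + t *s H a b) a b) j) field_differentiable (at t0)"
proof -
  define F where "F = (\<lambda>a b. B a b + t0 *s H a b)"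
  have F_ball: "in_ball n F" unfolding F_def by (rule F)
  define M where "M = 1 + (\<Sum>a<n. \<Sum>b<n. norm (H a b))"
  have M: "0 < M" by (simp add: M_def sum_nonneg add_pos_nonneg)
  have H_le: "norm (H a b) \<le> M" if "a < n" "b < n" for a b
  proof -
    have "norm (H a b) \<le> (\<Sum>b<n. norm (H a b))" using that by (intro member_le_sum) auto
    also have "\<dots> \<le> (\<Sum>a<n. \<Sum>b<n. norm (H a b))"
      using that by (intro member_le_sum[of a _ "\<lambda>a. \<Sum>b<n. norm (H a b)"]) (auto simp: sum_nonneg)
    finally show ?thesis by (simp add: M_def)
  qed
  obtain \<epsilon> where \<epsilon>: "0 < \<epsilon>"
    "\<And>T. (\<And>a b. a < n + n \<Longrightarrow> b < n + n \<Longrightarrow> norm (T a b - block_kernel n F (\<lambda>_ _. 0) F a b) \<le> \<epsilon>)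
      \<Longrightarrow> in_ball (n + n) T"
    using in_ball_open[OF in_ball_direct_sum[OF F_ball F_ball]] by blast
  define c where "c = \<epsilon> / M"
  have c: "0 < c" using \<epsilon> M by (simp add: c_def)
  define E where "E h = block_kernel n (\<lambda>a b. F a b + h *s H a b) (\<lambda>a b. of_real c *s H a b) F" for h
  have scaled: "norm (h *s H a b) \<le> \<epsilon>" if "cmod h \<le> c" "a < n" "b < n" for h a b
  proof -
    have "cmod h * norm (H a b) \<le> c * M" using that H_le c by (intro mult_mono) auto
    then show ?thesis using M by (simp add: norm_vec_scale c_def)
  qed
  have E_ball: "in_ball (n + n) (E h)" if "cmod h \<le> c" for h
  proof (rule \<epsilon>(2))
    fix a b assume "a < n + n" "b < n + n"
    then show "norm (E h a b - block_kernel n F (\<lambda>_ _. 0) F a b) \<le> \<epsilon>"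
      using \<epsilon>(1) scaled[OF that, of a b] scaled[of "of_real c" a "b - n"] c
      by (auto simp: block_kernel_def E_def)
  qed
  have E0: "in_ball (n + n) (E 0)" using c by (intro E_ball) simp
  have nn: "1 \<le> n + n" using n by simp
  obtain \<delta> where \<delta>: "0 < \<delta>"
    "\<And>G M a b. (\<And>a b. a < n + n \<Longrightarrow> b < n + n \<Longrightarrow> norm (G a b - E 0 a b) \<le> M) \<Longrightarrow> M \<le> \<delta>
      \<Longrightarrow> a < n + n \<Longrightarrow> b < n + n \<Longrightarrow> norm (e (n + n) G a b - e (n + n) (E 0) a b) \<le> M / \<delta>"
    using lipschitz_near[OF nn E0] by blast
  define D where "D = of_real (1 / c) *s e (n + n) (E 0) a (n + b)"
  have quotient: "norm ((1/h) *s (e n (\<lambda>a b. F a b + h *s H a b) a b - e n F a b) - D)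
      \<le> (M / (c * \<delta>)) * cmod h"
    if h: "h \<noteq> 0" "cmod h \<le> c" "cmod h \<le> \<delta> / M" for h
  proof -
    have E_eq: "E h = block_kernel n (\<lambda>a b. F a b + h *s H a b)
        (\<lambda>a b. (of_real c / h) *s ((F a b + h *s H a b) - F a b)) F"
      unfolding E_def using h by simp
    have "e (n + n) (E h) a (n + b)
        = (of_real c / h) *s (e n (\<lambda>a b. F a b + h *s H a b) a b - e n F a b)"
      unfolding E_eq by (rule difference_corner[OF n _ ab]) (use E_ball[OF h(2)] E_eq in simp)
    then have "of_real (1/c) *s e (n + n) (E h) a (n + b)
        = (1/h) *s (e n (\<lambda>a b. F a b + h *s H a b) a b - e n F a b)"
      using c by simp
    then have "norm ((1/h) *s (e n (\<lambda>a b. F a b + h *s H a b) a b - e n F a b) - D)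
        = norm (of_real (1/c) *s (e (n + n) (E h) a (n + b) - e (n + n) (E 0) a (n + b)))"
      unfolding D_def vec.scale_right_diff_distrib by simp
    also have "\<dots> = 1/c * norm (e (n + n) (E h) a (n + b) - e (n + n) (E 0) a (n + b))"
      unfolding norm_vec_scale norm_of_real using c by simp
    also have "\<dots> \<le> 1/c * ((cmod h * M) / \<delta>)"
    proof -
      have "norm (E h a b - E 0 a b) \<le> cmod h * M" if "a < n + n" "b < n + n" for a b
        using that M H_le[of a b] by (auto simp: E_def block_kernel_def norm_vec_scale mult_left_mono)
      moreover have "cmod h * M \<le> \<delta>" using h(3) M by (simp add: field_simps)
      ultimately have "norm (e (n + n) (E h) a (n + b) - e (n + n) (E 0) a (n + b)) \<le> cmod h * M / \<delta>"
        using ab by (intro \<delta>(2)) auto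
      then show ?thesis using c by (intro mult_left_mono) auto
    qed
    finally show ?thesis by (simp add: field_simps)
  qed
  define K where "K = M / (c * \<delta>)"
  have K: "0 < K" using M c \<delta> by (simp add: K_def)
  have "(\<lambda>h. (vec_nth (e n (\<lambda>a b. B a b + (t0 + h) *s H a b) a b) j
      - vec_nth (e n (\<lambda>a b. B a b + t0 *s H a b) a b) j) / h) \<midarrow>0\<rightarrow> vec_nth D j"
  proof (rule LIM_I)
    fix r :: real assume r: "0 < r"
    define s where "s = min c (min (\<delta> / M) (r / K))"
    have s: "0 < s" using c \<delta> M r K by (simp add: s_def)
    have "norm ((vec_nth (e n (\<lambda>a b. B a b + (t0 + h) *s H a b) a b) j
      - vec_nth (e n (\<lambda>a b. B a b + t0 *s H a b) a b) j) / h - vec_nth D j) < r"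
      if h: "h \<noteq> 0" "norm (h - 0) < s" for h
    proof -
      have Fh: "(\<lambda>a b. B a b + (t0 + h) *s H a b) = (\<lambda>a b. F a b + h *s H a b)"
        by (simp add: F_def vec.scale_left_distrib add.assoc)
      have "norm ((vec_nth (e n (\<lambda>a b. B a b + (t0 + h) *s H a b) a b) j
          - vec_nth (e n (\<lambda>a b. B a b + t0 *s H a b) a b) j) / h - vec_nth D j)
          = norm (vec_nth ((1/h) *s (e n (\<lambda>a b. F a b + h *s H a b) a b - e n F a b) - D) j)"
        unfolding Fh by (simp add: F_def diff_divide_distrib)
      also have "\<dots> \<le> norm ((1/h) *s (e n (\<lambda>a b. F a b + h *s H a b) a b - e n F a b) - D)"
        by (rule Finite_Cartesian_Product.norm_nth_le)
      also have "\<dots> \<le> K * cmod h"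
        unfolding K_def using h by (intro quotient) (auto simp: s_def)
      also have "\<dots> < K * (r / K)" using h K by (intro mult_strict_left_mono) (auto simp: s_def)
      finally show ?thesis using K by simp
    qed
    then show "\<exists>s>0. \<forall>h. h \<noteq> 0 \<and> norm (h - 0) < s \<longrightarrow>
        norm ((vec_nth (e n (\<lambda>a b. B a b + (t0 + h) *s H a b) a b) j
      - vec_nth (e n (\<lambda>a b. B a b + t0 *s H a b) a b) j) / h - vec_nth D j) < r"
      using s by blast
  qed
  then show ?thesis unfolding field_differentiable_def DERIV_def by blast
qed

lemma entry_holomorphic:
  assumes n: "1 \<le> n" and F: "\<And>t. t \<in> S \<Longrightarrow> in_ball n (\<lambda>a b. B a b + t *s H a b)" and ab: "a < n" "b < n"
  shows "(\<lambda>t. vec_nth (e n (\<lambda>a b. B a b + t *s H a b) a b) j) holomorphic_on S"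
  unfolding holomorphic_on_def
  using entry_field_differentiable[OF n F ab] by (blast intro: field_differentiable_at_within)

lemma linear_part_lipschitz:
  assumes "norm \<beta> \<le> 1/8" "norm \<gamma> \<le> 1/8"
  shows "norm (linear_part \<beta> - linear_part \<gamma>) \<le> 8 * norm (\<beta> - \<gamma>)"
proof (cases "\<beta> = \<gamma>")
  case False
  let ?d = "norm (\<beta> - \<gamma>)"
  have d: "0 < ?d" using False by simp
  let ?c = "of_real (1 / (8 * ?d)) :: complex"
  have c: "cmod ?c = 1 / (8 * ?d)" unfolding norm_of_real by simp
  have "in_ball (2 + 2) (block_kernel 2 (nilpotent_kernel \<beta>)
      (\<lambda>a b. ?c *s (nilpotent_kernel \<beta> a b - nilpotent_kernel \<gamma> a b)) (nilpotent_kernel \<gamma>))"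
  proof (rule in_ball_small_entries[where M = "1/8"])
    fix a b :: nat assume "a < 2 + 2" "b < 2 + 2"
    have "norm (?c *s (\<beta> - \<gamma>)) \<le> 1/8" unfolding norm_vec_scale c using d by simp
    then show "norm (block_kernel 2 (nilpotent_kernel \<beta>)
      (\<lambda>a b. ?c *s (nilpotent_kernel \<beta> a b - nilpotent_kernel \<gamma> a b)) (nilpotent_kernel \<gamma>) a b) \<le> 1/8"
      using assms unfolding block_kernel_def nilpotent_kernel_def by simp
  qed simp
  from difference_bound[OF _ this, of 0 1]
  have "1 / (8 * ?d) * norm (linear_part \<beta> - linear_part \<gamma>) \<le> 1"
    unfolding c linear_part_def by simp
  then show ?thesis using d by (simp add: field_simps)
qed simp

end

section \<open>Maps whose scalar fixed points form a subspace\<close>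

locale nc_self_map_fixing = nc_self_map e
  for e :: "nat \<Rightarrow> 'd::finite kernel \<Rightarrow> 'd kernel" +
  fixes V :: "(complex ^ 'd) set"
  assumes subspace: "vec.subspace V"
    and fixed_scalars: "\<And>v. norm v < 1 \<Longrightarrow> e 1 (\<lambda>_ _. v) 0 0 = v \<longleftrightarrow> v \<in> V"
begin

lemma V_scale: "v \<in> V \<Longrightarrow> c *s v \<in> V"
  using subspace by (rule vec.subspace_scale)

lemma rigid:
  assumes v: "v \<in> V" and n: "1 \<le> n" and F: "in_ball n F" and ab: "a < n" "b < n"
  shows "cinner (e n F a b) v = cinner (F a b) v"
proof (cases "v = 0")
  case False
  obtain u where u: "norm u = 1" "v = of_real (norm v) *s u" "u = of_real (1 / norm v) *s v"
    using unit_multiple[OF False] .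
  have uV: "u \<in> V" using V_scale[OF v] u(3) by metis
  have "cinner (e n F a b) u = cinner (F a b) u"
  proof (rule rigid_in_fixed_direction[OF u(1) _ n F ab])
    fix r :: real assume r: "0 < r" "r < 1"
    show "linear_part (of_real r *s u) = of_real r *s u"
    proof (rule linear_part_of_fixed_line[OF u(1) _ r])
      fix t :: real assume "0 < t" "t < 1"
      then have "norm (of_real t *s u) < 1" using u(1) by (simp add: norm_vec_scale)
      then show "e 1 (\<lambda>_ _. of_real t *s u) 0 0 = of_real t *s u"
        using fixed_scalars V_scale[OF uV] by blast
    qed
  qed
  then show ?thesis by (subst (1 2) u(2)) (simp add: cinner_scale_right)
qed simp

lemma fixes_tuples_over_V:
  assumes n: "1 \<le> n" and F: "in_ball n F" and FV: "\<And>a b. a < n \<Longrightarrow> b < n \<Longrightarrow> F a b \<in> V"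
    and ab: "a < n" "b < n"
  shows "e n F a b = F a b"
proof (cases "\<exists>v\<in>V. v \<noteq> 0")
  case True
  then obtain v where v: "v \<in> V" "v \<noteq> 0" by blast
  obtain u where u: "norm u = 1" "u = of_real (1 / norm v) *s v"
    using unit_multiple[OF v(2)] .
  have "u \<in> V" using V_scale[OF v(1)] u(2) by metis
  show ?thesis
  proof (rule identity_on_rigid_directions[where U = V and u = u, OF _ _ _ _ n F _ ab])
    show "c *s v \<in> V" if "v \<in> V" for c v using that by (rule V_scale)
    show "u \<in> V" by fact
    show "norm u = 1" by fact
    show "cinner (e n F a b) v = cinner (F a b) v" if "v \<in> V" "1 \<le> n" "in_ball n F" "a < n" "b < n"
      for v n F a b using that by (rule rigid)
    show "F a b \<in> V" if "a < n" "b < n" for a b using that by (rule FV)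
  qed
next
  case False
  then have "F a b = 0" if "a < n" "b < n" for a b using FV[OF that] by blast
  then show ?thesis using zero_level[OF n _ ab, of F] ab by simp
qed

text \<open>
  The line of \<open>\<beta>\<close> consists of rigid directions by \<open>rigid_in_fixed_direction\<close>, so \<open>e\<close> is the identity on
  it; in particular the scalar point \<open>\<beta>\<close> is fixed.
\<close>

lemma linear_part_fixed_imp_V:
  assumes \<beta>: "norm \<beta> < 1" and fixed: "linear_part \<beta> = \<beta>"
  shows "\<beta> \<in> V"
proof (cases "\<beta> = 0")
  case True
  then show ?thesis using vec.subspace_0[OF subspace] by simp
next
  case False
  obtain u where u: "norm u = 1" "\<beta> = of_real (norm \<beta>) *s u" "u = of_real (1 / norm \<beta>) *s \<beta>"
    using unit_multiple[OF False] .
  have fixed_u: "linear_part (of_real r *s u) = of_real r *s u" if r: "0 < r" "r < 1" for r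
  proof -
    have eq: "of_real r *s u = of_real (r / norm \<beta>) *s \<beta>"
      by (subst u(3)) (simp add: of_real_mult[symmetric] del: of_real_mult of_real_divide)
    have "norm (of_real r *s u) < 1" using r u(1) by (simp add: norm_vec_scale)
    then have "linear_part (of_real (r / norm \<beta>) *s \<beta>) = of_real (r / norm \<beta>) *s linear_part \<beta>"
      unfolding eq by (rule linear_part_scale[OF \<beta>])
    then show ?thesis by (simp only: eq fixed)
  qed
  have "e 1 (\<lambda>_ _. \<beta>) 0 0 = \<beta>"
  proof (rule identity_on_rigid_directions[where U = "range (\<lambda>c. c *s u)" and n = 1 and F = "\<lambda>_ _. \<beta>"])
    show "c *s v \<in> range (\<lambda>c. c *s u)" if "v \<in> range (\<lambda>c. c *s u)" for c v
      using that by auto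
    show "u \<in> range (\<lambda>c. c *s u)" by (metis rangeI vec.scale_one)
    show "\<beta> \<in> range (\<lambda>c. c *s u)" using u(2) by (metis rangeI)
    show "in_ball 1 (\<lambda>_ _. \<beta>)" using \<beta> by (simp add: in_ball_one[simplified])
    fix v n a b and F :: "'d kernel"
    assume v: "v \<in> range (\<lambda>c. c *s u)" and h: "1 \<le> n" "in_ball n F" "a < n" "b < n"
    obtain c where "v = c *s u" using v by blast
    then show "cinner (e n F a b) v = cinner (F a b) v"
      using rigid_in_fixed_direction[OF u(1) fixed_u h] by (simp add: cinner_scale_right)
  qed (use u in auto)
  then show ?thesis using fixed_scalars[OF \<beta>] by simp
qed

abbreviation (input) averaged :: "nat \<Rightarrow> 'd kernel \<Rightarrow> 'd kernel" where
  "averaged \<equiv> \<lambda>n F a b. (1/2) *s (e n F a b + F a b)"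

lemma averaged_fixing: "nc_self_map_fixing averaged V"
proof -
  interpret g: nc_self_map averaged by (rule nc_self_map_average) unfold_locales
  show ?thesis
    by unfold_locales (rule subspace, simp only: average_eq_iff fixed_scalars)
qed

lemma averaged_linear_part:
  "nc_self_map.linear_part averaged \<beta> = (1/2) *s (linear_part \<beta> + \<beta>)"
proof -
  interpret g: nc_self_map averaged by (rule nc_self_map_average) unfold_locales
  have "nilpotent_kernel \<beta> 0 1 = \<beta>" by (simp add: nilpotent_kernel_def)
  then show ?thesis by (simp only: g.linear_part_def linear_part_def)
qed

text \<open>
  Equality would force \<open>linear_part y = y\<close> by the parallelogram law, hence \<open>y \<in> V\<close>. This is the reason for
  averaging with the identity: \<open>linear_part\<close> itself may have eigenvalues of modulus one other than 1.
\<close>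

lemma averaged_linear_part_strict:
  assumes y: "norm y < 1" "y \<noteq> 0" and perp: "\<And>v. v \<in> V \<Longrightarrow> cinner y v = 0"
  shows "norm ((1/2) *s (linear_part y + y)) < norm y"
proof (rule ccontr)
  let ?L = "linear_part y"
  assume "\<not> ?thesis"
  then have ge: "2 * norm y \<le> norm (?L + y)" by (simp only: norm_vec_scale) simp
  have L: "norm ?L \<le> norm y" by (rule linear_part_norm_le[OF y(1)])
  have ReI: "(norm (?L - y))\<^sup>2 + (norm (?L + y))\<^sup>2 = 2 * (norm ?L)\<^sup>2 + 2 * (norm y)\<^sup>2"
    using norm_diff_scale_squared[of ?L 1 y] norm_diff_scale_squared[of ?L "-1" y]
    by (simp add: vector_sneg_minus1[symmetric])
  have "(2 * norm y)\<^sup>2 \<le> (norm (?L + y))\<^sup>2" using ge by (intro power_mono) auto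
  then have "4 * (norm y)\<^sup>2 \<le> (norm (?L + y))\<^sup>2" by (simp add: power_mult_distrib)
  moreover have "(norm ?L)\<^sup>2 \<le> (norm y)\<^sup>2" using L by (intro power_mono) auto
  ultimately have "(norm (?L - y))\<^sup>2 \<le> 0" using ReI by linarith
  then have "?L = y" by simp
  then have "y \<in> V" by (rule linear_part_fixed_imp_V[OF y(1)])
  then have "cinner y y = 0" by (rule perp)
  then show False using y(2) by (simp add: cinner_self)
qed

text \<open>
  Compactness of a sphere in the orthogonal complement makes the strict inequality uniform. The radius
  \<open>1/8\<close> is the one for which \<open>linear_part_lipschitz\<close> is available; homogeneity does the rest.
\<close>

lemma averaged_linear_part_contraction:
  obtains q where "0 \<le> q" "q < 1"
    "\<And>y. norm y < 1 \<Longrightarrow> (\<And>v. v \<in> V \<Longrightarrow> cinner y v = 0)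
      \<Longrightarrow> norm ((1/2) *s (linear_part y + y)) \<le> q * norm y"
proof -
  define S where "S = sphere (0 :: complex ^ 'd) (1/8) \<inter> (\<Inter>v\<in>V. {y. cinner y v = 0})"
  define \<psi> where "\<psi> y = norm ((1/2) *s (linear_part y + y))" for y
  have "continuous_on UNIV (\<lambda>y. cinner y v)" for v :: "complex ^ 'd"
    unfolding cinner_def by (intro continuous_intros)
  then have "closed {y. cinner y v = 0}" for v :: "complex ^ 'd"
    by (intro closed_Collect_eq) auto
  then have S: "compact S" unfolding S_def by (intro compact_Int_closed) auto
  have L_cont: "continuous_on S linear_part"
  proof (rule continuous_onI)
    fix x \<epsilon> assume x: "x \<in> S" and \<epsilon>: "(0::real) < \<epsilon>"
    have "dist (linear_part y) (linear_part x) \<le> \<epsilon>" if "y \<in> S" "dist y x < \<epsilon>/8" for y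
      using linear_part_lipschitz[of y x] that x by (auto simp: S_def dist_norm)
    then show "\<exists>d>0. \<forall>y\<in>S. dist y x < d \<longrightarrow> dist (linear_part y) (linear_part x) \<le> \<epsilon>"
      using \<epsilon> by (intro exI[of _ "\<epsilon>/8"]) auto
  qed
  have \<psi>_eq: "\<psi> = (\<lambda>y. (1/2) * norm (linear_part y + y))"
    unfolding \<psi>_def norm_vec_scale by (simp add: norm_divide)
  have cont: "continuous_on S \<psi>"
    unfolding \<psi>_eq by (intro continuous_intros L_cont)
  obtain m where m: "0 \<le> m" "m < 1/8" "\<And>y. y \<in> S \<Longrightarrow> \<psi> y \<le> m"
  proof (cases "S = {}")
    case True
    then show ?thesis using that[of 0] by simp
  next
    case False
    obtain y0 where y0: "y0 \<in> S" "\<And>y. y \<in> S \<Longrightarrow> \<psi> y \<le> \<psi> y0"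
      using continuous_attains_sup[OF S False cont] by blast
    have "\<psi> y0 < norm y0"
      unfolding \<psi>_def using y0(1) by (intro averaged_linear_part_strict) (auto simp: S_def)
    moreover have "norm y0 = 1/8" using y0(1) by (simp add: S_def)
    ultimately show ?thesis using that[of "\<psi> y0"] y0(2) by (simp add: \<psi>_def)
  qed
  have "\<psi> y \<le> (8 * m) * norm y" if y: "norm y < 1" and perp: "\<And>v. v \<in> V \<Longrightarrow> cinner y v = 0" for y
  proof (cases "y = 0")
    case True
    have "linear_part 0 = 0" using linear_part_norm_le[of 0] by simp
    then show ?thesis by (simp add: True \<psi>_def)
  next
    case False
    let ?r = "8 * norm y"
    have r: "0 < ?r" using False by simp
    define z where "z = of_real (1 / ?r) *s y"
    have z: "norm z = 1/8" unfolding z_def norm_vec_scale norm_of_real using r by simp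
    have "z \<in> S" using z perp by (auto simp: S_def z_def cinner_scale_left)
    have yz: "y = of_real ?r *s z"
      unfolding z_def using r by (simp add: of_real_mult[symmetric] del: of_real_mult)
    have "linear_part y = of_real ?r *s linear_part z"
      using linear_part_scale[of z "of_real ?r"] z y unfolding yz[symmetric] by simp
    then have "linear_part y + y = of_real ?r *s (linear_part z + z)"
      by (subst yz) (simp only: vec.scale_right_distrib)
    then have "norm (linear_part y + y) = ?r * norm (linear_part z + z)"
      unfolding norm_vec_scale norm_of_real by (simp only: norm_vec_scale norm_of_real) simp
    then have "\<psi> y = ?r * \<psi> z" unfolding \<psi>_eq by simp
    also have "\<dots> \<le> ?r * m" using m(3)[OF \<open>z \<in> S\<close>] r by (intro mult_left_mono) auto
    finally show ?thesis by (simp add: mult_ac)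
  qed
  then show ?thesis using that[of "8 * m"] m unfolding \<psi>_def by simp
qed

end

section \<open>Iteration of the averaged map\<close>

text \<open>
  The Schwarz lemma for \<open>(f (\<rho> z) - f 0) / 3\<close>; the divisor 3 instead of 2 makes the bound on this
  function strict.
\<close>

lemma bounded_holomorphic_close_to_centre:
  assumes hol: "f holomorphic_on ball 0 \<rho>" and bd: "\<And>z. cmod z < \<rho> \<Longrightarrow> cmod (f z) \<le> 1"
    and \<rho>: "1 < \<rho>"
  shows "cmod (f 1 - f 0) \<le> 3 / \<rho>"
proof -
  have \<rho>0: "0 < \<rho>" using \<rho> by simp
  define g where "g z = (f (of_real \<rho> * z) - f 0) / 3" for z
  have in\<rho>: "cmod (of_real \<rho> * z) < \<rho>" if "cmod z < 1" for z
    using that \<rho>0 by (simp add: norm_mult)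
  have "(f \<circ> (\<lambda>z. of_real \<rho> * z)) holomorphic_on ball 0 1"
    by (rule holomorphic_on_compose_gen[OF _ hol]) (use in\<rho> in \<open>auto intro!: holomorphic_intros\<close>)
  then have g_hol: "g holomorphic_on ball 0 1"
    unfolding g_def o_def by (intro holomorphic_intros) auto
  have g_bd: "cmod (g z) < 1" if "cmod z < 1" for z
  proof -
    have "cmod (f (of_real \<rho> * z) - f 0) \<le> 1 + 1"
      using bd[OF in\<rho>[OF that]] bd[of 0] \<rho>0 by (intro order_trans[OF norm_triangle_ineq4] add_mono) auto
    then show ?thesis by (simp add: g_def norm_divide)
  qed
  have "cmod (g (of_real (1 / \<rho>))) \<le> cmod (of_real (1 / \<rho>))"
  proof (rule Schwarz_Lemma(1)[OF g_hol])
    show "g 0 = 0" by (simp add: g_def)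
    show "cmod (of_real (1 / \<rho>)) < 1" unfolding norm_of_real using \<rho> by simp
  qed (rule g_bd)
  then have "cmod (f 1 - f 0) / 3 \<le> 1 / \<rho>"
    using \<rho>0 by (simp add: g_def norm_divide)
  then show ?thesis by simp
qed

context nc_self_map_fixing
begin

text \<open>
  Since \<open>e X = X\<close>, the difference \<open>e (X + Y) - X\<close> is \<open>1/c\<close> times the corner \<open>\<Gamma> t\<close> at \<open>t = 1\<close> of the value of \<open>e\<close>
  at the tuple with diagonal \<open>t (X + Y), t X\<close> and corner \<open>c Y\<close>. At \<open>t = 0\<close> that corner is
  \<open>linear_part (c Y)\<close>, which is contracted by \<open>q\<close>. For small \<open>X\<close> and \<open>Y\<close> the function \<open>\<Gamma>\<close> is defined on a large
  disc, and there \<open>\<Gamma> 1\<close> and \<open>\<Gamma> 0\<close> are close.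
\<close>

lemma local_contraction:
  assumes q: "0 \<le> q" "q < 1"
    and contr: "\<forall>y \<in> orthogonal_complement V. norm y < 1 \<longrightarrow> norm (linear_part y) \<le> q * norm y"
    and n: "1 \<le> n"
  shows "\<exists>\<delta>>0. \<forall>X Y M.
      (\<forall>a<n. \<forall>b<n. X a b \<in> V \<and> norm (X a b) \<le> \<delta> \<and>
        Y a b \<in> orthogonal_complement V \<and> norm (Y a b) \<le> M) \<longrightarrow> M \<le> \<delta> \<longrightarrow>
      (\<forall>a<n. \<forall>b<n. norm (e n (\<lambda>a b. X a b + Y a b) a b - X a b) \<le> (1 + q) / 2 * M)"
proof -
  define d where "d = real CARD('d)"
  have d: "1 \<le> d" by (simp add: d_def Suc_leI)
  define N where "N = real n"
  have N: "1 \<le> N" using n by (simp add: N_def)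
  \<comment> \<open>Chosen so that the error \<open>(3 d / \<rho>) / c = 384 N\<^sup>2 d \<delta> M\<close> below is \<open>(1 - q) / 2 * M\<close>.\<close>
  define \<delta> where "\<delta> = (1 - q) / (768 * N\<^sup>2 * d)"
  have \<delta>: "0 < \<delta>" using q N d by (simp add: \<delta>_def)
  define \<rho> where "\<rho> = 1 / (16 * N * \<delta>)"
  have N\<delta>: "768 * N * \<delta> \<le> 1"
  proof -
    have "768 * N * \<delta> = (1 - q) / (N * d)" using N d by (simp add: \<delta>_def power2_eq_square)
    also have "\<dots> \<le> 1 / 1" using q N d mult_mono[of 1 N 1 d] by (intro frac_le) auto
    finally show ?thesis by simp
  qed
  have \<rho>: "1 < \<rho>" using N\<delta> \<delta> N by (simp add: \<rho>_def field_simps)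
  have small: "norm (e n (\<lambda>a b. X a b + Y a b) a0 b0 - X a0 b0) \<le> (1 + q) / 2 * M"
    if XV: "\<And>a b. a < n \<Longrightarrow> b < n \<Longrightarrow> X a b \<in> V"
      and X: "\<And>a b. a < n \<Longrightarrow> b < n \<Longrightarrow> norm (X a b) \<le> \<delta>"
      and perp: "\<And>a b v. a < n \<Longrightarrow> b < n \<Longrightarrow> v \<in> V \<Longrightarrow> cinner (Y a b) v = 0"
      and Y: "\<And>a b. a < n \<Longrightarrow> b < n \<Longrightarrow> norm (Y a b) \<le> M"
      and M: "M \<le> \<delta>" and ab: "a0 < n" "b0 < n"
    for X Y M a0 b0
  proof -
    have X_ball: "in_ball n X"
      using X N\<delta> \<delta> N by (intro in_ball_small_entries[of n X \<delta>]) (auto simp: N_def[symmetric])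
    have eX: "e n X a0 b0 = X a0 b0"
      by (rule fixes_tuples_over_V[OF n X_ball XV ab])
    show ?thesis
    proof (cases "M = 0")
      case True
      then have "e n (\<lambda>a b. X a b + Y a b) a0 b0 = e n X a0 b0"
        using Y by (intro cong[OF _ ab]) simp
      then show ?thesis by (simp add: eX True)
    next
      case False
      then have M0: "0 < M" using Y[OF ab] norm_ge_zero[of "Y a0 b0"] by linarith
      \<comment> \<open>All entries of the tuple of size \<open>2 n\<close> are then at most \<open>1 / (8 N)\<close> for \<open>\<bar>t\<bar> < \<rho>\<close>.\<close>
      define c where "c = 1 / (8 * N * M)"
      have c: "0 < c" using M0 N by (simp add: c_def)
      have cY: "norm (of_real c *s Y a b) \<le> 1 / (8 * N)" if "a < n" "b < n" for a b
      proof -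
        have "c * norm (Y a b) \<le> c * M" using Y[OF that] c by (intro mult_left_mono) auto
        then show ?thesis using M0 c unfolding norm_vec_scale norm_of_real by (simp add: c_def)
      qed
      define B where "B = block_kernel n (\<lambda>_ _. 0) (\<lambda>a b. of_real c *s Y a b) (\<lambda>_ _. 0)"
      define H where "H = block_kernel n (\<lambda>a b. X a b + Y a b) (\<lambda>_ _. 0) X"
      have BH: "(\<lambda>a b. B a b + t *s H a b) = block_kernel n (\<lambda>a b. t *s (X a b + Y a b))
          (\<lambda>a b. of_real c *s Y a b) (\<lambda>a b. t *s X a b)" for t
        by (intro ext) (simp add: B_def H_def block_kernel_def)
      have ball_BH: "in_ball (n + n) (\<lambda>a b. B a b + t *s H a b)" if t: "cmod t < \<rho>" for t
      proof (rule in_ball_small_entries[where M = "1 / (8 * N)"])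
        fix a b assume "a < n + n" "b < n + n"
        have "\<rho> * (\<delta> + \<delta>) = 1 / (8 * N)" using \<delta> N by (simp add: \<rho>_def)
        moreover have "norm (t *s Z) \<le> \<rho> * (\<delta> + \<delta>)" if "norm Z \<le> \<delta> + \<delta>" for Z :: "complex ^ 'd"
          unfolding norm_vec_scale using t that \<rho> by (intro mult_mono) auto
        ultimately have scaled: "norm (t *s Z) \<le> 1 / (8 * N)" if "norm Z \<le> \<delta> + \<delta>" for Z :: "complex ^ 'd"
          using that by metis
        have "norm (X a b + Y a b) \<le> \<delta> + \<delta>" if "a < n" "b < n" for a b
          using X[OF that] Y[OF that] M by (intro order_trans[OF norm_triangle_ineq] add_mono) auto
        then have S1: "norm (t *s (X a b + Y a b)) \<le> 1 / (8 * N)" if "a < n" "b < n" for a b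
          using that by (intro scaled)
        have "norm (X a b) \<le> \<delta> + \<delta>" if "a < n" "b < n" for a b
          using X[OF that] \<delta> by simp
        then have S2: "norm (t *s X a b) \<le> 1 / (8 * N)" if "a < n" "b < n" for a b
          using that by (intro scaled)
        show "norm (B a b + t *s H a b) \<le> 1 / (8 * N)"
          unfolding fun_cong[OF fun_cong[OF BH[of t]]] block_kernel_def
          using S1[of a b] S2[of "a - n" "b - n"] cY[of a "b - n"] N \<open>a < n + n\<close> \<open>b < n + n\<close>
          by auto
      qed (use N in \<open>simp add: N_def field_simps\<close>)
      define \<Gamma> where "\<Gamma> t = e (n + n) (\<lambda>a b. B a b + t *s H a b) a0 (n + b0)" for t
      have nn: "1 \<le> n + n" "a0 < n + n" "n + b0 < n + n" using n ab by auto
      have \<Gamma>_close: "cmod (vec_nth (\<Gamma> 1 - \<Gamma> 0) j) \<le> 3 / \<rho>" for j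
      proof -
        have "(\<lambda>t. vec_nth (\<Gamma> t) j) holomorphic_on ball 0 \<rho>"
          unfolding \<Gamma>_def by (rule entry_holomorphic[OF nn(1) _ nn(2,3)]) (simp add: ball_BH)
        moreover have "cmod (vec_nth (\<Gamma> t) j) \<le> 1" if "cmod t < \<rho>" for t
        proof -
          have "norm (\<Gamma> t) \<le> 1"
            unfolding \<Gamma>_def by (rule in_ball_entry[OF ball[OF nn(1) ball_BH[OF that]] nn(2,3)])
          then show ?thesis using Finite_Cartesian_Product.norm_nth_le[of "\<Gamma> t" j] by linarith
        qed
        ultimately have "cmod (vec_nth (\<Gamma> 1) j - vec_nth (\<Gamma> 0) j) \<le> 3 / \<rho>"
          using \<rho> by (rule bounded_holomorphic_close_to_centre)
        then show ?thesis by simp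
      qed
      have "norm (\<Gamma> 1 - \<Gamma> 0) \<le> (\<Sum>j\<in>UNIV. cmod (vec_nth (\<Gamma> 1 - \<Gamma> 0) j))"
        by (rule norm_vec_le_sum)
      also have "\<dots> \<le> (\<Sum>j\<in>(UNIV :: 'd set). 3 / \<rho>)" by (rule sum_mono) (rule \<Gamma>_close)
      also have "\<dots> = d * (3 / \<rho>)" by (simp add: d_def)
      finally have diff: "norm (\<Gamma> 1 - \<Gamma> 0) \<le> d * (3 / \<rho>)" .
      have B0: "(\<lambda>a b. B a b + 0 *s H a b) = B" by (simp add: fun_eq_iff)
      have \<Gamma>0: "\<Gamma> 0 = linear_part (of_real c *s Y a0 b0)"
        unfolding \<Gamma>_def B0 unfolding B_def
      proof (rule corner_linear_part[OF n cY _ ab])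
        show "real (n + n) * (1 / (8 * N)) < 1" using N by (simp add: N_def field_simps)
      qed
      have \<Gamma>1: "\<Gamma> 1 = of_real c *s (e n (\<lambda>a b. X a b + Y a b) a0 b0 - X a0 b0)"
      proof -
        have BH1: "(\<lambda>a b. B a b + 1 *s H a b) = block_kernel n (\<lambda>a b. X a b + Y a b)
          (\<lambda>a b. of_real c *s ((X a b + Y a b) - X a b)) X"
          unfolding BH by simp
        have "in_ball (n + n) (\<lambda>a b. B a b + 1 *s H a b)" using \<rho> by (intro ball_BH) simp
        then have "\<Gamma> 1 = of_real c *s (e n (\<lambda>a b. X a b + Y a b) a0 b0 - e n X a0 b0)"
          unfolding \<Gamma>_def BH1 by (rule difference_corner[OF n _ ab])
        then show ?thesis by (simp only: eX)
      qed
      have "norm (linear_part (of_real c *s Y a0 b0)) \<le> q * norm (of_real c *s Y a0 b0)"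
      proof (rule contr[rule_format])
        have "1 / (8 * N) < 1" using N by (simp add: field_simps)
        then show "norm (of_real c *s Y a0 b0) < 1" using cY[OF ab] by linarith
      qed (simp add: orthogonal_complement_def cinner_scale_left perp[OF ab])
      also have "\<dots> \<le> q * (c * M)"
        using Y[OF ab] c q unfolding norm_vec_scale norm_of_real
        by (intro mult_left_mono) (auto intro!: mult_left_mono)
      finally have "norm (\<Gamma> 0) \<le> q * (c * M)" unfolding \<Gamma>0 .
      then have "norm (\<Gamma> 1) \<le> q * (c * M) + d * (3 / \<rho>)"
        using diff norm_triangle_sub[of "\<Gamma> 1" "\<Gamma> 0"] by linarith
      then have "c * norm (e n (\<lambda>a b. X a b + Y a b) a0 b0 - X a0 b0) \<le> q * (c * M) + d * (3 / \<rho>)"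
        unfolding \<Gamma>1 norm_vec_scale norm_of_real using c by simp
      also have "d * (3 / \<rho>) = c * ((1 - q) / 2 * M)"
        using N d M0 q by (simp add: \<rho>_def c_def \<delta>_def field_simps power2_eq_square)
      also have "q * (c * M) + c * ((1 - q) / 2 * M) = c * ((1 + q) / 2 * M)"
        by (simp add: field_simps)
      finally show ?thesis using c by simp
    qed
  qed
  show ?thesis
  proof (intro exI[of _ \<delta>] conjI allI impI)
    fix X Y M a b
    assume "\<forall>a<n. \<forall>b<n. X a b \<in> V \<and> norm (X a b) \<le> \<delta> \<and>
        Y a b \<in> orthogonal_complement V \<and> norm (Y a b) \<le> M" "M \<le> \<delta>" "a < n" "b < n"
    then show "norm (e n (\<lambda>a b. X a b + Y a b) a b - X a b) \<le> (1 + q) / 2 * M"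
      by (intro small) (auto simp: orthogonal_complement_def)
  qed (rule \<delta>)
qed

text \<open>
  Rigidity freezes the \<open>V\<close>-component \<open>t X\<close> along the iteration, and \<open>local_contraction\<close> shrinks the
  orthogonal component by a fixed factor in each step.
\<close>

lemma iterates_converge_to_V:
  assumes q: "0 \<le> q" "q < 1"
    and contr: "\<forall>y \<in> orthogonal_complement V. norm y < 1 \<longrightarrow> norm (linear_part y) \<le> q * norm y"
    and n: "1 \<le> n" and XY: "\<forall>a<n. \<forall>b<n. X a b \<in> V \<and> Y a b \<in> orthogonal_complement V"
  shows "\<exists>r>0. \<forall>t. cmod t < r \<longrightarrow> (\<forall>a<n. \<forall>b<n.
      (\<lambda>k. (e n ^^ k) (\<lambda>a b. t *s (X a b + Y a b)) a b - t *s X a b) \<longlonglongrightarrow> 0)"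
proof -
  obtain \<delta>0 where \<delta>0: "0 < \<delta>0" and step: "\<forall>X Y M.
      (\<forall>a<n. \<forall>b<n. X a b \<in> V \<and> norm (X a b) \<le> \<delta>0 \<and>
        Y a b \<in> orthogonal_complement V \<and> norm (Y a b) \<le> M) \<longrightarrow> M \<le> \<delta>0 \<longrightarrow>
      (\<forall>a<n. \<forall>b<n. norm (e n (\<lambda>a b. X a b + Y a b) a b - X a b) \<le> (1 + q) / 2 * M)"
    using local_contraction[OF q contr n] by blast
  have XV: "X a b \<in> V" if "a < n" "b < n" for a b using XY that by blast
  have perp: "cinner (Y a b) v = 0" if "a < n" "b < n" "v \<in> V" for a b v
    using XY that unfolding orthogonal_complement_def by blast
  define \<delta> where "\<delta> = min \<delta>0 (1 / (4 * real n))"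
  have \<delta>: "0 < \<delta>" "\<delta> \<le> \<delta>0" "2 * \<delta> * n < 1"
  proof -
    show "0 < \<delta>" "\<delta> \<le> \<delta>0" using \<delta>0 n by (simp_all add: \<delta>_def)
    have "2 * \<delta> * n \<le> 2 * (1 / (4 * real n)) * n" unfolding \<delta>_def by (intro mult_right_mono) auto
    then show "2 * \<delta> * n < 1" using n by simp
  qed
  define m where "m = 1 + (\<Sum>a<n. \<Sum>b<n. norm (X a b) + norm (Y a b))"
  have m: "0 < m" by (simp add: m_def sum_nonneg add_pos_nonneg)
  have XY_le: "norm (X a b) \<le> m" "norm (Y a b) \<le> m" if "a < n" "b < n" for a b
  proof -
    have "norm (X a b) + norm (Y a b) \<le> (\<Sum>b<n. norm (X a b) + norm (Y a b))"
      using that by (intro member_le_sum[of b _ "\<lambda>b. norm (X a b) + norm (Y a b)"]) auto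
    also have "\<dots> \<le> (\<Sum>a<n. \<Sum>b<n. norm (X a b) + norm (Y a b))"
      using that by (intro member_le_sum[of a _ "\<lambda>a. \<Sum>b<n. norm (X a b) + norm (Y a b)"])
        (auto simp: sum_nonneg)
    finally have "norm (X a b) + norm (Y a b) \<le> m" by (simp add: m_def)
    then show "norm (X a b) \<le> m" "norm (Y a b) \<le> m"
      using norm_ge_zero[of "X a b"] norm_ge_zero[of "Y a b"] by linarith+
  qed
  define p where "p = (1 + q) / 2"
  have p: "0 \<le> p" "p < 1" using q by (simp_all add: p_def)
  show ?thesis
  proof (intro exI[of _ "\<delta> / m"] conjI allI impI)
    show "0 < \<delta> / m" using \<delta> m by simp
    fix t a0 b0 assume t: "cmod t < \<delta> / m" and ab: "a0 < n" "b0 < n"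
    define G where "G k = (e n ^^ k) (\<lambda>a b. t *s (X a b + Y a b))" for k
    have tm: "cmod t * m \<le> \<delta>" using t m by (simp add: field_simps)
    have tX: "norm (t *s X a b) \<le> \<delta>" "norm (t *s Y a b) \<le> \<delta>" if "a < n" "b < n" for a b
      using XY_le[OF that] mult_left_mono[of _ m "cmod t"] tm unfolding norm_vec_scale
      by (meson norm_ge_zero order_trans)+
    have G_step: "G (Suc k) = e n (G k)" for k by (simp add: G_def)
    have G0: "G 0 a b - t *s X a b = t *s Y a b" for a b by (simp add: G_def)
    have inv: "(\<forall>a<n. \<forall>b<n. norm (G k a b - t *s X a b) \<le> p ^ k * \<delta> \<and>
        (\<forall>v\<in>V. cinner (G k a b - t *s X a b) v = 0))" for k
    proof (induction k)
      case 0
      show ?case unfolding G0 using tX(2) perp by (simp add: cinner_scale_left)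
    next
      case (Suc k)
      define Z where "Z a b = G k a b - t *s X a b" for a b
      have GZ: "G k = (\<lambda>a b. t *s X a b + Z a b)" by (simp add: Z_def fun_eq_iff)
      have Z: "norm (Z a b) \<le> p ^ k * \<delta>" "v \<in> V \<Longrightarrow> cinner (Z a b) v = 0"
        if "a < n" "b < n" for a b v using Suc that by (simp_all add: Z_def)
      have pk: "p ^ k * \<delta> \<le> \<delta>" using p \<delta> by (simp add: mult_left_le_one_le power_le_one)
      have Gk_ball: "in_ball n (G k)"
      proof (rule in_ball_small_entries[where M = "\<delta> + \<delta>"])
        show "norm (G k a b) \<le> \<delta> + \<delta>" if "a < n" "b < n" for a b
          unfolding GZ using tX(1)[OF that] Z(1)[OF that] pk
          by (intro order_trans[OF norm_triangle_ineq] add_mono) auto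
        show "real n * (\<delta> + \<delta>) < 1" using \<delta>(3) by (simp add: algebra_simps)
      qed
      show ?case
      proof (intro allI impI conjI ballI)
        fix a b assume ab: "a < n" "b < n"
        have "norm (e n (G k) a b - t *s X a b) \<le> p * (p ^ k * \<delta>)"
        proof -
          have "\<forall>a<n. \<forall>b<n. t *s X a b \<in> V \<and> norm (t *s X a b) \<le> \<delta>0 \<and>
              Z a b \<in> orthogonal_complement V \<and> norm (Z a b) \<le> p ^ k * \<delta>"
            using V_scale[OF XV] order_trans[OF tX(1) \<delta>(2)] Z unfolding orthogonal_complement_def
            by auto
          moreover have "p ^ k * \<delta> \<le> \<delta>0" using pk \<delta>(2) by simp
          ultimately show ?thesis
            using step[rule_format, of "\<lambda>a b. t *s X a b" Z "p ^ k * \<delta>" a b] ab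
            unfolding GZ p_def[symmetric] by blast
        qed
        then show "norm (G (Suc k) a b - t *s X a b) \<le> p ^ Suc k * \<delta>"
          by (simp add: G_step mult.assoc)
        fix v assume v: "v \<in> V"
        have "cinner (G (Suc k) a b) v = cinner (G k a b) v"
          unfolding G_step by (rule rigid[OF v n Gk_ball ab])
        then show "cinner (G (Suc k) a b - t *s X a b) v = 0"
          using Z(2)[OF ab v] by (simp add: Z_def cinner_diff_left)
      qed
    qed
    have "(\<lambda>k. p ^ k * \<delta>) \<longlonglongrightarrow> 0 * \<delta>"
      by (intro tendsto_mult_right LIMSEQ_realpow_zero p)
    then have lim: "(\<lambda>k. p ^ k * \<delta>) \<longlonglongrightarrow> 0" by simp
    have "(\<lambda>k. G k a0 b0 - t *s X a0 b0) \<longlonglongrightarrow> 0"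
      by (rule Lim_null_comparison[OF _ lim]) (use inv ab in \<open>auto intro!: always_eventually\<close>)
    then show "(\<lambda>k. (e n ^^ k) (\<lambda>a b. t *s (X a b + Y a b)) a0 b0 - t *s X a0 b0) \<longlonglongrightarrow> 0"
      by (simp add: G_def)
  qed
qed

end

text \<open>
  A normal family argument: a locally uniform limit of a subsequence is holomorphic and vanishes near
  the origin, hence at 1, where the sequence is constant.
\<close>

lemma constant_limit_by_identity_theorem:
  fixes h :: "nat \<Rightarrow> complex \<Rightarrow> complex"
  assumes hol: "\<And>k. h k holomorphic_on ball 0 R" and bd: "\<And>k z. cmod z < R \<Longrightarrow> cmod (h k z) \<le> B"
    and r: "0 < r" and R: "1 < R"
    and lim: "\<And>z. cmod z < r \<Longrightarrow> (\<lambda>k. h k z) \<longlonglongrightarrow> 0"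
    and const: "\<And>k. h k 1 = c"
  shows "c = 0"
proof -
  have hol': "f holomorphic_on ball 0 R" if "f \<in> range h" for f
    using that hol by blast
  have bd': "\<exists>B. \<forall>f\<in>range h. \<forall>z\<in>K. norm (f z) \<le> B" if "compact K" "K \<subseteq> ball 0 R" for K
    using bd that by (intro exI[of _ B]) (auto simp: subset_iff)
  obtain g s where g: "g holomorphic_on ball 0 R" and s: "strict_mono (s :: nat \<Rightarrow> nat)"
    and lim_g: "\<And>z. z \<in> ball 0 R \<Longrightarrow> (\<lambda>k. h (s k) z) \<longlonglongrightarrow> g z"
  proof (rule Montel[OF open_ball hol' bd' order_refl])
    fix g s
    assume "g holomorphic_on ball 0 R" "strict_mono (s :: nat \<Rightarrow> nat)"
      "\<And>z. z \<in> ball 0 R \<Longrightarrow> (\<lambda>k. h (s k) z) \<longlonglongrightarrow> g z"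
    then show thesis by (rule that)
  qed
  have zero: "g z = 0" if "cmod z < min r R" for z
  proof -
    have "(\<lambda>k. h (s k) z) \<longlonglongrightarrow> 0"
      using LIMSEQ_subseq_LIMSEQ[OF lim s, of z] that by (simp add: o_def)
    moreover have "(\<lambda>k. h (s k) z) \<longlonglongrightarrow> g z" using that by (intro lim_g) simp
    ultimately show ?thesis using LIMSEQ_unique by blast
  qed
  have "g 1 = 0"
  proof (rule analytic_continuation_open[of "ball 0 (min r R)" "ball 0 R" g "\<lambda>_. 0"])
    show "ball (0::complex) (min r R) \<noteq> {}" using r R by simp
    show "g z = 0" if "z \<in> ball 0 (min r R)" for z using zero that by simp
  qed (use g R in auto)
  moreover have "(\<lambda>k. h (s k) 1) \<longlonglongrightarrow> g 1" using R by (intro lim_g) simp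
  ultimately show ?thesis by (simp add: const LIMSEQ_const_iff)
qed

context nc_self_map_fixing
begin

text \<open>
  The functions of \<open>t\<close> to which \<open>constant_limit_by_identity_theorem\<close> is applied are the entries of
  \<open>e\<^sup>k (t F) - t X\<close>. They are holomorphic on a disc of radius \<open>R > 1\<close> because the ball is open, and at
  \<open>t = 1\<close> they equal those of \<open>Y\<close> because \<open>F\<close> is fixed.
\<close>

lemma fixed_imp_over_V_if_contraction:
  assumes q: "0 \<le> q" "q < 1"
    and contr: "\<forall>y \<in> orthogonal_complement V. norm y < 1 \<longrightarrow> norm (linear_part y) \<le> q * norm y"
    and n: "1 \<le> n" and F: "in_ball n F" and fixed: "\<And>a b. a < n \<Longrightarrow> b < n \<Longrightarrow> e n F a b = F a b"
    and ab: "a0 < n" "b0 < n"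
  shows "F a0 b0 \<in> V"
proof -
  have "\<exists>x y. F a b = x + y \<and> x \<in> V \<and> (\<forall>v\<in>V. cinner y v = 0)" for a b
    using orthogonal_decomposition[OF subspace, of "F a b"] by metis
  then obtain X Y where XY: "\<And>a b. F a b = X a b + Y a b" "\<And>a b. X a b \<in> V"
    "\<And>a b v. v \<in> V \<Longrightarrow> cinner (Y a b) v = 0"
    by metis
  have F_eq: "F = (\<lambda>a b. X a b + Y a b)" using XY(1) by (simp add: fun_eq_iff)
  have "\<forall>a<n. \<forall>b<n. X a b \<in> V \<and> Y a b \<in> orthogonal_complement V"
    using XY(2,3) by (simp add: orthogonal_complement_def)
  from iterates_converge_to_V[OF q contr n this]
  obtain r where r: "0 < r" and lim: "\<forall>t. cmod t < r \<longrightarrow> (\<forall>a<n. \<forall>b<n.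
      (\<lambda>k. (e n ^^ k) (\<lambda>a b. t *s (X a b + Y a b)) a b - t *s X a b) \<longlonglongrightarrow> 0)"
    by blast
  obtain \<epsilon> where \<epsilon>: "0 < \<epsilon>"
    "\<And>G. (\<And>a b. a < n \<Longrightarrow> b < n \<Longrightarrow> norm (G a b - F a b) \<le> \<epsilon>) \<Longrightarrow> in_ball n G"
    using in_ball_open[OF F] by blast
  define R where "R = 1 + \<epsilon>"
  have R: "1 < R" using \<epsilon> by (simp add: R_def)
  have RF: "in_ball n (\<lambda>a b. of_real R *s F a b)"
  proof (rule \<epsilon>(2))
    fix a b assume ab: "a < n" "b < n"
    have "of_real R *s F a b - F a b = of_real \<epsilon> *s F a b"
      by (simp add: R_def vec.scale_left_distrib)
    then show "norm (of_real R *s F a b - F a b) \<le> \<epsilon>"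
      using \<epsilon>(1) in_ball_entry[OF F ab] by (simp add: norm_vec_scale)
  qed
  have tF: "in_ball n (\<lambda>a b. t *s F a b)" if t: "cmod t < R" for t
  proof -
    have "cmod (t / of_real R) \<le> 1" using t R by (simp add: norm_divide)
    from in_ball_scale[OF RF this] show ?thesis using R by simp
  qed
  have "Y a b = 0" if ab: "a < n" "b < n" for a b
  proof -
    have "vec_nth (Y a b) j = 0" for j
    proof -
      define h where "h k t = vec_nth ((e n ^^ k) (\<lambda>a b. t *s F a b) a b - t *s X a b) j" for k t
      have iter: "nc_self_map (\<lambda>n. e n ^^ k)" for k
        by (rule nc_self_map_funpow) unfold_locales
      show ?thesis
      proof (rule constant_limit_by_identity_theorem[where h = h and R = R and r = r
            and B = "1 + R * norm (X a b)"])
        fix k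
        interpret g: nc_self_map "\<lambda>n. e n ^^ k" by (rule iter)
        have "(\<lambda>t. vec_nth ((e n ^^ k) (\<lambda>a b. (\<lambda>_ _. 0) a b + t *s F a b) a b) j) holomorphic_on ball 0 R"
          by (rule g.entry_holomorphic[OF n _ ab]) (simp add: tF)
        then show "h k holomorphic_on ball 0 R"
          unfolding h_def by (auto intro!: holomorphic_intros)
        show "cmod (h k t) \<le> 1 + R * norm (X a b)" if t: "cmod t < R" for t
        proof -
          have "norm ((e n ^^ k) (\<lambda>a b. t *s F a b) a b) \<le> 1"
            by (rule in_ball_entry[OF g.ball[OF n tF[OF t]] ab])
          moreover have "norm (t *s X a b) \<le> R * norm (X a b)"
            unfolding norm_vec_scale using t by (intro mult_right_mono) auto
          ultimately have "norm ((e n ^^ k) (\<lambda>a b. t *s F a b) a b - t *s X a b) \<le> 1 + R * norm (X a b)"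
            using norm_triangle_ineq4 by (meson add_mono order_trans)
          then show ?thesis
            unfolding h_def using Finite_Cartesian_Product.norm_nth_le order_trans by blast
        qed
        have inv: "(e n ^^ k) F a b = F a b" if "a < n" "b < n" for k a b
          using that
        proof (induction k arbitrary: a b)
          case (Suc k)
          have "(e n ^^ Suc k) F a b = e n F a b"
            using cong[of n "(e n ^^ k) F" F a b] Suc by simp
          then show ?case using fixed Suc.prems by simp
        qed simp
        show "h k 1 = vec_nth (Y a b) j"
          using trans[OF inv[OF ab, of k] XY(1)[of a b]] by (simp add: h_def)
      next
        fix t assume "cmod t < r"
        from tendsto_vec_nth[OF lim[rule_format, OF this ab], of j]
        show "(\<lambda>k. h k t) \<longlonglongrightarrow> 0" unfolding h_def F_eq by simp
      qed (use r R in auto)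
    qed
    then show ?thesis by (simp add: Finite_Cartesian_Product.vec_eq_iff)
  qed
  then show ?thesis using XY(1)[of a0 b0] XY(2)[of a0 b0] ab by simp
qed

lemma fixed_imp_over_V:
  assumes n: "1 \<le> n" and F: "in_ball n F" and fixed: "\<And>a b. a < n \<Longrightarrow> b < n \<Longrightarrow> e n F a b = F a b"
    and ab: "a < n" "b < n"
  shows "F a b \<in> V"
proof -
  interpret g: nc_self_map_fixing averaged V by (rule averaged_fixing)
  obtain q where q: "0 \<le> q" "q < 1"
    "\<And>y. norm y < 1 \<Longrightarrow> (\<And>v. v \<in> V \<Longrightarrow> cinner y v = 0)
      \<Longrightarrow> norm ((1/2) *s (linear_part y + y)) \<le> q * norm y"
    using averaged_linear_part_contraction by blast
  have contr: "\<forall>y \<in> orthogonal_complement V. norm y < 1 \<longrightarrow> norm (g.linear_part y) \<le> q * norm y"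
    unfolding averaged_linear_part orthogonal_complement_def using q(3) by blast
  have g_fixed: "(1/2) *s (e n F a b + F a b) = F a b" if "a < n" "b < n" for a b
    unfolding average_eq_iff by (rule fixed[OF that])
  show ?thesis
    by (rule g.fixed_imp_over_V_if_contraction[OF q(1,2) contr n F g_fixed ab])
qed

theorem fixed_iff_over_V:
  assumes "1 \<le> n" "in_ball n F"
  shows "(\<forall>a<n. \<forall>b<n. e n F a b = F a b) \<longleftrightarrow> (\<forall>a<n. \<forall>b<n. F a b \<in> V)"
  using fixed_imp_over_V[OF assms] fixes_tuples_over_V[OF assms] by blast

end

section \<open>Fixed points of self-maps of the matrix ball\<close>

theorem theorem3p12:
  fixes f :: "'d::finite mat_tuple \<Rightarrow> 'd mat_tuple"
    and V :: "(complex ^ 'd) set"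
  assumes "nc_map_on nc_ball f"
    and "f ` nc_ball \<subseteq> nc_ball"
    and "f (\<lambda>_. 0\<^sub>m 1 1) = (\<lambda>_. 0\<^sub>m 1 1)"
    and "vec.subspace V"
    and "{X \<in> nc_ball_level 1. f X = X} = scalar_tuple ` V \<inter> nc_ball_level 1"
  shows "\<forall>n\<ge>1. \<forall>Z\<in>nc_ball_level n.
    f Z = Z \<longleftrightarrow>
    (\<forall>a :: complex ^ 'd.
      (\<forall>v\<in>V. (\<Sum>j\<in>UNIV. vec_nth a j * vec_nth v j) = 0) \<longrightarrow>
      mat_sum n (\<lambda>j. vec_nth a j \<cdot>\<^sub>m Z j) = 0\<^sub>m n n)"
proof -
  note kernel = kernel_map_nc_self_map(1)[OF assms(1-3)]
  note rep = kernel_map_tuple_of[OF assms(1-3)]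
  have fixed_iff: "f (tuple_of n F) = tuple_of n F \<longleftrightarrow> (\<forall>a<n. \<forall>b<n. kernel_map f n F a b = F a b)"
    if "1 \<le> n" "in_ball n F" for n and F :: "'d kernel"
    unfolding rep[OF that, symmetric] tuple_of_eq_iff by (rule refl)
  have scalar: "scalar_tuple v = tuple_of 1 (\<lambda>_ _. v)" for v :: "complex ^ 'd"
    by (intro ext eq_matI) (simp_all add: scalar_tuple_def)
  interpret nc_self_map_fixing "kernel_map f" V
  proof (rule nc_self_map_fixing.intro[OF kernel], unfold_locales)
    show "vec.subspace V" by (rule assms(4))
    fix v :: "complex ^ 'd" assume "norm v < 1"
    then have v: "in_ball 1 (\<lambda>_ _. v)" by (simp only: in_ball_one)
    have level: "tuple_of 1 (\<lambda>_ _. v) \<in> nc_ball_level 1" using v by (simp only: tuple_of_in_ball)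
    have "kernel_map f 1 (\<lambda>_ _. v) 0 0 = v \<longleftrightarrow> f (tuple_of 1 (\<lambda>_ _. v)) = tuple_of 1 (\<lambda>_ _. v)"
      unfolding fixed_iff[OF order_refl v] by simp
    also have "\<dots> \<longleftrightarrow> tuple_of 1 (\<lambda>_ _. v) \<in> scalar_tuple ` V"
      using assms(5) level by blast
    also have "\<dots> \<longleftrightarrow> v \<in> V"
      unfolding scalar image_iff tuple_of_eq_iff by auto
    finally show "kernel_map f 1 (\<lambda>_ _. v) 0 0 = v \<longleftrightarrow> v \<in> V" .
  qed
  have "f Z = Z \<longleftrightarrow> (\<forall>a :: complex ^ 'd. (\<forall>v\<in>V. (\<Sum>j\<in>UNIV. vec_nth a j * vec_nth v j) = 0) \<longrightarrow>
      mat_sum n (\<lambda>j. vec_nth a j \<cdot>\<^sub>m Z j) = 0\<^sub>m n n)"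
    if n: "1 \<le> n" and Z: "Z \<in> nc_ball_level n" for n Z
  proof -
    define F where "F = (\<lambda>a b. \<chi> j. Z j $$ (a, b))"
    have ZF: "Z = tuple_of n F" unfolding F_def by (rule tuple_of_entries[OF nc_ball_levelD[OF Z], symmetric])
    have F: "in_ball n F" using Z unfolding ZF by (simp only: tuple_of_in_ball)
    have "mat_sum n (\<lambda>j. vec_nth a j \<cdot>\<^sub>m Z j) = 0\<^sub>m n n \<longleftrightarrow>
        (\<forall>r<n. \<forall>s<n. (\<Sum>j\<in>UNIV. vec_nth a j * vec_nth (F r s) j) = 0)" for a
      unfolding ZF by (auto simp: mat_eq_iff mat_sum_def)
    then show ?thesis
      unfolding ZF fixed_iff[OF n F] fixed_iff_over_V[OF n F] annihilator_iff[OF assms(4)]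
      by auto
  qed
  then show ?thesis by blast
qed

end
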